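(* Let $M$ be a complete $C^1$ Finsler manifold modeled on a Banach space that admits a $C^1$ Lipschitz bump function, let $\Omega\subset M$ be a non-empty bounded open subset with $\partial\Omega\neq\emptyset$, and let $h:\partial\Omega\to\mathbb{R}$ be $1$-Lipschitz with respect to the Finsler metric $d$ of $M$. Then the function $u\colon\overline{\Omega}\to\mathbb{R}$ defined by $$u(x)=\inf\{h(y)+d(y,x): y\in\partial\Omega\}$$ is the unique viscosity solution of the eikonal equation $$\|du(x)\|_x=1\ \text{ for all }x\in\Omega,\qquad u(x)=h(x)\ \text{ for all }x\in\partial\Omega.$$
   Context: $C^1$ Finsler manifold (in the sense of Palais): a connected, paracompact $C^1$ Banach manifold $M$ modeled on a Banach space $(X,\|\cdot\|)$, with a continuous map $\|\cdot\|_M:TM\to[0,\infty)$ such that: (P1) for every $x\in M$ the restriction $\|\cdot\|_x$ of $\|\cdot\|_M$ to $T_xM$ is a norm such that for every chart $\varphi:U\to X$ with $x\in U$, the norm $v\in X\mapsto\|d\varphi^{-1}(\varphi(x))(v)\|_x$ is equivalent to $\|\cdot\|$; (P2) for every $x_0\in M$, $\varepsilon>0$ and chart $\varphi:U\to X$ with $x_0\in U$ there is an open neighborhood $W$ of $x_0$ such that for all $x\in W$, $v\in X$, $\frac{1}{1+\varepsilon}\|d\varphi^{-1}(\varphi(x_0))(v)\|_{x_0}\le\|d\varphi^{-1}(\varphi(x))(v)\|_x\le(1+\varepsilon)\|d\varphi^{-1}(\varphi(x_0))(v)\|_{x_0}$. Finsler metric: $d(p,q)$ is the infimum of the lengths $\ell(c)=\int_a^b\|c'(t)\|_{c(t)}\,dt$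 over piecewise $C^1$ paths $c:[a,b]\to M$ connecting $p$ to $q$. $M$ is complete if $(M,d)$ is a complete metric space; boundedness is with respect to $d$. $C^1$ Lipschitz bump function on $X$: a $C^1$, Lipschitz function $b:X\to\mathbb{R}$ with bounded, non-empty support. Sub/superdifferential: for $u:\overline{\Omega}\to\mathbb{R}$ and $x\in\Omega$, $D^-u(x)$ (resp. $D^+u(x)$) is the set of $dg(x)\in T_xM^*$ where $g:M\to\mathbb{R}$ is $C^1$ and $u-g$ attains a local minimum (resp. local maximum) at $x$. For $\xi\in T_xM^*$, $\|\xi\|_x$ denotes the dual norm $\sup\{|\xi(v)|:v\in T_xM,\ \|v\|_x=1\}$. Viscosity solution of the eikonal equation with boundary data $h$: a continuous function $u:\overline{\Omega}\to\mathbb{R}$ such that (i) $\|\Delta\|_x\ge1$ for all $x\in\Omega$, $\Delta\in D^-u(x)$; (ii) $\|\Lambda\|_x\le1$ for all $x\in\Omega$, $\Lambda\in D^+u(x)$; (iii) $u(x)=h(x)$ for all $x\in\partial\Omega$. *)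

theory Defs
  imports "HOL-Analysis.Analysis"
begin

section \<open>$C^1$ maps between Banach spaces\<close>

text \<open>Continuity of the derivative is with respect to the operator norm; only used for open sets.\<close>

definition C1_on :: "'a::real_normed_vector set \<Rightarrow> ('a \<Rightarrow> 'b::real_normed_vector) \<Rightarrow> bool" where
  "C1_on S f \<longleftrightarrow>
    (\<exists>f' :: 'a \<Rightarrow> 'a \<Rightarrow>\<^sub>L 'b.
      (\<forall>x\<in>S. (f has_derivative blinfun_apply (f' x)) (at x)) \<and> continuous_on S f')"

definition C1_Lipschitz_bump :: "('x::real_normed_vector \<Rightarrow> real) \<Rightarrow> bool" where
  "C1_Lipschitz_bump b \<longleftrightarrow>
    C1_on UNIV b \<and> (\<exists>L. L-lipschitz_on UNIV b) \<and>
    bounded (closure {x. b x \<noteq> 0}) \<and> closure {x. b x \<noteq> 0} \<noteq> {}"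

section \<open>$C^1$ Banach manifolds\<close>

definition paracompact_space :: "'m topology \<Rightarrow> bool" where
  "paracompact_space X \<longleftrightarrow> Hausdorff_space X \<and>
    (\<forall>\<U>. (\<forall>U\<in>\<U>. openin X U) \<and> \<Union>\<U> = topspace X \<longrightarrow>
      (\<exists>\<V>. (\<forall>V\<in>\<V>. openin X V) \<and> \<Union>\<V> = topspace X \<and>
            (\<forall>V\<in>\<V>. \<exists>U\<in>\<U>. V \<subseteq> U) \<and> locally_finite_in X \<V>))"

text \<open>The manifold is a whole type \<open>'m\<close>, the model space is the Banach space \<open>'x\<close>.
  A chart is a pair \<open>(U, \<phi>)\<close>; the values of \<open>\<phi>\<close> outside \<open>U\<close> carry no meaning.\<close>

type_synonym ('m, 'x) chart = "'m set \<times> ('m \<Rightarrow> 'x)"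

definition chart_inv :: "('m, 'x) chart \<Rightarrow> 'x \<Rightarrow> 'm" where
  "chart_inv c = inv_into (fst c) (snd c)"

definition is_chart :: "('m::t2_space, 'x::banach) chart \<Rightarrow> bool" where
  "is_chart c \<longleftrightarrow> open (fst c) \<and> open (snd c ` fst c) \<and>
    homeomorphism (fst c) (snd c ` fst c) (snd c) (chart_inv c)"

definition C1_compatible :: "('m, 'x::banach) chart \<Rightarrow> ('m, 'x) chart \<Rightarrow> bool" where
  "C1_compatible c c' \<longleftrightarrow>
    C1_on (snd c ` (fst c \<inter> fst c')) (snd c' \<circ> chart_inv c) \<and>
    C1_on (snd c' ` (fst c \<inter> fst c')) (snd c \<circ> chart_inv c')"

text \<open>The differentiable structure is given by its maximal atlas \<open>A\<close>, so that ``every chart''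
  means every element of \<open>A\<close>.\<close>

locale C1_Banach_manifold =
  fixes A :: "('m::t2_space, 'x::banach) chart set"
  assumes conn: "connected (UNIV :: 'm set)"
    and paracompact: "paracompact_space (euclidean :: 'm topology)"
    and charts: "c \<in> A \<Longrightarrow> is_chart c"
    and cover: "(\<Union>c\<in>A. fst c) = UNIV"
    and compatible: "c \<in> A \<Longrightarrow> c' \<in> A \<Longrightarrow> C1_compatible c c'"
    and maximal: "is_chart c \<Longrightarrow> (\<forall>c'\<in>A. C1_compatible c c') \<Longrightarrow> c \<in> A"

definition C1_fun :: "('m, 'x::banach) chart set \<Rightarrow> ('m \<Rightarrow> real) \<Rightarrow> bool" where
  "C1_fun A g \<longleftrightarrow> (\<forall>c\<in>A. C1_on (snd c ` fst c) (g \<circ> chart_inv c))"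

section \<open>Tangent vectors\<close>

text \<open>A tangent vector at \<open>x\<close> is an equivalence class of pairs \<open>(c, v)\<close> of a chart \<open>c\<close> at \<open>x\<close>
  and a vector \<open>v\<close> of the model space.\<close>

type_synonym ('m, 'x) tangent = "(('m, 'x) chart \<times> 'x) set"

definition tangent_rel ::
    "('m, 'x::banach) chart set \<Rightarrow> 'm \<Rightarrow> ((('m, 'x) chart \<times> 'x) \<times> (('m, 'x) chart \<times> 'x)) set" where
  "tangent_rel A x = {((c, v), (c', w)). c \<in> A \<and> c' \<in> A \<and> x \<in> fst c \<and> x \<in> fst c' \<and>
     w = frechet_derivative (snd c' \<circ> chart_inv c) (at (snd c x)) v}"

definition tangent_space :: "('m, 'x::banach) chart set \<Rightarrow> 'm \<Rightarrow> ('m, 'x) tangent set" where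
  "tangent_space A x = {(c, v). c \<in> A \<and> x \<in> fst c} // tangent_rel A x"

text \<open>\<open>chart_vec A c x v\<close> is $d\varphi^{-1}(\varphi(x))(v)$ for $c = (U,\varphi)$. For each chart
  at \<open>x\<close> it is a bijection from the model space to the tangent space, and the vector space
  structure of the tangent space is the one making these bijections linear.\<close>

definition chart_vec ::
    "('m, 'x::banach) chart set \<Rightarrow> ('m, 'x) chart \<Rightarrow> 'm \<Rightarrow> 'x \<Rightarrow> ('m, 'x) tangent" where
  "chart_vec A c x v = tangent_rel A x `` {(c, v)}"

text \<open>The topology of the tangent bundle is the one for which all the maps
  $U \times X \to TU$ induced by charts are homeomorphisms onto open sets.\<close>

definition tangent_bundle_open ::
    "('m::t2_space, 'x::banach) chart set \<Rightarrow> ('m \<times> ('m, 'x) tangent) set \<Rightarrow> bool" where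
  "tangent_bundle_open A W \<longleftrightarrow> W \<subseteq> Sigma UNIV (tangent_space A) \<and>
    (\<forall>c\<in>A. open {(x, v). x \<in> fst c \<and> (x, chart_vec A c x v) \<in> W})"

definition tangent_bundle ::
    "('m::t2_space, 'x::banach) chart set \<Rightarrow> ('m \<times> ('m, 'x) tangent) topology" where
  "tangent_bundle A = topology (tangent_bundle_open A)"

lemma istopology_tangent_bundle_open: "istopology (tangent_bundle_open A)"
  unfolding istopology_def
proof (intro conjI allI impI)
  fix S T assume "tangent_bundle_open A S" "tangent_bundle_open A T"
  moreover have "{(x, v). x \<in> fst c \<and> (x, chart_vec A c x v) \<in> S \<inter> T} =
      {(x, v). x \<in> fst c \<and> (x, chart_vec A c x v) \<in> S} \<inter>
      {(x, v). x \<in> fst c \<and> (x, chart_vec A c x v) \<in> T}" for c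
    by auto
  ultimately show "tangent_bundle_open A (S \<inter> T)"
    unfolding tangent_bundle_open_def by (simp add: le_infI1 open_Int)
next
  fix \<K> assume *: "\<forall>K\<in>\<K>. tangent_bundle_open A K"
  have "{(x, v). x \<in> fst c \<and> (x, chart_vec A c x v) \<in> \<Union>\<K>} =
      (\<Union>K\<in>\<K>. {(x, v). x \<in> fst c \<and> (x, chart_vec A c x v) \<in> K})" for c
    by auto
  with * show "tangent_bundle_open A (\<Union>\<K>)"
    unfolding tangent_bundle_open_def by (simp add: Sup_le_iff open_UN)
qed

lemma openin_tangent_bundle: "openin (tangent_bundle A) = tangent_bundle_open A"
  unfolding tangent_bundle_def by (rule topology_inverse'[OF istopology_tangent_bundle_open])

text \<open>The differential of a function at \<open>x\<close>, as a functional on the tangent space at \<open>x\<close>.\<close>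

definition differential ::
    "('m, 'x::banach) chart set \<Rightarrow> ('m \<Rightarrow> real) \<Rightarrow> 'm \<Rightarrow> ('m, 'x) tangent \<Rightarrow> real" where
  "differential A g x = (\<lambda>\<xi>\<in>tangent_space A x.
     THE r. \<forall>(c, v)\<in>\<xi>. r = frechet_derivative (g \<circ> chart_inv c) (at (snd c x)) v)"

section \<open>Finsler manifolds in the sense of Palais\<close>

definition is_norm :: "('x::real_vector \<Rightarrow> real) \<Rightarrow> bool" where
  "is_norm N \<longleftrightarrow> (\<forall>v. 0 \<le> N v) \<and> (\<forall>v. N v = 0 \<longleftrightarrow> v = 0) \<and>
    (\<forall>r v. N (r *\<^sub>R v) = \<bar>r\<bar> * N v) \<and> (\<forall>v w. N (v + w) \<le> N v + N w)"

locale C1_Finsler_manifold = C1_Banach_manifold A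
  for A :: "('m::t2_space, 'x::banach) chart set" +
  fixes F :: "'m \<Rightarrow> ('m, 'x) tangent \<Rightarrow> real"
  assumes continuous_norm: "continuous_map (tangent_bundle A) euclideanreal (\<lambda>(x, \<xi>). F x \<xi>)"
    and P1_norm: "c \<in> A \<Longrightarrow> x \<in> fst c \<Longrightarrow> is_norm (\<lambda>v. F x (chart_vec A c x v))"
    and P1_equiv: "c \<in> A \<Longrightarrow> x \<in> fst c \<Longrightarrow>
      \<exists>k>0. \<exists>K>0. \<forall>v. k * norm v \<le> F x (chart_vec A c x v) \<and> F x (chart_vec A c x v) \<le> K * norm v"
    and P2: "c \<in> A \<Longrightarrow> x0 \<in> fst c \<Longrightarrow> 0 < \<epsilon> \<Longrightarrow>
      \<exists>W. open W \<and> x0 \<in> W \<and> W \<subseteq> fst c \<and>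
        (\<forall>x\<in>W. \<forall>v. 1 / (1 + \<epsilon>) * F x0 (chart_vec A c x0 v) \<le> F x (chart_vec A c x v) \<and>
                   F x (chart_vec A c x v) \<le> (1 + \<epsilon>) * F x0 (chart_vec A c x0 v))"

section \<open>The Finsler metric\<close>

text \<open>At the end points of a closed interval \<open>S\<close> the derivatives are one-sided.\<close>

definition C1_curve_on ::
    "('m::t2_space, 'x::banach) chart set \<Rightarrow> real set \<Rightarrow> (real \<Rightarrow> 'm) \<Rightarrow> bool" where
  "C1_curve_on A S \<gamma> \<longleftrightarrow> continuous_on S \<gamma> \<and>
    (\<forall>c\<in>A. \<exists>D. (\<forall>t\<in>S \<inter> \<gamma> -` fst c. ((snd c \<circ> \<gamma>) has_vector_derivative D t) (at t within S)) \<and>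
               continuous_on (S \<inter> \<gamma> -` fst c) D)"

text \<open>\<open>P\<close> is the set of points of a subdivision of \<open>[a, b]\<close>.\<close>

definition piecewise_C1_path ::
    "('m::t2_space, 'x::banach) chart set \<Rightarrow> real \<Rightarrow> real \<Rightarrow> (real \<Rightarrow> 'm) \<Rightarrow> bool" where
  "piecewise_C1_path A a b \<gamma> \<longleftrightarrow> a < b \<and>
    (\<exists>P. finite P \<and> a \<in> P \<and> b \<in> P \<and> P \<subseteq> {a..b} \<and>
      (\<forall>s\<in>P. \<forall>t\<in>P. s < t \<and> {s<..<t} \<inter> P = {} \<longrightarrow> C1_curve_on A {s..t} \<gamma>))"

text \<open>The tangent vector represented by $(\varphi\circ\gamma)'(t)$ in every chart $\varphi$ at
  $\gamma(t)$. At the finitely many points where the curve is not differentiable the value is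
  meaningless, which does not affect the length.\<close>

definition velocity ::
    "('m, 'x::banach) chart set \<Rightarrow> (real \<Rightarrow> 'm) \<Rightarrow> real \<Rightarrow> ('m, 'x) tangent" where
  "velocity A \<gamma> t = {(c, v). c \<in> A \<and> \<gamma> t \<in> fst c \<and> v = vector_derivative (snd c \<circ> \<gamma>) (at t)}"

definition path_len ::
    "('m, 'x::banach) chart set \<Rightarrow> ('m \<Rightarrow> ('m, 'x) tangent \<Rightarrow> real) \<Rightarrow>
      real \<Rightarrow> real \<Rightarrow> (real \<Rightarrow> 'm) \<Rightarrow> real" where
  "path_len A F a b \<gamma> = integral {a..b} (\<lambda>t. F (\<gamma> t) (velocity A \<gamma> t))"

definition finsler_dist ::
    "('m::t2_space, 'x::banach) chart set \<Rightarrow> ('m \<Rightarrow> ('m, 'x) tangent \<Rightarrow> real) \<Rightarrow>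
      'm \<Rightarrow> 'm \<Rightarrow> real" where
  "finsler_dist A F p q =
    Inf {path_len A F a b \<gamma> | a b \<gamma>. piecewise_C1_path A a b \<gamma> \<and> \<gamma> a = p \<and> \<gamma> b = q}"

section \<open>Viscosity solutions of the eikonal equation\<close>

text \<open>The supremum is over a non-empty set as soon as the model space is non-trivial.\<close>

definition dual_norm ::
    "('m, 'x::banach) chart set \<Rightarrow> ('m \<Rightarrow> ('m, 'x) tangent \<Rightarrow> real) \<Rightarrow>
      'm \<Rightarrow> (('m, 'x) tangent \<Rightarrow> real) \<Rightarrow> real" where
  "dual_norm A F x \<Lambda> = Sup {\<bar>\<Lambda> \<xi>\<bar> | \<xi>. \<xi> \<in> tangent_space A x \<and> F x \<xi> = 1}"

definition local_min_on :: "'m::topological_space set \<Rightarrow> ('m \<Rightarrow> real) \<Rightarrow> 'm \<Rightarrow> bool" where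
  "local_min_on S f x \<longleftrightarrow> (\<exists>W. open W \<and> x \<in> W \<and> (\<forall>y\<in>W \<inter> S. f x \<le> f y))"

definition local_max_on :: "'m::topological_space set \<Rightarrow> ('m \<Rightarrow> real) \<Rightarrow> 'm \<Rightarrow> bool" where
  "local_max_on S f x \<longleftrightarrow> (\<exists>W. open W \<and> x \<in> W \<and> (\<forall>y\<in>W \<inter> S. f y \<le> f x))"

definition subdifferential ::
    "('m::t2_space, 'x::banach) chart set \<Rightarrow> 'm set \<Rightarrow> ('m \<Rightarrow> real) \<Rightarrow> 'm \<Rightarrow>
      (('m, 'x) tangent \<Rightarrow> real) set" where
  "subdifferential A \<Omega> u x =
    {differential A g x | g. C1_fun A g \<and> local_min_on (closure \<Omega>) (\<lambda>y. u y - g y) x}"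

definition superdifferential ::
    "('m::t2_space, 'x::banach) chart set \<Rightarrow> 'm set \<Rightarrow> ('m \<Rightarrow> real) \<Rightarrow> 'm \<Rightarrow>
      (('m, 'x) tangent \<Rightarrow> real) set" where
  "superdifferential A \<Omega> u x =
    {differential A g x | g. C1_fun A g \<and> local_max_on (closure \<Omega>) (\<lambda>y. u y - g y) x}"

text \<open>Only the values of \<open>u\<close> on the closure of \<open>\<Omega>\<close> and of \<open>h\<close> on its boundary matter.\<close>

definition eikonal_viscosity_solution ::
    "('m::t2_space, 'x::banach) chart set \<Rightarrow> ('m \<Rightarrow> ('m, 'x) tangent \<Rightarrow> real) \<Rightarrow>
      'm set \<Rightarrow> ('m \<Rightarrow> real) \<Rightarrow> ('m \<Rightarrow> real) \<Rightarrow> bool" where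
  "eikonal_viscosity_solution A F \<Omega> h u \<longleftrightarrow>
    continuous_on (closure \<Omega>) u \<and>
    (\<forall>x\<in>\<Omega>. \<forall>\<Delta>\<in>subdifferential A \<Omega> u x. 1 \<le> dual_norm A F x \<Delta>) \<and>
    (\<forall>x\<in>\<Omega>. \<forall>\<Lambda>\<in>superdifferential A \<Omega> u x. dual_norm A F x \<Lambda> \<le> 1) \<and>
    (\<forall>x\<in>frontier \<Omega>. u x = h x)"

end

theory Submission
  imports Defs
begin

text \<open>
  The function \<open>u\<close> is 1-Lipschitz, which bounds its superdifferentials, and almost optimal paths to
  the boundary make it decrease at unit rate, which bounds its subdifferentials from below.

  For uniqueness, both viscosity inequalities are converted into inequalities for metric slopes, by
  a fuzzy sum rule in a chart. The rule is a doubling of variables; the minimizer of the doubled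
  function is obtained by adding a series of rapidly decreasing \<open>C\<^sup>1\<close> bumps, and it is applied to
  a solution and a multiple of the norm of the chart at one fixed point (made steeper far away in
  the case of the superdifferential). An upper bound of the slope is integrated along paths and shows
  that a solution lies below \<open>u\<close>. A lower bound of the descending slope is incompatible in \<open>\<Omega>\<close> with
  the conclusion of Ekeland's principle, so that the Ekeland point lies on the boundary and the
  solution lies above \<open>u\<close>.
\<close>

section \<open>Calculus of $C^1$ functions\<close>

text \<open>Balls of the model space need not be compact, so minimizers have to be manufactured;
  this is what the bump function is for. The Finsler norm need not be differentiable and varies only
  continuously with the point, so neither it nor the distance can serve as a test function. By P2 it
  agrees near a point, up to a factor close to 1, with the norm of that single tangent space read in
  a chart, and slopes are compared with that fixed norm. Each comparison costs such a factor; hence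
  slope bounds are obtained for every \<open>k > 1\<close>, or refuted for \<open>k < 1\<close>, and
  the factor is removed only at the end.

  Two facts about the manifold support this. The metric is defined through curves, while continuity
  and local extrema refer to the given topology; that the two topologies agree is proved by showing
  that short curves cannot leave a chart. And test functions must be C1 on all of M, while the fuzzy
  sum rule produces functions on the model space; they are cut off and extended by zero. Both need
  closed sets of a chart to stay closed in M, which holds for small sets because paracompactness
  gives regularity.\<close>

lemma blinfun_apply_Blinfun_frechet_derivative:
  "f differentiable (at x) \<Longrightarrow>
    blinfun_apply (Blinfun (frechet_derivative f (at x))) = frechet_derivative f (at x)"
  by (meson bounded_linear_Blinfun_apply frechet_derivative_works has_derivative_bounded_linear)

text \<open>The derivative in \<open>C1_on\<close> is taken in full neighbourhoods and hence unique,
  so the witness may be taken to be the Frechet derivative. In this form the property is visibly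
  local, which \<open>C1_on_local\<close> exploits to glue.\<close>

lemma C1_on_iff:
  "C1_on S f \<longleftrightarrow> (\<forall>x\<in>S. f differentiable (at x)) \<and>
    continuous_on S (\<lambda>x. Blinfun (frechet_derivative f (at x)))"
proof
  assume "C1_on S f"
  then obtain f' where f': "\<And>x. x \<in> S \<Longrightarrow> (f has_derivative blinfun_apply (f' x)) (at x)"
    "continuous_on S f'" unfolding C1_on_def by blast
  have "Blinfun (frechet_derivative f (at x)) = f' x" if "x \<in> S" for x
    using frechet_derivative_at[OF f'(1)[OF that]] by (metis blinfun_apply_inverse)
  then show "(\<forall>x\<in>S. f differentiable (at x)) \<and>
    continuous_on S (\<lambda>x. Blinfun (frechet_derivative f (at x)))"
    using f' by (auto simp: differentiable_def cong: continuous_on_cong)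
next
  assume *: "(\<forall>x\<in>S. f differentiable (at x)) \<and>
    continuous_on S (\<lambda>x. Blinfun (frechet_derivative f (at x)))"
  then show "C1_on S f" unfolding C1_on_def
    by (intro exI[of _ "\<lambda>x. Blinfun (frechet_derivative f (at x))"])
       (auto simp: blinfun_apply_Blinfun_frechet_derivative frechet_derivative_works[THEN iffD1])
qed

lemma C1_onI:
  assumes "\<And>x. x \<in> S \<Longrightarrow> (f has_derivative blinfun_apply (f' x)) (at x)" "continuous_on S f'"
  shows "C1_on S f"
  using assms unfolding C1_on_def by blast

lemma C1_on_differentiable: "C1_on S f \<Longrightarrow> x \<in> S \<Longrightarrow> f differentiable (at x)"
  by (simp add: C1_on_iff)

lemma C1_on_has_derivative:
  "C1_on S f \<Longrightarrow> x \<in> S \<Longrightarrow> (f has_derivative frechet_derivative f (at x)) (at x)"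
  by (simp add: C1_on_differentiable frechet_derivative_works[THEN iffD1])

lemma C1_on_continuous: "C1_on S f \<Longrightarrow> continuous_on S f"
  by (meson C1_on_has_derivative continuous_at_imp_continuous_on has_derivative_continuous)

lemma C1_on_compose:
  assumes "C1_on T g" "C1_on S f" "f ` S \<subseteq> T"
  shows "C1_on S (g \<circ> f)"
proof -
  obtain f' where f': "\<And>x. x \<in> S \<Longrightarrow> (f has_derivative blinfun_apply (f' x)) (at x)"
    "continuous_on S f'" using assms(2) unfolding C1_on_def by blast
  obtain g' where g': "\<And>x. x \<in> T \<Longrightarrow> (g has_derivative blinfun_apply (g' x)) (at x)"
    "continuous_on T g'" using assms(1) unfolding C1_on_def by blast
  show ?thesis
  proof (rule C1_onI)
    fix x assume x: "x \<in> S"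
    have "((\<lambda>x. g (f x)) has_derivative (\<lambda>v. blinfun_apply (g' (f x)) (blinfun_apply (f' x) v))) (at x)"
      using assms(3) x by (intro has_derivative_compose[OF f'(1) g'(1)]) auto
    then show "(g \<circ> f has_derivative blinfun_apply (g' (f x) o\<^sub>L f' x)) (at x)"
      by (simp add: o_def blinfun_compose.rep_eq)
  next
    have "continuous_on S (\<lambda>x. g' (f x))"
      using continuous_on_compose2[OF g'(2) C1_on_continuous[OF assms(2)]] assms(3) by blast
    then show "continuous_on S (\<lambda>x. g' (f x) o\<^sub>L f' x)"
      by (rule bounded_bilinear.continuous_on[OF bounded_bilinear_blinfun_compose _ f'(2)])
  qed
qed

lemma C1_on_mult:
  fixes f g :: "'a::real_normed_vector \<Rightarrow> real"
  assumes "C1_on S f" "C1_on S g"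
  shows "C1_on S (\<lambda>x. f x * g x)"
proof -
  obtain f' where f': "\<And>x. x \<in> S \<Longrightarrow> (f has_derivative blinfun_apply (f' x)) (at x)"
    "continuous_on S f'" using assms(1) unfolding C1_on_def by blast
  obtain g' where g': "\<And>x. x \<in> S \<Longrightarrow> (g has_derivative blinfun_apply (g' x)) (at x)"
    "continuous_on S g'" using assms(2) unfolding C1_on_def by blast
  show ?thesis
  proof (rule C1_onI)
    fix x assume "x \<in> S"
    then show "((\<lambda>x. f x * g x) has_derivative blinfun_apply (f x *\<^sub>R g' x + g x *\<^sub>R f' x)) (at x)"
      by (auto intro!: derivative_eq_intros f' g' simp: blinfun.bilinear_simps algebra_simps)
  next
    show "continuous_on S (\<lambda>x. f x *\<^sub>R g' x + g x *\<^sub>R f' x)"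
      by (intro continuous_intros f' g' C1_on_continuous assms)
  qed
qed

lemma C1_on_transform:
  assumes "C1_on T g" "open T" "\<And>x. x \<in> T \<Longrightarrow> f x = g x"
  shows "C1_on T f"
proof -
  obtain g' where g': "\<And>x. x \<in> T \<Longrightarrow> (g has_derivative blinfun_apply (g' x)) (at x)"
    "continuous_on T g'" using assms(1) unfolding C1_on_def by blast
  have "(f has_derivative blinfun_apply (g' x)) (at x)" if "x \<in> T" for x
    using has_derivative_transform_within_open[OF g'(1)[OF that] assms(2) that] assms(3) by simp
  then show ?thesis using g'(2) by (rule C1_onI)
qed

lemma C1_on_local:
  assumes "\<And>x. x \<in> S \<Longrightarrow> \<exists>T. open T \<and> x \<in> T \<and> C1_on T f"
  shows "C1_on S f"
  unfolding C1_on_iff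
proof (intro conjI ballI)
  fix x assume "x \<in> S"
  then show "f differentiable (at x)" using assms C1_on_differentiable by blast
next
  show "continuous_on S (\<lambda>x. Blinfun (frechet_derivative f (at x)))"
  proof (rule continuous_at_imp_continuous_on, rule ballI)
    fix x assume "x \<in> S"
    then obtain T where T: "open T" "x \<in> T" "C1_on T f" using assms by blast
    then show "isCont (\<lambda>x. Blinfun (frechet_derivative f (at x))) x"
      by (simp add: C1_on_iff continuous_on_eq_continuous_at)
  qed
qed

lemma C1_on_const: "C1_on S (\<lambda>x. c)"
  by (rule C1_onI[where f'="\<lambda>x. 0"]) (auto intro!: derivative_eq_intros simp: zero_blinfun.rep_eq)

lemma C1_on_affine: "C1_on S (\<lambda>x::'a::real_normed_vector. r *\<^sub>R (x - a))"
  by (rule C1_onI[where f'="\<lambda>x. r *\<^sub>R id_blinfun"])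
     (auto intro!: derivative_eq_intros simp: blinfun.bilinear_simps)

lemma C1_on_minus:
  fixes f :: "'a::real_normed_vector \<Rightarrow> real"
  assumes "C1_on S f" shows "C1_on S (\<lambda>x. - f x)"
  using C1_on_mult[OF C1_on_const[of S "-1"] assms] by simp

text \<open>Only a one-sided estimate along one ray is required. This suits test functions that
  touch a nonsmooth function: the estimate of the nonsmooth function is inherited by their
  derivative.\<close>

lemma directional_derivative_le:
  fixes g :: "'a::real_normed_vector \<Rightarrow> real"
  assumes "(g has_derivative T) (at x)"
    and "\<forall>\<^sub>F t in at_right 0. g (x + t *\<^sub>R v) - g x \<le> t * C"
  shows "T v \<le> C"
proof -
  interpret T: bounded_linear T using assms(1) by (rule has_derivative_bounded_linear)
  have "((\<lambda>t. g (x + t *\<^sub>R v)) has_derivative (\<lambda>t. T (t *\<^sub>R v))) (at 0)"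
    by (rule has_derivative_compose[where f="\<lambda>t. x + t *\<^sub>R v" and g=g])
       (auto intro!: derivative_eq_intros assms(1))
  then have "((\<lambda>t. g (x + t *\<^sub>R v)) has_real_derivative T v) (at 0)"
    by (simp add: has_field_derivative_def T.scaleR mult_commute_abs)
  then have "((\<lambda>t. (g (x + t *\<^sub>R v) - g x) / t) \<longlongrightarrow> T v) (at_right 0)"
    by (simp add: DERIV_def filterlim_at_split)
  moreover have "\<forall>\<^sub>F t in at_right 0. (g (x + t *\<^sub>R v) - g x) / t \<le> C"
    using assms(2) eventually_at_right_less[of 0]
    by eventually_elim (simp add: divide_le_eq mult.commute)
  ultimately show ?thesis
    by (rule tendsto_upperbound) simp
qed

section \<open>Smooth cutoff functions\<close>

text \<open>A normal form for bump functions. The plateau of radius \<delta> makes a cut-off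
  function agree with the original near the centre; the uniform bound B lets series of shrinking
  copies converge together with their derivatives.\<close>

locale smooth_cutoff =
  fixes \<beta> :: "'x::banach \<Rightarrow> real" and \<beta>' :: "'x \<Rightarrow> 'x \<Rightarrow>\<^sub>L real" and B \<delta> :: real
  assumes has_deriv: "(\<beta> has_derivative blinfun_apply (\<beta>' x)) (at x)"
    and continuous_deriv: "continuous_on UNIV \<beta>'"
    and norm_deriv: "norm (\<beta>' x) \<le> B"
    and nonneg: "0 \<le> \<beta> x" and le_one: "\<beta> x \<le> 1"
    and delta_pos: "0 < \<delta>"
    and eq_one: "norm x \<le> \<delta> \<Longrightarrow> \<beta> x = 1"
    and eq_zero: "1 \<le> norm x \<Longrightarrow> \<beta> x = 0"
begin

lemma B_nonneg: "0 \<le> B"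
  using norm_deriv[of 0] norm_ge_zero order_trans by blast

lemma continuous: "continuous_on S \<beta>"
  using has_deriv continuous_at_imp_continuous_on has_derivative_continuous by blast

lemma C1: "C1_on S \<beta>"
  by (rule C1_onI[where f'=\<beta>']) (auto intro: has_deriv continuous_on_subset[OF continuous_deriv])

lemma zero: "\<beta> 0 = 1"
  using eq_one[of 0] delta_pos by simp

end

lemma has_real_derivative_max_square:
  "((\<lambda>s::real. (max 0 s)^2) has_real_derivative 2 * max 0 s) (at s)"
proof (cases "s = 0")
  case True
  have "((\<lambda>h::real. (max 0 h)^2 / h) \<longlongrightarrow> 0) (at 0)"
  proof (rule Lim_null_comparison)
    show "\<forall>\<^sub>F h::real in at 0. norm ((max 0 h)\<^sup>2 / h) \<le> \<bar>h\<bar>"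
      by (rule always_eventually) (auto simp: max_def power2_eq_square)
    show "((\<lambda>h::real. \<bar>h\<bar>) \<longlongrightarrow> 0) (at 0)"
      by (rule tendsto_rabs_zero) (rule tendsto_ident_at)
  qed
  then show ?thesis using True by (simp add: DERIV_def)
next
  case False
  show ?thesis
  proof (cases "s < 0")
    case True
    have "((\<lambda>s::real. 0::real) has_real_derivative 2 * max 0 s) (at s)" using True by auto
    then show ?thesis
      by (rule has_field_derivative_transform_within_open[where S="{..<0}"]) (use True in auto)
  next
    case 2: False
    have "((\<lambda>s::real. s^2) has_real_derivative 2 * max 0 s) (at s)"
      using 2 False by (auto intro!: derivative_eq_intros)
    then show ?thesis
      by (rule has_field_derivative_transform_within_open[where S="{0<..}"]) (use 2 False in auto)
  qed
qed

text \<open>A C1 step from 0 (for \<open>s \<le> 0\<close>) to 1 (for \<open>s \<ge> 1\<close>),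
  equal to \<open>1 - (1 - s^2)^2\<close> in between. Writing it with truncated squares reduces its
  derivative to the chain rule and \<open>has_real_derivative_max_square\<close>.\<close>

definition smooth_step :: "real \<Rightarrow> real" where
  "smooth_step s = 1 - (max 0 (1 - (max 0 s)^2))^2"

definition smooth_step' :: "real \<Rightarrow> real" where
  "smooth_step' s = 4 * max 0 (1 - (max 0 s)^2) * max 0 s"

lemma smooth_step_deriv: "(smooth_step has_real_derivative smooth_step' s) (at s)"
proof -
  have "((\<lambda>s. 1 - (max 0 s)^2) has_real_derivative - (2 * max 0 s)) (at s)"
    using DERIV_diff[OF DERIV_const[of 1] has_real_derivative_max_square] by simp
  from DERIV_chain2[OF has_real_derivative_max_square this]
  have "((\<lambda>s. 1 - (max 0 (1 - (max 0 s)^2))^2) has_real_derivative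
      0 - 2 * max 0 (1 - (max 0 s)^2) * - (2 * max 0 s)) (at s)"
    by (intro DERIV_diff DERIV_const)
  then show ?thesis
    unfolding smooth_step_def[abs_def] smooth_step'_def by (simp add: algebra_simps)
qed

lemma smooth_step'_bound: "\<bar>smooth_step' s\<bar> \<le> 4"
proof -
  have "max 0 (1 - (max 0 s)^2) * max 0 s \<le> 1 * 1"
  proof (cases "s \<le> 1")
    case True
    then show ?thesis by (intro mult_mono) auto
  next
    case False
    then have "s^2 \<ge> 1" by (simp add: one_le_power)
    then show ?thesis using False by simp
  qed
  then show ?thesis unfolding smooth_step'_def by (simp add: abs_mult algebra_simps)
qed

text \<open>Translate the bump to a point where it does not vanish, rescale, and compose with
  \<open>smooth_step\<close>. The Lipschitz constant bounds the derivative, which the C1 property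
  alone would not.\<close>

lemma ex_smooth_cutoff:
  fixes b :: "'x::banach \<Rightarrow> real"
  assumes "C1_Lipschitz_bump b"
  shows "\<exists>\<beta> \<beta>' B \<delta>. smooth_cutoff (\<beta> :: 'x \<Rightarrow> real) \<beta>' B \<delta>"
proof -
  obtain b' where b': "\<And>x. (b has_derivative blinfun_apply (b' x)) (at x)" "continuous_on UNIV b'"
    using assms unfolding C1_Lipschitz_bump_def C1_on_def by auto
  obtain L where L: "L-lipschitz_on UNIV b" using assms unfolding C1_Lipschitz_bump_def by auto
  have bn: "norm (b' x) \<le> L" for x
  proof (rule norm_blinfun_bound)
    show "0 \<le> L" using L by (rule lipschitz_on_nonneg)
    fix v
    have "b' x w \<le> L * norm w" for w
    proof (rule directional_derivative_le[OF b'(1)])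
      show "\<forall>\<^sub>F t in at_right 0. b (x + t *\<^sub>R w) - b x \<le> t * (L * norm w)"
        using eventually_at_right_less[of 0]
      proof eventually_elim
        case (elim t)
        then show ?case
          using lipschitz_onD[OF L, of "x + t *\<^sub>R w" x] by (simp add: dist_norm algebra_simps abs_le_iff)
      qed
    qed
    from this[of v] this[of "-v"] show "norm (b' x v) \<le> L * norm v"
      by (simp add: blinfun.bilinear_simps abs_le_iff)
  qed
  obtain x0 where x0: "b x0 \<noteq> 0"
    using assms unfolding C1_Lipschitz_bump_def by force
  have "bounded {x. b x \<noteq> 0}"
    using assms unfolding C1_Lipschitz_bump_def using bounded_subset closure_subset by blast
  then obtain R0 where R0: "\<And>x. b x \<noteq> 0 \<Longrightarrow> norm x \<le> R0"
    unfolding bounded_iff by blast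
  have R0p: "0 \<le> R0" using R0[OF x0] norm_ge_zero order_trans by blast
  \<comment> \<open>With this dilation the outside of the unit ball is sent to points of norm
    greater than \<open>R0\<close>, where \<open>b\<close> vanishes.\<close>
  define R where "R = R0 + norm x0 + 1"
  have R: "R > 0" using R0p unfolding R_def by (simp add: add_nonneg_pos)
  \<comment> \<open>Whatever the sign of \<open>b x0\<close>, the rescaled function has the value 2
    at 0. It therefore stays above 1, where the step is constant, on a whole ball.\<close>
  define c where "c = 2 / b x0"
  define a where "a = (\<lambda>x. c * b (x0 + R *\<^sub>R x))"
  define \<beta> where "\<beta> = (\<lambda>x. smooth_step (a x))"
  define \<beta>' where "\<beta>' = (\<lambda>x. (smooth_step' (a x) * c * R) *\<^sub>R b' (x0 + R *\<^sub>R x))"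
  have cb: "continuous_on UNIV b"
    using b' continuous_at_imp_continuous_on has_derivative_continuous by blast
  have ca: "continuous_on UNIV a" unfolding a_def
    by (intro continuous_intros continuous_on_compose2[OF cb]) auto
  have "isCont a 0" using ca by (simp add: continuous_on_eq_continuous_at)
  then obtain \<delta> where \<delta>: "\<delta> > 0" "\<And>x. dist x 0 < \<delta> \<Longrightarrow> dist (a x) (a 0) < 1"
    unfolding continuous_at_eps_delta by (metis zero_less_one)
  have a0: "a 0 = 2" using x0 unfolding a_def c_def by simp
  have "smooth_cutoff \<beta> \<beta>' (4 * \<bar>c\<bar> * R * L) (\<delta>/2)"
  proof
    fix x
    have 1: "(a has_derivative (\<lambda>v. c * b' (x0 + R *\<^sub>R x) (R *\<^sub>R v))) (at x)"
      unfolding a_def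
      by (rule derivative_eq_intros has_derivative_compose[OF _ b'(1)] refl | simp)+
    have "(\<beta> has_derivative (\<lambda>v. smooth_step' (a x) * (c * b' (x0 + R *\<^sub>R x) (R *\<^sub>R v)))) (at x)"
      unfolding \<beta>_def
      using has_derivative_compose[OF 1 smooth_step_deriv[of "a x", unfolded has_field_derivative_def]]
      by (simp add: mult.commute)
    moreover have "(\<lambda>v. smooth_step' (a x) * (c * b' (x0 + R *\<^sub>R x) (R *\<^sub>R v))) = blinfun_apply (\<beta>' x)"
      unfolding \<beta>'_def by (simp add: fun_eq_iff blinfun.bilinear_simps)
    ultimately show "(\<beta> has_derivative blinfun_apply (\<beta>' x)) (at x)" by simp
    have "norm (\<beta>' x) = \<bar>smooth_step' (a x)\<bar> * \<bar>c\<bar> * R * norm (b' (x0 + R *\<^sub>R x))"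
      unfolding \<beta>'_def using R by (simp add: abs_mult)
    also have "\<dots> \<le> 4 * \<bar>c\<bar> * R * L"
      using R bn smooth_step'_bound by (intro mult_mono) auto
    finally show "norm (\<beta>' x) \<le> 4 * \<bar>c\<bar> * R * L" .
    have "0 \<le> max 0 (1 - (max 0 (a x))^2)" "max 0 (1 - (max 0 (a x))^2) \<le> 1" by auto
    then show "0 \<le> \<beta> x" "\<beta> x \<le> 1" unfolding \<beta>_def smooth_step_def
      by (auto simp: power_le_one)
    show "\<beta> x = 1" if "norm x \<le> \<delta>/2"
    proof -
      have "dist (a x) 2 < 1" using \<delta>(2)[of x] a0 that \<delta>(1) by simp
      then have "a x \<ge> 1" by (simp add: dist_real_def abs_if split: if_splits)
      then have "(max 0 (a x))^2 \<ge> 1" by (simp add: one_le_power)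
      then show ?thesis unfolding \<beta>_def smooth_step_def by simp
    qed
    show "\<beta> x = 0" if "1 \<le> norm x"
    proof -
      have "R * 1 \<le> R * norm x" using R that by (intro mult_left_mono) auto
      then have "norm (R *\<^sub>R x) \<ge> R" using R by simp
      moreover have "norm (x0 + R *\<^sub>R x) \<ge> norm (R *\<^sub>R x) - norm x0"
        by (metis add.commute norm_diff_ineq)
      ultimately have "norm (x0 + R *\<^sub>R x) > R0" unfolding R_def by linarith
      then have "a x = 0" using R0 unfolding a_def by force
      then show ?thesis unfolding \<beta>_def smooth_step_def by simp
    qed
  next
    have "continuous_on UNIV smooth_step'" unfolding smooth_step'_def by (intro continuous_intros)
    then show "continuous_on UNIV \<beta>'" unfolding \<beta>'_def
      by (intro continuous_intros continuous_on_compose2[OF b'(2)] continuous_on_compose2[OF _ ca]) auto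
  qed (use \<delta> in auto)
  then show ?thesis by blast
qed

section \<open>A smooth variational principle\<close>

text \<open>The weights of the perturbations. With ratio 1/16 one term exceeds the sum of all later
  ones with ample room, and the terms remain summable after differentiating bumps shrunk by
  \<open>2 * 2 ^ n\<close>.\<close>

lemma sums_geometric_16: "(\<lambda>n. c / 16 ^ n) sums (16/15 * c :: real)"
proof -
  have "(\<lambda>n. c * (1/16) ^ n) sums (c * (1 / (1 - 1/16)))"
    by (intro sums_mult geometric_sums) simp
  then show ?thesis by (simp add: power_one_over field_simps)
qed

context smooth_cutoff begin

text \<open>Shrinking the n-th bump multiplies its derivative by \<open>2 * 2 ^ n\<close>; the
  weight leaves a bound of order \<open>(1/8) ^ n\<close>, so the derivatives converge uniformly
  wherever the centres \<open>e n\<close> lie. The exact constant 16/7 is rounded up to 4.\<close>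

lemma cutoff_series:
  fixes a :: "nat \<Rightarrow> real"
  assumes a: "\<And>n. \<bar>a n\<bar> \<le> c / 16 ^ n"
  obtains g' :: "'x \<Rightarrow> 'x \<Rightarrow>\<^sub>L real"
  where "\<And>x. ((\<lambda>x. \<Sum>n. a n * \<beta> ((2 * 2 ^ n) *\<^sub>R (x - e n))) has_derivative blinfun_apply (g' x)) (at x)"
    and "continuous_on UNIV g'" and "\<And>x. norm (g' x) \<le> 4 * c * B"
proof -
  have c: "0 \<le> c" using a[of 0] by (simp add: abs_le_iff)
  define t where "t = (\<lambda>n x. a n * \<beta> ((2 * 2 ^ n) *\<^sub>R (x - e n)))"
  define t' where "t' = (\<lambda>n x. (a n * (2 * 2 ^ n)) *\<^sub>R \<beta>' ((2 * 2 ^ n) *\<^sub>R (x - e n)))"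
  define g' where "g' = (\<lambda>x. \<Sum>n. t' n x)"
  have t': "(t n has_derivative blinfun_apply (t' n x)) (at x)" for n x
  proof -
    have "((\<lambda>x. (2 * 2 ^ n) *\<^sub>R (x - e n)) has_derivative (\<lambda>v. (2 * 2 ^ n) *\<^sub>R v)) (at x)"
      by (auto intro!: derivative_eq_intros)
    from has_derivative_compose[OF this has_deriv]
    have "((\<lambda>x. a n * \<beta> ((2 * 2 ^ n) *\<^sub>R (x - e n))) has_derivative
        (\<lambda>v. a n * \<beta>' ((2 * 2 ^ n) *\<^sub>R (x - e n)) ((2 * 2 ^ n) *\<^sub>R v))) (at x)"
      by (rule has_derivative_mult_right)
    moreover have "(\<lambda>v. a n * \<beta>' ((2 * 2 ^ n) *\<^sub>R (x - e n)) ((2 * 2 ^ n) *\<^sub>R v)) = blinfun_apply (t' n x)"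
      unfolding t'_def by (simp add: fun_eq_iff blinfun.bilinear_simps)
    ultimately show ?thesis unfolding t_def by simp
  qed
  have bd: "norm (t' n x) \<le> 2 * c * B * (1/8) ^ n" for n x
  proof -
    have "norm (t' n x) = \<bar>a n\<bar> * (2 * 2 ^ n) * norm (\<beta>' ((2 * 2 ^ n) *\<^sub>R (x - e n)))"
      unfolding t'_def by (simp add: abs_mult)
    also have "\<dots> \<le> c / 16 ^ n * (2 * 2 ^ n) * B"
      using a norm_deriv c by (intro mult_mono) auto
    also have "\<dots> = 2 * c * B * (1/8) ^ n"
      using power_mult_distrib[of "2::real" 8 n] by (simp add: field_simps power_one_over)
    finally show ?thesis .
  qed
  have sm: "summable (\<lambda>n. 2 * c * B * (1/8::real) ^ n)"
    by (intro summable_mult summable_geometric) simp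
  have unif: "uniform_limit UNIV (\<lambda>n x. \<Sum>i<n. t' i x) g' sequentially"
    unfolding g'_def by (rule Weierstrass_m_test[OF bd sm])
  have sums0: "summable (\<lambda>n. t n x)" for x
  proof (rule summable_comparison_test')
    show "summable (\<lambda>n. c / 16 ^ n)" using sums_geometric_16 sums_summable by blast
    fix n
    have "norm (t n x) = \<bar>a n\<bar> * \<beta> ((2 * 2 ^ n) *\<^sub>R (x - e n))"
      unfolding t_def using nonneg by (simp add: abs_mult)
    also have "\<dots> \<le> c / 16 ^ n * 1" using a le_one c nonneg by (intro mult_mono) auto
    finally show "norm (t n x) \<le> c / 16 ^ n" by simp
  qed
  have "\<exists>g. \<forall>x\<in>UNIV. (\<lambda>n. t n x) sums (g x) \<and> (g has_derivative blinfun_apply (g' x)) (at x within UNIV)"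
  proof (rule has_derivative_series)
    fix \<epsilon> :: real assume "\<epsilon> > 0"
    with unif have "\<forall>\<^sub>F n in sequentially. \<forall>x\<in>UNIV. dist (\<Sum>i<n. t' i x) (g' x) < \<epsilon>"
      by (simp add: uniform_limit_iff)
    then show "\<forall>\<^sub>F n in sequentially. \<forall>x\<in>UNIV. \<forall>h.
        norm ((\<Sum>i<n. blinfun_apply (t' i x) h) - blinfun_apply (g' x) h) \<le> \<epsilon> * norm h"
    proof eventually_elim
      case (elim n)
      show ?case
      proof (intro ballI allI)
        fix x h
        have "norm ((\<Sum>i<n. blinfun_apply (t' i x) h) - blinfun_apply (g' x) h) =
            norm (((\<Sum>i<n. t' i x) - g' x) h)"
          by (simp add: blinfun.bilinear_simps blinfun.sum_left)
        also have "\<dots> \<le> norm ((\<Sum>i<n. t' i x) - g' x) * norm h" by (rule norm_blinfun)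
        also have "\<dots> \<le> \<epsilon> * norm h" using elim by (intro mult_right_mono) (auto simp: dist_norm less_imp_le)
        finally show "norm ((\<Sum>i<n. blinfun_apply (t' i x) h) - blinfun_apply (g' x) h) \<le> \<epsilon> * norm h" .
      qed
    qed
  next
    show "(\<lambda>n. t n 0) sums (\<Sum>n. t n 0)" using sums0 summable_sums by blast
  qed (use t' in auto)
  then obtain g where g: "\<And>x. (\<lambda>n. t n x) sums (g x)"
    "\<And>x. (g has_derivative blinfun_apply (g' x)) (at x)" by auto
  have "g = (\<lambda>x. \<Sum>n. t n x)" using g(1) sums_unique by blast
  then have 1: "((\<lambda>x. \<Sum>n. a n * \<beta> ((2 * 2 ^ n) *\<^sub>R (x - e n))) has_derivative blinfun_apply (g' x)) (at x)" for x
    using g(2) unfolding t_def by simp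
  have 2: "continuous_on UNIV g'"
  proof (rule uniform_limit_theorem[OF _ unif])
    have "continuous_on UNIV (t' n)" for n
      unfolding t'_def
      by (intro continuous_intros continuous_on_compose2[OF continuous_deriv]) auto
    then show "\<forall>\<^sub>F n in sequentially. continuous_on UNIV (\<lambda>x. \<Sum>i<n. t' i x)"
      by (intro always_eventually allI continuous_on_sum)
  qed simp
  have 3: "norm (g' x) \<le> 4 * c * B" for x
  proof -
    have "summable (\<lambda>n. norm (t' n x))"
      by (rule summable_comparison_test'[OF sm]) (use bd in auto)
    then have "norm (g' x) \<le> (\<Sum>n. norm (t' n x))"
      unfolding g'_def by (rule summable_norm)
    also have "\<dots> \<le> (\<Sum>n. 2 * c * B * (1/8::real) ^ n)"
      by (intro suminf_le bd sm \<open>summable (\<lambda>n. norm (t' n x))\<close>)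
    also have "\<dots> = 2 * c * B * (8/7)"
      by (subst suminf_mult) (auto simp: suminf_geometric)
    also have "\<dots> = (16/7) * (c * B)" by simp
    also have "\<dots> \<le> 4 * (c * B)" using c B_nonneg by (intro mult_right_mono) auto
    finally show ?thesis by simp
  qed
  show ?thesis using that[OF 1 2 3] .
qed

end

text \<open>The bump \<open>b n e\<close> added at stage \<open>n\<close> lowers the function near an almost minimizer \<open>e\<close> by
  much more than all later bumps together, so that all later almost minimizers stay close to \<open>e\<close>.\<close>

lemma perturbed_minimum:
  fixes \<Phi> :: "'e::complete_space \<Rightarrow> real" and b :: "nat \<Rightarrow> 'e \<Rightarrow> 'e \<Rightarrow> real"
  assumes E: "closed E" "E \<noteq> {}" and cont: "continuous_on E \<Phi>" and lower: "\<And>z. z \<in> E \<Longrightarrow> m \<le> \<Phi> z"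
    and bcont: "\<And>n e. continuous_on UNIV (b n e)"
    and b0: "\<And>n e z. 0 \<le> b n e z" and b1: "\<And>n e z. b n e z \<le> 1" and bpeak: "\<And>n e. b n e e = 1"
    and bsupp: "\<And>n e z. (1/2)^n \<le> dist e z \<Longrightarrow> b n e z = 0" and c: "0 < c"
  obtains e z0 where "z0 \<in> E"
    "\<And>z. z \<in> E \<Longrightarrow> \<Phi> z0 - (\<Sum>n. c / 16^n * b n (e n) z0) \<le> \<Phi> z - (\<Sum>n. c / 16^n * b n (e n) z)"
proof -
  \<comment> \<open>The tolerance is a quarter of the height of the bump subtracted at this
    stage.\<close>
  define pick where "pick = (\<lambda>n \<Psi>. SOME e. e \<in> E \<and> \<Psi> e < Inf (\<Psi> ` E) + c / 16^n / 4)"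
  define \<Psi> where "\<Psi> = rec_nat \<Phi> (\<lambda>n \<Psi> z. \<Psi> z - c / 16^n * b n (pick n \<Psi>) z)"
  define e where "e = (\<lambda>n. pick n (\<Psi> n))"
  have \<Psi>0: "\<Psi> 0 = \<Phi>" unfolding \<Psi>_def by simp
  have \<Psi>S: "\<Psi> (Suc n) z = \<Psi> n z - c / 16^n * b n (e n) z" for n z
    unfolding \<Psi>_def e_def by simp
  define t where "t = (\<lambda>n z. c / 16^n * b n (e n) z)"
  have t0: "0 \<le> t n z" and t1: "t n z \<le> c / 16^n" for n z
    unfolding t_def using b0 b1 c by (auto intro!: mult_left_le simp: divide_le_cancel)
  have \<Psi>sum: "\<Psi> n z = \<Phi> z - (\<Sum>i<n. t i z)" for n z
    by (induction n) (auto simp: \<Psi>0 \<Psi>S t_def)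
  have summ: "summable (\<lambda>n. t n z)" for z
    by (rule summable_comparison_test'[OF sums_summable[OF sums_geometric_16]]) (use t0 t1 in auto)
  have geo: "(\<Sum>i\<in>{k..<n}. c / 16^i) \<le> 16/15 * (c / 16^k)" for k n
  proof -
    have "(\<Sum>i\<in>{k..<n}. c / 16^i) = (\<Sum>i<n-k. (c / 16^k) / 16^i)"
      by (rule sum.reindex_bij_witness[where i="\<lambda>i. i + k" and j="\<lambda>i. i - k"])
         (auto simp: power_add[symmetric])
    also have "\<dots> \<le> (\<Sum>i. (c / 16^k) / 16^i)"
      by (rule sum_le_suminf[OF sums_summable[OF sums_geometric_16]]) (use c in auto)
    also have "\<dots> = 16/15 * (c / 16^k)" using sums_geometric_16 sums_unique by metis
    finally show ?thesis .
  qed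
  have decr: "\<Psi> n z \<le> \<Psi> k z" if "k \<le> n" for k n z
    unfolding \<Psi>sum using that by (auto intro!: sum_mono2 t0)
  have lowdiff: "\<Psi> k z - 16/15 * (c / 16^k) \<le> \<Psi> n z" if "k \<le> n" for k n z
  proof -
    have "(\<Sum>i<n. t i z) = (\<Sum>i<k. t i z) + (\<Sum>i\<in>{k..<n}. t i z)"
      using that by (subst sum.union_disjoint[symmetric]) (auto intro: sum.cong)
    moreover have "(\<Sum>i\<in>{k..<n}. t i z) \<le> 16/15 * (c / 16^k)"
      by (rule order_trans[OF sum_mono geo]) (rule t1)
    ultimately show ?thesis unfolding \<Psi>sum by simp
  qed
  have bdd: "bdd_below (\<Psi> n ` E)" for n
  proof (rule bdd_belowI2)
    fix z assume "z \<in> E"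
    then show "m - 16/15 * c \<le> \<Psi> n z" using lowdiff[of 0 n z] lower[of z] \<Psi>0 by simp
  qed
  have e: "e n \<in> E" "\<Psi> n (e n) < Inf (\<Psi> n ` E) + c / 16^n / 4" for n
  proof -
    have "\<exists>x\<in>\<Psi> n ` E. x < Inf (\<Psi> n ` E) + c / 16^n / 4"
      using E(2) c by (intro cInf_lessD) auto
    then have "\<exists>x. x \<in> E \<and> \<Psi> n x < Inf (\<Psi> n ` E) + c / 16^n / 4" by auto
    from someI_ex[OF this] show "e n \<in> E" "\<Psi> n (e n) < Inf (\<Psi> n ` E) + c / 16^n / 4"
      unfolding e_def pick_def by auto
  qed
  have inf_le: "Inf (\<Psi> n ` E) \<le> \<Psi> n z" if "z \<in> E" for n z
    using that bdd by (auto intro: cInf_lower)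
  \<comment> \<open>If \<open>e k\<close> were outside the n-th bump, stage n would gain nothing
    there but the full height q = \<open>c / 16^n\<close> at \<open>e n\<close>. Since
    \<open>e k\<close> almost minimizes \<Psi> k, this is impossible: the two tolerances and the
    later bumps cost at most q/4, q/64 and q/15.\<close>
  have close: "dist (e n) (e k) < (1/2)^n" if "n < k" for n k
  proof (rule ccontr)
    assume "\<not> ?thesis"
    then have "b n (e n) (e k) = 0" using bsupp by simp
    then have 1: "\<Psi> (Suc n) (e k) = \<Psi> n (e k)" by (simp add: \<Psi>S)
    have pos: "c / 16^n > 0" using c by simp
    have step: "c / 16 ^ Suc n = (c / 16^n) / 16" by simp
    have "c / 16^k \<le> c / 16 ^ Suc n"
      using that c by (intro divide_left_mono power_increasing) auto
    then have k: "c / 16^k \<le> (c / 16^n) / 16" by simp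
    have "Inf (\<Psi> n ` E) \<le> \<Psi> (Suc n) (e k)" using inf_le e(1) 1 by simp
    moreover have "\<Psi> (Suc n) (e k) \<le> \<Psi> k (e k) + 16/15 * (c / 16 ^ Suc n)"
      using lowdiff[of "Suc n" k "e k"] that by linarith
    moreover have "\<Psi> k (e k) < Inf (\<Psi> k ` E) + c / 16^k / 4" by (rule e)
    moreover have "Inf (\<Psi> k ` E) \<le> \<Psi> k (e n)" using inf_le e(1) by simp
    moreover have "\<Psi> k (e n) \<le> \<Psi> (Suc n) (e n)" using decr that by simp
    moreover have "\<Psi> (Suc n) (e n) = \<Psi> n (e n) - c / 16^n" by (simp add: \<Psi>S bpeak)
    moreover have "\<Psi> n (e n) < Inf (\<Psi> n ` E) + c / 16^n / 4" by (rule e)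
    \<comment> \<open>The powers are abstracted to variables q and d, for stages n and k, so that
      the chain of inequalities becomes linear.\<close>
    ultimately show False using pos k
      unfolding step
    proof -
      fix q d I P1 P2 P3 P4 P5 J :: real
      assume "I \<le> P1" "P1 \<le> P2 + 16/15 * (q / 16)" "P2 < J + d / 4" "J \<le> P3" "P3 \<le> P4"
        "P4 = P5 - q" "P5 < I + q / 4" "0 < q" "d \<le> q / 16"
      then show False by linarith
    qed
  qed
  have "Cauchy e"
  proof (rule metric_CauchyI)
    fix r :: real assume "0 < r"
    then obtain N where N: "(1/2::real)^N < r / 2"
      using real_arch_pow_inv[of "r/2" "1/2"] by auto
    have "dist (e i) (e j) < r" if "N \<le> i" "N \<le> j" for i j
    proof -
      have "dist (e N) (e i) \<le> (1/2)^N" if "N \<le> i" for i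
        using close[of N i] that by (cases "N = i") auto
      from this[of i] this[of j] have "dist (e i) (e j) \<le> (1/2)^N + (1/2)^N"
        using that dist_triangle3[of "e i" "e j" "e N"] by linarith
      then show ?thesis using N by simp
    qed
    then show "\<exists>N. \<forall>i\<ge>N. \<forall>j\<ge>N. dist (e i) (e j) < r" by blast
  qed
  then obtain z0 where z0: "e \<longlonglongrightarrow> z0" using Cauchy_convergent convergent_def by blast
  have z0E: "z0 \<in> E" using E(1) e(1) z0 closed_sequentially by blast
  define p where "p = (\<lambda>z. \<Sum>n. t n z)"
  have "uniform_limit UNIV (\<lambda>n z. \<Sum>i<n. t i z) p sequentially"
    unfolding p_def
    by (rule Weierstrass_m_test[OF _ sums_summable[OF sums_geometric_16[of c]]]) (use t0 t1 in auto)
  then have pcont: "continuous_on UNIV p"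
  proof (rule uniform_limit_theorem[rotated])
    show "\<forall>\<^sub>F n in sequentially. continuous_on UNIV (\<lambda>z. \<Sum>i<n. t i z)"
      unfolding t_def by (intro always_eventually allI continuous_intros bcont)
  qed simp
  \<comment> \<open>The fully perturbed function lies between \<Psi> n and \<Psi> n minus the tail
    of the series, uniformly in z.\<close>
  have p_ge: "\<Phi> z - p z \<le> \<Psi> n z" for n z
    unfolding \<Psi>sum p_def using sum_le_suminf[OF summ, of "{..<n}" z] t0 by simp
  have p_le: "\<Psi> n z - 16/15 * (c / 16^n) \<le> \<Phi> z - p z" for n z
  proof (rule tendsto_lowerbound)
    show "(\<lambda>k. \<Psi> k z) \<longlonglongrightarrow> \<Phi> z - p z"
      unfolding \<Psi>sum p_def by (intro tendsto_intros summable_LIMSEQ summ)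
    show "\<forall>\<^sub>F k in sequentially. \<Psi> n z - 16/15 * (c / 16^n) \<le> \<Psi> k z"
      using lowdiff eventually_sequentially by blast
  qed simp
  \<comment> \<open>Minimality passes to the limit along \<open>e\<close>: at \<open>e n\<close> the
    perturbed function exceeds its value at any z by at most the tolerance plus the tail, that is
    (1/4 + 16/15) \<open>c / 16^n\<close>, rounded up to twice the weight.\<close>
  have "\<Phi> z0 - p z0 \<le> \<Phi> z - p z" if z: "z \<in> E" for z
  proof (rule tendsto_le[OF trivial_limit_sequentially])
    have "(\<lambda>n. \<Phi> (e n)) \<longlonglongrightarrow> \<Phi> z0"
      using cont e(1) z0 z0E by (auto simp: continuous_on_sequentially o_def)
    moreover have "(\<lambda>n. p (e n)) \<longlonglongrightarrow> p z0"
      using pcont z0 by (auto simp: continuous_on_sequentially o_def)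
    ultimately show "(\<lambda>n. \<Phi> (e n) - p (e n)) \<longlonglongrightarrow> \<Phi> z0 - p z0" by (rule tendsto_diff)
    have "(\<lambda>n. c / 16^n) \<longlonglongrightarrow> 0"
      using summable_LIMSEQ_zero[OF sums_summable[OF sums_geometric_16]] .
    from tendsto_add[OF tendsto_const[of "\<Phi> z - p z"] tendsto_mult[OF tendsto_const[of 2] this]]
    show "(\<lambda>n. \<Phi> z - p z + 2 * (c / 16^n)) \<longlonglongrightarrow> \<Phi> z - p z" by simp
    have "\<Phi> (e n) - p (e n) \<le> \<Phi> z - p z + 2 * (c / 16^n)" for n
    proof -
      have "A \<le> D + 2 * q" if "A \<le> P" "P < I + q / 4" "I \<le> Q" "Q - 16/15 * q \<le> D" "0 < q"
        for A D P Q I q :: real using that by linarith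
      from this[OF p_ge e(2) inf_le[OF z] p_le] show ?thesis using c by simp
    qed
    then show "\<forall>\<^sub>F n in sequentially. \<Phi> (e n) - p (e n) \<le> \<Phi> z - p z + 2 * (c / 16^n)" by simp
  qed
  then show thesis using that z0E unfolding p_def t_def by blast
qed

text \<open>Freezing one variable of the minimized function gives C1 functions touching f at z and G
  at s from below. The coupling \<rho> depends on z - s only, so its derivative enters g1' and g2'
  with opposite signs and cancels in the sum, which leaves the small derivatives of the
  perturbation. The hypothesis on the shell keeps z inside the radius R', so that, for
  \<open>R' \<le> R\<close>, the minimum in z is a local one in the whole space.\<close>

lemma (in smooth_cutoff) fuzzy_sum_rule:
  fixes f G :: "'x \<Rightarrow> real"
  assumes f: "continuous_on (cball y R) f" and m: "\<And>z. z \<in> cball y R \<Longrightarrow> m \<le> f z"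
    and G: "C-lipschitz_on UNIV G" and G0: "\<And>s. 0 \<le> G s"
    and x1: "x1 \<in> cball y R" and \<gamma>: "0 < \<gamma>" and r: "0 < r" and \<eta>: "0 < \<eta>"
    and shell: "\<And>z. z \<in> cball y R \<Longrightarrow> R' \<le> dist y z \<Longrightarrow> f x1 + G x1 + \<gamma> \<le> f z + G z"
  obtains z s g1 g2 g1' g2' where "z \<in> cball y R" "dist y z < R'" "dist z s < r"
    "f z + G s \<le> f x1 + G x1 + \<eta>"
    "C1_on UNIV g1" "(g1 has_derivative blinfun_apply g1') (at z)"
    "(g2 has_derivative blinfun_apply g2') (at s)" "norm (g1' + g2') \<le> \<eta>"
    "\<And>z'. z' \<in> cball y R \<Longrightarrow> f z - g1 z \<le> f z' - g1 z'"
    "\<And>s'. G s - g2 s \<le> G s' - g2 s'"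
proof -
  have C: "0 \<le> C" using G by (rule lipschitz_on_nonneg)
  \<comment> \<open>Replacing s by z in G then costs at most half of the margin \<gamma> on the
    shell.\<close>
  define r0 where "r0 = min r (\<gamma> / (2 * (C + 1)))"
  have r0: "0 < r0" "r0 \<le> r" "C * r0 \<le> \<gamma> / 2"
  proof -
    show "0 < r0" using r \<gamma> C unfolding r0_def by simp
    show "r0 \<le> r" unfolding r0_def by simp
    have "(C + 1) * r0 \<le> (C + 1) * (\<gamma> / (2 * (C + 1)))" unfolding r0_def using C by (intro mult_left_mono) auto
    also have "\<dots> = \<gamma> / 2" using C by (simp add: field_simps)
    finally show "C * r0 \<le> \<gamma> / 2" using \<open>0 < r0\<close> by (simp add: algebra_simps)
  qed
  define \<alpha> where "\<alpha> = f x1 + G x1"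
  \<comment> \<open>The height of the coupling: since \<open>f \<ge> m\<close> and
    \<open>G \<ge> 0\<close>, any pair at distance at least r0 has value at least \<alpha> +
    \<gamma>, too much for a minimizer.\<close>
  define K where "K = \<alpha> + \<gamma> - m"
  have K: "0 < K" using m[OF x1] G0[of x1] \<gamma> unfolding K_def \<alpha>_def by linarith
  define \<rho> where "\<rho> = (\<lambda>x. K * (1 - \<beta> ((1/r0) *\<^sub>R x)))"
  define \<rho>' where "\<rho>' = (\<lambda>x. (- K / r0) *\<^sub>R \<beta>' ((1/r0) *\<^sub>R x))"
  have \<rho>0: "0 \<le> \<rho> x" for x unfolding \<rho>_def using K le_one by simp
  have \<rho>z: "\<rho> 0 = 0" unfolding \<rho>_def using zero by simp
  have \<rho>far: "\<rho> x = K" if "r0 \<le> norm x" for x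
    unfolding \<rho>_def using eq_zero[of "(1/r0) *\<^sub>R x"] that r0(1) by (simp add: le_divide_eq)
  have \<rho>c: "continuous_on S \<rho>" for S unfolding \<rho>_def
    by (intro continuous_intros continuous_on_compose2[OF continuous[of UNIV]]) auto
  have \<rho>': "(\<rho> has_derivative blinfun_apply (\<rho>' x)) (at x)" for x
  proof -
    have "((\<lambda>x. (1/r0) *\<^sub>R x) has_derivative (\<lambda>v. (1/r0) *\<^sub>R v)) (at x)"
      by (auto intro!: derivative_eq_intros)
    from has_derivative_compose[OF this has_deriv]
    have "(\<rho> has_derivative (\<lambda>v. K * (0 - \<beta>' ((1/r0) *\<^sub>R x) ((1/r0) *\<^sub>R v)))) (at x)"
      unfolding \<rho>_def by (intro has_derivative_mult_right has_derivative_diff has_derivative_const)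
    moreover have "(\<lambda>v. K * (0 - \<beta>' ((1/r0) *\<^sub>R x) ((1/r0) *\<^sub>R v))) = blinfun_apply (\<rho>' x)"
      unfolding \<rho>'_def by (simp add: fun_eq_iff blinfun.bilinear_simps)
    ultimately show ?thesis by simp
  qed
  have \<rho>'c: "continuous_on UNIV \<rho>'" unfolding \<rho>'_def
    by (intro continuous_intros continuous_on_compose2[OF continuous_deriv]) auto
  define \<Phi> where "\<Phi> = (\<lambda>(z, s). f z + G s + \<rho> (z - s))"
  define E where "E = cball y R \<times> (UNIV :: 'x set)"
  \<comment> \<open>A product of bumps, so that freezing one variable leaves a one-variable series.
    The extra factor 2 halves each radius, because the distance in the product is bounded by the sum
    of the two distances.\<close>
  define b where "b = (\<lambda>n e z. \<beta> ((2 * 2^n) *\<^sub>R (fst z - fst e)) * \<beta> ((2 * 2^n) *\<^sub>R (snd z - snd (e::'x\<times>'x))))"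
  \<comment> \<open>The perturbation is at most \<open>2 * c\<close>, hence below both \<gamma>/4
    and \<eta>; the two partial derivatives contribute \<open>4 * c * B\<close> each. The summand 2
    also keeps the denominator positive if B = 0.\<close>
  define c where "c = min (\<gamma>/8) (\<eta> / (8 * B + 2))"
  have c: "0 < c" "c \<le> \<gamma>/8" "8 * c * B + 2 * c \<le> \<eta>"
  proof -
    have B: "0 < 8 * B + 2" using B_nonneg by simp
    then show "0 < c" unfolding c_def using \<gamma> \<eta> by simp
    show "c \<le> \<gamma>/8" unfolding c_def by (rule min.cobounded1)
    have "c * (8 * B + 2) \<le> \<eta> / (8 * B + 2) * (8 * B + 2)"
      unfolding c_def using B by (intro mult_right_mono) auto
    also have "\<dots> = \<eta>" using B by (metis less_irrefl nonzero_eq_divide_eq)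
    finally show "8 * c * B + 2 * c \<le> \<eta>" by (simp add: algebra_simps)
  qed
  have Gc: "continuous_on S G" for S
    using G lipschitz_on_continuous_on continuous_on_subset by blast
  obtain e z0 where z0E: "z0 \<in> E" and z0:
    "\<And>z. z \<in> E \<Longrightarrow> \<Phi> z0 - (\<Sum>n. c / 16^n * b n (e n) z0) \<le> \<Phi> z - (\<Sum>n. c / 16^n * b n (e n) z)"
  proof (rule perturbed_minimum[of E \<Phi> m b c])
    show "closed E" unfolding E_def by (intro closed_Times) auto
    show "E \<noteq> {}" unfolding E_def using x1 by blast
    show "continuous_on E \<Phi>" unfolding \<Phi>_def E_def case_prod_beta
      by (intro continuous_intros continuous_on_compose2[OF f] continuous_on_compose2[OF Gc[of UNIV]]
          continuous_on_compose2[OF \<rho>c[of UNIV]]) auto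
    show "m \<le> \<Phi> z" if "z \<in> E" for z
      using that m[of "fst z"] G0[of "snd z"] \<rho>0[of "fst z - snd z"] unfolding E_def \<Phi>_def by force
    show "continuous_on UNIV (b n e)" for n e unfolding b_def
      by (intro continuous_intros continuous_on_compose2[OF continuous[of UNIV]]) auto
    show "0 \<le> b n e z" "b n e z \<le> 1" for n e z unfolding b_def
      using nonneg le_one by (auto intro: mult_le_one)
    show "b n e e = 1" for n e unfolding b_def using zero by simp
    show "b n e z = 0" if "(1/2)^n \<le> dist e z" for n e z
    proof (rule ccontr)
      assume "b n e z \<noteq> 0"
      then have "norm ((2 * 2^n) *\<^sub>R (fst z - fst e)) < 1" "norm ((2 * 2^n) *\<^sub>R (snd z - snd e)) < 1"
        unfolding b_def using eq_zero by (force simp: not_le[symmetric])+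
      then have "dist (fst e) (fst z) < (1/2)^n / 2" "dist (snd e) (snd z) < (1/2)^n / 2"
        unfolding norm_scaleR dist_commute[of "fst e"] dist_commute[of "snd e"] unfolding dist_norm
        by (auto simp: field_simps power_one_over simp del: scaleR_diff_right)
      moreover have "dist e z \<le> dist (fst e) (fst z) + dist (snd e) (snd z)"
        unfolding dist_prod_def by (rule sqrt_sum_squares_le_sum) auto
      ultimately show False using that by linarith
    qed
  qed (use c in auto)
  obtain z s where zs: "z0 = (z, s)" by fastforce
  have z: "z \<in> cball y R" using z0E zs unfolding E_def by simp
  define a where "a = (\<lambda>n. fst (e n))"
  define d where "d = (\<lambda>n. snd (e n))"
  define p where "p = (\<lambda>u v. \<Sum>n. c / 16^n * b n (e n) (u, v))"
  have b01: "0 \<le> c / 16^n * b n (e n) x" "c / 16^n * b n (e n) x \<le> c / 16^n" for n x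
    using mult_left_le[of "b n (e n) x" "c / 16^n"] c(1) nonneg le_one
    by (auto simp: b_def mult_le_one)
  have psum: "summable (\<lambda>n. c / 16^n * b n (e n) x)" for x
    by (rule summable_comparison_test'[OF sums_summable[OF sums_geometric_16[of c]]])
       (simp only: real_norm_def abs_of_nonneg[OF b01(1)] b01(2))
  have p0: "0 \<le> p u v" for u v unfolding p_def by (rule suminf_nonneg[OF psum b01(1)])
  have p2: "p u v \<le> 2 * c" for u v
  proof -
    have "p u v \<le> (\<Sum>n. c / 16^n)"
      unfolding p_def by (rule suminf_le[OF b01(2) psum sums_summable[OF sums_geometric_16]])
    also have "\<dots> = 16/15 * c" using sums_geometric_16 sums_unique by metis
    finally show ?thesis using c by simp
  qed
  have min: "f z + G s + \<rho> (z - s) - p z s \<le> f u + G v + \<rho> (u - v) - p u v" if "u \<in> cball y R" for u v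
    using z0[of "(u, v)"] that unfolding zs \<Phi>_def p_def E_def by simp
  \<comment> \<open>Comparison with the diagonal pair (x1, x1), where the coupling vanishes.\<close>
  have le: "f z + G s + \<rho> (z - s) \<le> \<alpha> + 2 * c"
    using min[OF x1, of x1] \<rho>z p0[of x1 x1] p2[of z s] unfolding \<alpha>_def by simp
  have close: "dist z s < r0"
  proof (rule ccontr)
    assume "\<not> dist z s < r0"
    then have "\<rho> (z - s) = K" by (intro \<rho>far) (simp add: dist_norm)
    then show False using le m[OF z] G0[of s] c \<gamma> unfolding K_def by simp
  qed
  have inner: "dist y z < R'"
  proof (rule ccontr)
    assume "\<not> dist y z < R'"
    then have "\<alpha> + \<gamma> \<le> f z + G z" using shell z unfolding \<alpha>_def by simp
    moreover have "\<bar>G z - G s\<bar> \<le> C * dist z s" using lipschitz_onD[OF G, of z s] by (simp add: dist_real_def)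
    moreover have "C * dist z s \<le> C * r0" using close C by (intro mult_left_mono) auto
    ultimately show False using le \<rho>0[of "z - s"] r0(3) c \<gamma> by linarith
  qed
  have bnd: "\<bar>c / 16^n * \<beta> x\<bar> \<le> c / 16^n" for n x
    using c(1) nonneg le_one by (simp add: abs_mult mult_left_le divide_right_mono)
  obtain q1 where q1: "\<And>x. ((\<lambda>x. \<Sum>n. c / 16^n * \<beta> ((2 * 2 ^ n) *\<^sub>R (s - d n)) * \<beta> ((2 * 2 ^ n) *\<^sub>R (x - a n)))
      has_derivative blinfun_apply (q1 x)) (at x)" "continuous_on UNIV q1" "\<And>x. norm (q1 x) \<le> 4 * c * B"
    by (rule cutoff_series[of "\<lambda>n. c / 16^n * \<beta> ((2 * 2 ^ n) *\<^sub>R (s - d n))" c a, OF bnd]) (rule that)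
  obtain q2 where q2: "\<And>x. ((\<lambda>x. \<Sum>n. c / 16^n * \<beta> ((2 * 2 ^ n) *\<^sub>R (z - a n)) * \<beta> ((2 * 2 ^ n) *\<^sub>R (x - d n)))
      has_derivative blinfun_apply (q2 x)) (at x)" "continuous_on UNIV q2" "\<And>x. norm (q2 x) \<le> 4 * c * B"
    by (rule cutoff_series[of "\<lambda>n. c / 16^n * \<beta> ((2 * 2 ^ n) *\<^sub>R (z - a n))" c d, OF bnd]) (rule that)
  have q1': "((\<lambda>x. p x s) has_derivative blinfun_apply (q1 x)) (at x)" for x
    using q1(1)[of x] unfolding p_def b_def a_def d_def by (simp add: mult.assoc mult.left_commute mult.commute)
  have q2': "((\<lambda>x. p z x) has_derivative blinfun_apply (q2 x)) (at x)" for x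
    using q2(1)[of x] unfolding p_def b_def a_def d_def by (simp add: mult.assoc)
  define g1 where "g1 = (\<lambda>x. p x s - \<rho> (x - s))"
  define g2 where "g2 = (\<lambda>x. p z x - \<rho> (z - x))"
  have g1': "(g1 has_derivative blinfun_apply (q1 x - \<rho>' (x - s))) (at x)" for x
  proof -
    have "((\<lambda>x. x - s) has_derivative (\<lambda>v. v)) (at x)" by (auto intro!: derivative_eq_intros)
    from has_derivative_diff[OF q1' has_derivative_compose[OF this \<rho>']]
    show ?thesis unfolding g1_def by (simp add: minus_blinfun.rep_eq)
  qed
  have g2': "(g2 has_derivative blinfun_apply (q2 s + \<rho>' (z - s))) (at s)"
  proof -
    have "((\<lambda>x. z - x) has_derivative (\<lambda>v. - v)) (at s)" by (auto intro!: derivative_eq_intros)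
    from has_derivative_diff[OF q2' has_derivative_compose[OF this \<rho>']]
    have "(g2 has_derivative (\<lambda>x. blinfun_apply (q2 s) x - blinfun_apply (\<rho>' (z - s)) (- x))) (at s)"
      unfolding g2_def .
    moreover have "(\<lambda>x. blinfun_apply (q2 s) x - blinfun_apply (\<rho>' (z - s)) (- x)) = blinfun_apply (q2 s + \<rho>' (z - s))"
      by (simp add: fun_eq_iff blinfun.bilinear_simps)
    ultimately show ?thesis by simp
  qed
  show thesis
  proof (rule that[OF z inner])
    show "dist z s < r" using close r0 by simp
    have "2 * c \<le> \<eta>" using c(3) c(1) B_nonneg mult_nonneg_nonneg[of "8 * c" B] by linarith
    then show "f z + G s \<le> f x1 + G x1 + \<eta>" using le \<rho>0[of "z - s"] unfolding \<alpha>_def by linarith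
    show "C1_on UNIV g1"
      by (rule C1_onI[OF g1']) (intro continuous_intros q1 continuous_on_compose2[OF \<rho>'c]; simp)
    show "(g1 has_derivative blinfun_apply (q1 z - \<rho>' (z - s))) (at z)" by (rule g1')
    show "(g2 has_derivative blinfun_apply (q2 s + \<rho>' (z - s))) (at s)" by (rule g2')
    have "norm (q1 z + q2 s) \<le> 4 * c * B + 4 * c * B" by (rule norm_triangle_mono[OF q1(3) q2(3)])
    moreover have "q1 z - \<rho>' (z - s) + (q2 s + \<rho>' (z - s)) = q1 z + q2 s" by simp
    moreover have "4 * c * B + 4 * c * B = 8 * c * B" by (simp add: algebra_simps)
    ultimately show "norm (q1 z - \<rho>' (z - s) + (q2 s + \<rho>' (z - s))) \<le> \<eta>"
      using c(1,3) by simp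
    show "f z - g1 z \<le> f z' - g1 z'" if "z' \<in> cball y R" for z'
      using min[OF that, of s] unfolding g1_def by simp
    show "G s - g2 s \<le> G s' - g2 s'" for s'
      using min[OF z, of s'] unfolding g2_def by simp
  qed
qed

section \<open>Tangent vectors and test functions in charts\<close>

text \<open>Refine the cover by U and all open sets whose closures miss x. The members of the
  refinement not contained in U form a locally finite family, so the closure of their union is the
  union of their closures and misses x; its complement is the neighbourhood sought.\<close>

lemma paracompact_space_regular:
  fixes U :: "'m::t2_space set"
  assumes "paracompact_space (euclidean :: 'm topology)" "open U" "x \<in> U"
  obtains W where "open W" "x \<in> W" "closure W \<subseteq> U"
proof -
  define \<U> where "\<U> = insert U {V. open V \<and> x \<notin> closure V}"
  have "\<exists>V\<in>\<U>. y \<in> V" for y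
  proof (cases "y \<in> U")
    case False
    then have "x \<noteq> y" using assms by auto
    then obtain N V where *: "open N" "open V" "x \<in> N" "y \<in> V" "N \<inter> V = {}"
      using hausdorff[of x y] by blast
    then have "x \<notin> closure V" using open_Int_closure_eq_empty[of N V] by blast
    then show ?thesis using * unfolding \<U>_def by blast
  qed (auto simp: \<U>_def)
  then have "\<Union>\<U> = UNIV" by blast
  moreover have "\<forall>V\<in>\<U>. open V" unfolding \<U>_def using assms by auto
  ultimately obtain \<V> where \<V>: "\<forall>V\<in>\<V>. open V" "\<Union>\<V> = UNIV" "\<forall>V\<in>\<V>. \<exists>U\<in>\<U>. V \<subseteq> U"
    "locally_finite_in (euclidean :: 'm topology) \<V>"
    using assms(1) unfolding paracompact_space_def open_openin[symmetric] topspace_euclidean by metis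
  define \<W> where "\<W> = {V \<in> \<V>. \<not> V \<subseteq> U}"
  have "locally_finite_in (euclidean :: 'm topology) \<W>"
    using \<V>(4) unfolding \<W>_def by (rule locally_finite_in_subset) auto
  then have cl: "closure (\<Union>\<W>) = (\<Union>V\<in>\<W>. closure V)"
    using closure_of_locally_finite_Union[of euclidean \<W>] by simp
  have "x \<notin> closure V" if V: "V \<in> \<W>" for V
  proof -
    obtain U' where "U' \<in> \<U>" "V \<subseteq> U'" using \<V>(3) V unfolding \<W>_def by blast
    then show ?thesis using V closure_mono[of V U'] unfolding \<W>_def \<U>_def by blast
  qed
  then have x: "x \<in> - closure (\<Union>\<W>)" using cl by blast
  have "open (\<Union>\<W>)" using \<V>(1) unfolding \<W>_def by blast
  then have "closure (- closure (\<Union>\<W>)) \<subseteq> - \<Union>\<W>"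
    by (intro closure_minimal) (use closure_subset[of "\<Union>\<W>"] in auto)
  also have "- \<Union>\<W> \<subseteq> U"
  proof
    fix y assume "y \<in> - \<Union>\<W>"
    moreover obtain V where "V \<in> \<V>" "y \<in> V" using \<V>(2) by (metis UNIV_I UnionE)
    ultimately show "y \<in> U" unfolding \<W>_def by auto
  qed
  finally show thesis by (rule that[of "- closure (\<Union>\<W>)", rotated 2]) (use x in auto)
qed

section \<open>Charts, tangent vectors and differentials\<close>

context C1_Banach_manifold begin

lemma chart_open: "c \<in> A \<Longrightarrow> open (fst c)"
  and chart_image_open: "c \<in> A \<Longrightarrow> open (snd c ` fst c)"
  and chart_homeomorphism: "c \<in> A \<Longrightarrow> homeomorphism (fst c) (snd c ` fst c) (snd c) (chart_inv c)"
  using charts unfolding is_chart_def by blast+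

lemma chart_inv_chart [simp]: "c \<in> A \<Longrightarrow> x \<in> fst c \<Longrightarrow> chart_inv c (snd c x) = x"
  using homeomorphism_apply1[OF chart_homeomorphism] by blast

lemma chart_continuous: "c \<in> A \<Longrightarrow> continuous_on (fst c) (snd c)"
  using chart_homeomorphism homeomorphism_cont1 by blast

lemma chart_inv_continuous: "c \<in> A \<Longrightarrow> continuous_on (snd c ` fst c) (chart_inv c)"
  using chart_homeomorphism homeomorphism_cont2 by blast

lemma open_chart_image:
  assumes "c \<in> A" "open V" shows "open (snd c ` (fst c \<inter> V))"
proof -
  have "snd c ` (fst c \<inter> V) = (snd c ` fst c) \<inter> chart_inv c -` V"
    using assms(1) by (auto simp: image_iff)
  then show ?thesis
    using continuous_open_preimage[OF chart_inv_continuous[OF assms(1)] chart_image_open[OF assms(1)] assms(2)]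
    by simp
qed

lemma open_chart_preimage:
  assumes "c \<in> A" "open V" shows "open {y \<in> fst c. snd c y \<in> V}"
  using continuous_open_preimage[OF chart_continuous[OF assms(1)] chart_open[OF assms(1)] assms(2)]
  by (simp add: vimage_def Int_def)

lemma obtain_chart: obtains c where "c \<in> A" "x \<in> fst c"
  using cover by blast

lemma transition_C1:
  "c \<in> A \<Longrightarrow> c' \<in> A \<Longrightarrow> C1_on (snd c ` (fst c \<inter> fst c')) (snd c' \<circ> chart_inv c)"
  using compatible unfolding C1_compatible_def by blast

definition transition_deriv :: "('m, 'x) chart \<Rightarrow> ('m, 'x) chart \<Rightarrow> 'm \<Rightarrow> 'x \<Rightarrow> 'x" where
  "transition_deriv c c' x = frechet_derivative (snd c' \<circ> chart_inv c) (at (snd c x))"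

lemma transition_has_derivative:
  assumes "c \<in> A" "c' \<in> A" "x \<in> fst c" "x \<in> fst c'"
  shows "((snd c' \<circ> chart_inv c) has_derivative transition_deriv c c' x) (at (snd c x))"
  unfolding transition_deriv_def
  using C1_on_has_derivative[OF transition_C1[OF assms(1,2)], of "snd c x"] assms(3,4) by blast

lemma chain_chart:
  fixes g :: "'m \<Rightarrow> 'b::real_normed_vector"
  assumes c: "c \<in> A" "c' \<in> A" "x \<in> fst c" "x \<in> fst c'"
    and g: "((g \<circ> chart_inv c') has_derivative D) (at (snd c' x))"
  shows "((g \<circ> chart_inv c) has_derivative D \<circ> transition_deriv c c' x) (at (snd c x))"
proof -
  have "((g \<circ> chart_inv c') \<circ> (snd c' \<circ> chart_inv c) has_derivative D \<circ> transition_deriv c c' x) (at (snd c x))"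
    by (rule diff_chain_at[OF transition_has_derivative[OF c]]) (use c g in simp)
  then show ?thesis
  proof (rule has_derivative_transform_within_open)
    show "open (snd c ` (fst c \<inter> fst c'))" using open_chart_image chart_open c by blast
  qed (use c in auto)
qed

lemma transition_deriv_self:
  assumes "c \<in> A" "x \<in> fst c" shows "transition_deriv c c x = (\<lambda>v. v)"
proof -
  have "((snd c \<circ> chart_inv c) has_derivative (\<lambda>v. v)) (at (snd c x))"
    by (rule has_derivative_transform_within_open[OF has_derivative_ident chart_image_open[OF assms(1)]])
       (use assms in auto)
  then show ?thesis
    using transition_has_derivative[OF assms(1,1,2,2)] has_derivative_unique by blast
qed

lemma transition_deriv_trans:
  assumes "c \<in> A" "c' \<in> A" "c'' \<in> A" "x \<in> fst c" "x \<in> fst c'" "x \<in> fst c''"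
  shows "transition_deriv c' c'' x (transition_deriv c c' x v) = transition_deriv c c'' x v"
  using has_derivative_unique[OF chain_chart[OF assms(1,2,4,5) transition_has_derivative[OF assms(2,3,5,6)]]
      transition_has_derivative[OF assms(1,3,4,6)]]
  by (auto simp: fun_eq_iff)

lemma tangent_rel_iff:
  "((c, v), (c', w)) \<in> tangent_rel A x \<longleftrightarrow>
    c \<in> A \<and> c' \<in> A \<and> x \<in> fst c \<and> x \<in> fst c' \<and> w = transition_deriv c c' x v"
  unfolding tangent_rel_def transition_deriv_def by simp

lemma chart_vec_eq:
  "c \<in> A \<Longrightarrow> x \<in> fst c \<Longrightarrow>
    chart_vec A c x v = {(c', w). c' \<in> A \<and> x \<in> fst c' \<and> w = transition_deriv c c' x v}"
  unfolding chart_vec_def by (auto simp: tangent_rel_iff)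

lemma chart_vec_transition:
  assumes "c \<in> A" "c' \<in> A" "x \<in> fst c" "x \<in> fst c'"
  shows "chart_vec A c' x (transition_deriv c c' x v) = chart_vec A c x v"
  using assms by (auto simp: chart_vec_eq transition_deriv_trans)

lemma tangent_space_eq:
  assumes "c \<in> A" "x \<in> fst c" shows "tangent_space A x = range (chart_vec A c x)"
proof -
  have "\<xi> \<in> range (chart_vec A c x)" if \<xi>: "\<xi> \<in> tangent_space A x" for \<xi>
  proof -
    obtain p where p: "p \<in> {(c, v). c \<in> A \<and> x \<in> fst c}" "\<xi> = tangent_rel A x `` {p}"
      using \<xi> unfolding tangent_space_def by (rule quotientE)
    obtain c' w where "p = (c', w)" by (rule prod.exhaust)
    with p have "c' \<in> A" "x \<in> fst c'" "\<xi> = chart_vec A c' x w" by (simp_all add: chart_vec_def)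
    then show ?thesis using chart_vec_transition[OF _ assms(1) _ assms(2)] by (metis rangeI)
  qed
  moreover have "chart_vec A c x v \<in> tangent_space A x" for v
    unfolding tangent_space_def chart_vec_def using assms by (intro quotientI) auto
  ultimately show ?thesis by blast
qed

text \<open>The representatives of a tangent vector are related by derivatives of transition maps,
  so by the chain rule all of them give the same number and the description in
  \<open>differential\<close> is unambiguous.\<close>

lemma differential_chart_vec:
  assumes c: "c \<in> A" "x \<in> fst c" and g: "(g \<circ> chart_inv c has_derivative D) (at (snd c x))"
  shows "differential A g x (chart_vec A c x v) = D v"
proof -
  have D': "frechet_derivative (g \<circ> chart_inv c') (at (snd c' x)) = D \<circ> transition_deriv c' c x"
    if "c' \<in> A" "x \<in> fst c'" for c'
    using frechet_derivative_at[OF chain_chart[OF that(1) c(1) that(2) c(2) g]] by simp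
  have "chart_vec A c x v \<in> tangent_space A x" using tangent_space_eq[OF c] by simp
  moreover have "(THE r. \<forall>(c', w)\<in>chart_vec A c x v.
      r = frechet_derivative (g \<circ> chart_inv c') (at (snd c' x)) w) = D v"
  proof (rule the_equality)
    show "\<forall>(c', w)\<in>chart_vec A c x v. D v = frechet_derivative (g \<circ> chart_inv c') (at (snd c' x)) w"
      using c D' by (auto simp: chart_vec_eq transition_deriv_trans transition_deriv_self)
    fix r assume *: "\<forall>(c', w)\<in>chart_vec A c x v. r = frechet_derivative (g \<circ> chart_inv c') (at (snd c' x)) w"
    have "(c, v) \<in> chart_vec A c x v" using c by (auto simp: chart_vec_eq transition_deriv_self)
    with * D'[OF c] show "r = D v" using c by (auto simp: transition_deriv_self)
  qed
  ultimately show ?thesis unfolding differential_def by simp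
qed

lemma C1_fun_has_derivative:
  assumes "C1_fun A g" "c \<in> A" "x \<in> fst c"
  shows "(g \<circ> chart_inv c has_derivative frechet_derivative (g \<circ> chart_inv c) (at (snd c x))) (at (snd c x))"
  using assms unfolding C1_fun_def by (intro C1_on_has_derivative) auto

text \<open>The preimage of a closed set under a chart is closed only relative to the chart domain.
  For sets in a small ball the preimage lies in a neighbourhood W whose closure stays inside the
  domain, so it cannot accumulate at outside points.\<close>

lemma chart_closed_sets:
  assumes c: "c \<in> A" "x \<in> fst c" "open U" "x \<in> U"
  obtains r where "0 < r" "cball (snd c x) r \<subseteq> snd c ` (fst c \<inter> U)"
    "\<And>S. closed S \<Longrightarrow> S \<subseteq> cball (snd c x) r \<Longrightarrow> closed {y \<in> fst c. snd c y \<in> S}"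
proof -
  obtain W where W: "open W" "x \<in> W" "closure W \<subseteq> fst c"
    using paracompact_space_regular[OF paracompact chart_open[OF c(1)] c(2)] by blast
  have "open (snd c ` (fst c \<inter> (U \<inter> W)))" using W c open_chart_image by blast
  then obtain r where r: "r > 0" "cball (snd c x) r \<subseteq> snd c ` (fst c \<inter> (U \<inter> W))"
    using open_contains_cball c W by (metis IntI imageI)
  have "closed {y \<in> fst c. snd c y \<in> S}" if S: "closed S" "S \<subseteq> cball (snd c x) r" for S
  proof -
    have sub: "{y \<in> fst c. snd c y \<in> S} \<subseteq> W"
    proof
      fix y assume y: "y \<in> {y \<in> fst c. snd c y \<in> S}"
      then obtain z where z: "z \<in> fst c" "z \<in> W" "snd c y = snd c z" using S r by blast
      then have "y = z" using y c(1) chart_inv_chart by (metis (mono_tags, lifting) mem_Collect_eq)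
      then show "y \<in> W" using z by simp
    qed
    obtain C where C: "closed C" "{y \<in> fst c. snd c y \<in> S} = fst c \<inter> C"
      using continuous_closedin_preimage[OF chart_continuous[OF c(1)] S(1)]
      by (auto simp: closedin_closed vimage_def Int_def)
    have "closure {y \<in> fst c. snd c y \<in> S} \<subseteq> closure W \<inter> C"
      using closure_mono[OF sub] closure_minimal[of "{y \<in> fst c. snd c y \<in> S}" C] C by auto
    then have "closure {y \<in> fst c. snd c y \<in> S} \<subseteq> {y \<in> fst c. snd c y \<in> S}" using W C(2) by blast
    then show ?thesis by (simp add: closure_subset_eq)
  qed
  with r show thesis by (intro that[of r]) auto
qed

text \<open>Multiply g by a cutoff supported in a small ball of the chart and extend by zero. The
  preimage K of that ball is closed in M, so the chart domain and the complement of K form an open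
  cover, and the extension is C1 on each of the two sets.\<close>

lemma C1_extension:
  fixes \<beta> :: "'x \<Rightarrow> real"
  assumes cut: "smooth_cutoff \<beta> \<beta>' B \<delta>" and c: "c \<in> A" "x \<in> fst c" and g: "C1_on UNIV g"
  obtains G N where "C1_fun A G" "open N" "x \<in> N" "N \<subseteq> fst c" "\<And>y. y \<in> N \<Longrightarrow> G y = g (snd c y)"
proof -
  interpret smooth_cutoff \<beta> \<beta>' B \<delta> by (rule cut)
  obtain r where r: "0 < r" "\<And>S. closed S \<Longrightarrow> S \<subseteq> cball (snd c x) r \<Longrightarrow> closed {y \<in> fst c. snd c y \<in> S}"
    using chart_closed_sets[OF c open_UNIV UNIV_I] by metis
  define q where "q = (\<lambda>p. \<beta> ((1/r) *\<^sub>R (p - snd c x)) * g p)"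
  have qC1: "C1_on UNIV q" unfolding q_def
    using C1_on_mult[OF C1_on_compose[OF C1 C1_on_affine[of UNIV "1/r" "snd c x"] subset_UNIV] g]
    by (simp add: o_def)
  define G where "G = (\<lambda>y. if y \<in> fst c then q (snd c y) else 0)"
  define K where "K = {y \<in> fst c. snd c y \<in> cball (snd c x) r}"
  have K: "closed K" unfolding K_def by (rule r) auto
  have G0: "G y = 0" if "y \<notin> K" for y
  proof (cases "y \<in> fst c")
    case True
    then have "1 \<le> norm ((1/r) *\<^sub>R (snd c y - snd c x))"
      using that r(1) unfolding K_def by (simp add: le_divide_eq dist_norm norm_minus_commute)
    then show ?thesis unfolding G_def q_def using eq_zero by simp
  qed (simp add: G_def)
  have "C1_fun A G" unfolding C1_fun_def
  proof
    fix c' assume c': "c' \<in> A"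
    show "C1_on (snd c' ` fst c') (G \<circ> chart_inv c')"
    proof (rule C1_on_local)
      fix p assume "p \<in> snd c' ` fst c'"
      then obtain y where y: "y \<in> fst c'" "p = snd c' y" by blast
      show "\<exists>T. open T \<and> p \<in> T \<and> C1_on T (G \<circ> chart_inv c')"
      proof (cases "y \<in> fst c")
        case True
        let ?T = "snd c' ` (fst c' \<inter> fst c)"
        have "C1_on ?T (q \<circ> (snd c \<circ> chart_inv c'))"
          by (rule C1_on_compose[OF qC1 transition_C1[OF c' c(1)]]) auto
        then have "C1_on ?T (G \<circ> chart_inv c')"
          by (rule C1_on_transform) (use c c' open_chart_image chart_open G_def in auto)
        then show ?thesis using open_chart_image chart_open c c' y True by blast
      next
        case False
        let ?T = "snd c' ` (fst c' \<inter> - K)"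
        have "open ?T" using open_chart_image[OF c'] K by (simp add: open_Compl)
        then have "C1_on ?T (G \<circ> chart_inv c')"
          by (rule C1_on_transform[OF C1_on_const]) (use c' G0 in auto)
        moreover have "y \<in> - K" using False K_def by blast
        ultimately show ?thesis using \<open>open ?T\<close> y by blast
      qed
    qed
  qed
  moreover have "G y = g (snd c y)" if "y \<in> fst c" "snd c y \<in> ball (snd c x) (r * \<delta>)" for y
  proof -
    have "norm ((1/r) *\<^sub>R (snd c y - snd c x)) \<le> \<delta>"
      using that r(1) by (simp add: dist_norm norm_minus_commute divide_le_eq mult.commute)
    then show ?thesis unfolding G_def q_def using eq_one that by simp
  qed
  ultimately show thesis
    using that[of G "{y \<in> fst c. snd c y \<in> ball (snd c x) (r * \<delta>)}"] open_chart_preimage[OF c(1), of "ball (snd c x) (r * \<delta>)"]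
      c(2) r(1) delta_pos by simp
qed

end

section \<open>The Finsler norm in a chart and the dual norm\<close>

context C1_Finsler_manifold begin

abbreviation (input) chart_norm :: "('m, 'x) chart \<Rightarrow> 'm \<Rightarrow> 'x \<Rightarrow> real" where
  "chart_norm c x v \<equiv> F x (chart_vec A c x v)"

context
  fixes c :: "('m, 'x) chart" and x :: 'm
  assumes c: "c \<in> A" "x \<in> fst c"
begin

lemma chart_norm_nonneg: "0 \<le> chart_norm c x v"
  and chart_norm_zero_iff: "chart_norm c x v = 0 \<longleftrightarrow> v = 0"
  and chart_norm_scale: "chart_norm c x (r *\<^sub>R v) = \<bar>r\<bar> * chart_norm c x v"
  and chart_norm_triangle: "chart_norm c x (v + w) \<le> chart_norm c x v + chart_norm c x w"
  using P1_norm[OF c] unfolding is_norm_def by auto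

lemma chart_norm_minus: "chart_norm c x (- v) = chart_norm c x v"
  using chart_norm_scale[of "-1" v] by simp

lemma chart_norm_triangle_diff: "chart_norm c x v - chart_norm c x w \<le> chart_norm c x (v - w)"
  using chart_norm_triangle[of "v - w" w] by simp

lemma chart_norm_lipschitz: obtains K where "K-lipschitz_on UNIV (\<lambda>v. chart_norm c x (v - p))"
proof -
  obtain K where K: "0 < K" "\<And>v. chart_norm c x v \<le> K * norm v" using P1_equiv[OF c] by blast
  have "K-lipschitz_on UNIV (\<lambda>v. chart_norm c x (v - p))"
  proof (rule lipschitz_onI)
    fix v w
    have "chart_norm c x (v - p) - chart_norm c x (w - p) \<le> K * norm (v - w)" for v w
      using chart_norm_triangle_diff[of "v - p" "w - p"] K(2)[of "v - w"] by simp
    from this[of v w] this[of w v]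
    show "dist (chart_norm c x (v - p)) (chart_norm c x (w - p)) \<le> K * dist v w"
      by (simp add: dist_norm abs_le_iff norm_minus_commute)
  qed (use K in auto)
  then show thesis by (rule that)
qed

lemma chart_norm_continuous_on: "continuous_on S (\<lambda>v. chart_norm c x (v - p))"
proof -
  obtain K where "K-lipschitz_on UNIV (\<lambda>v. chart_norm c x (v - p))" by (rule chart_norm_lipschitz)
  then show ?thesis using lipschitz_on_continuous_on continuous_on_subset[OF _ subset_UNIV] by blast
qed

text \<open>In a chart the supremum runs over the unit sphere of \<open>chart_norm c x\<close>; by
  \<open>P1_equiv\<close> it is a supremum of a bounded set. For an upper bound the sphere must
  contain a vector, since \<open>Sup\<close> of the empty set carries no information.\<close>

lemma dual_norm_bound:
  assumes g: "(g \<circ> chart_inv c has_derivative D) (at (snd c x))"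
  shows "\<bar>D v\<bar> \<le> dual_norm A F x (differential A g x) * chart_norm c x v"
    and "(\<And>v. \<bar>D v\<bar> \<le> k * chart_norm c x v) \<Longrightarrow> (\<exists>v::'x. v \<noteq> 0) \<Longrightarrow>
      dual_norm A F x (differential A g x) \<le> k"
proof -
  interpret D: bounded_linear D using g by (rule has_derivative_bounded_linear)
  obtain k0 where k0: "k0 > 0" "\<And>v. k0 * norm v \<le> chart_norm c x v" using P1_equiv[OF c] by blast
  define Z where "Z = {\<bar>D v\<bar> | v. chart_norm c x v = 1}"
  have Z: "dual_norm A F x (differential A g x) = Sup Z"
  proof -
    have "{\<bar>differential A g x \<xi>\<bar> | \<xi>. \<xi> \<in> range (chart_vec A c x) \<and> F x \<xi> = 1} =
        {\<bar>differential A g x (chart_vec A c x v)\<bar> | v. chart_norm c x v = 1}" by blast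
    then show ?thesis
      unfolding dual_norm_def Z_def tangent_space_eq[OF c] differential_chart_vec[OF c g] by simp
  qed
  have norm1: "chart_norm c x ((1 / chart_norm c x v) *\<^sub>R v) = 1" if "v \<noteq> 0" for v
    using chart_norm_nonneg[of v] chart_norm_zero_iff[of v] that by (simp add: chart_norm_scale)
  obtain L where L: "\<And>v. norm (D v) \<le> norm v * L" using D.bounded by blast
  have bdd: "bdd_above Z"
  proof (rule bdd_aboveI[where M="\<bar>L\<bar> / k0"])
    fix z assume "z \<in> Z"
    then obtain v where v: "z = \<bar>D v\<bar>" "chart_norm c x v = 1" unfolding Z_def by blast
    have "z \<le> norm v * \<bar>L\<bar>" using L[of v] v(1) mult_left_mono[OF abs_ge_self, of "norm v" L] by simp
    also have "\<dots> \<le> (1 / k0) * \<bar>L\<bar>"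
      using k0(1) k0(2)[of v] v(2) by (intro mult_right_mono) (auto simp: field_simps)
    finally show "z \<le> \<bar>L\<bar> / k0" by simp
  qed
  show "\<bar>D v\<bar> \<le> dual_norm A F x (differential A g x) * chart_norm c x v"
  proof (cases "v = 0")
    case True
    then show ?thesis using chart_norm_zero_iff[of v] D.zero by simp
  next
    case False
    have pos: "0 < chart_norm c x v" using False chart_norm_nonneg[of v] chart_norm_zero_iff[of v] by simp
    have "\<bar>D ((1 / chart_norm c x v) *\<^sub>R v)\<bar> \<le> Sup Z"
      by (rule cSup_upper[OF _ bdd]) (use norm1[OF False] in \<open>auto simp: Z_def\<close>)
    then show ?thesis unfolding Z using pos by (simp add: D.scaleR abs_mult field_simps)
  qed
  show "dual_norm A F x (differential A g x) \<le> k"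
    if *: "\<And>v. \<bar>D v\<bar> \<le> k * chart_norm c x v" and "\<exists>v::'x. v \<noteq> 0"
    unfolding Z
  proof (rule cSup_least)
    show "Z \<noteq> {}" using that(2) norm1 unfolding Z_def by blast
    fix z assume "z \<in> Z"
    then obtain v where "z = \<bar>D v\<bar>" "chart_norm c x v = 1" unfolding Z_def by blast
    then show "z \<le> k" using *[of v] by simp
  qed
qed

end

text \<open>Continuity of F on the tangent bundle, unfolded in a chart. It is what makes the speed
  of a C1 curve continuous and its length an ordinary integral.\<close>

lemma chart_norm_jointly_continuous:
  assumes "c \<in> A"
  shows "continuous_on (fst c \<times> UNIV) (\<lambda>(x, v). chart_norm c x v)"
proof (subst continuous_on_open_vimage)
  show "open (fst c \<times> (UNIV :: 'x set))" using assms chart_open by (intro open_Times) auto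
  have "tangent_bundle_open A (Sigma UNIV (tangent_space A))"
  proof -
    have "{(x, v). x \<in> fst c \<and> (x, chart_vec A c x v) \<in> Sigma UNIV (tangent_space A)} = fst c \<times> UNIV"
      if "c \<in> A" for c using that by (auto simp: tangent_space_eq)
    then show ?thesis unfolding tangent_bundle_open_def using chart_open by (auto intro!: open_Times)
  qed
  then have top: "Sigma UNIV (tangent_space A) \<subseteq> topspace (tangent_bundle A)"
    unfolding openin_tangent_bundle[symmetric] by (rule openin_subset)
  show "\<forall>B. open B \<longrightarrow> open ((\<lambda>(x, v). chart_norm c x v) -` B \<inter> (fst c \<times> UNIV))"
  proof (intro allI impI)
    fix B :: "real set" assume B: "open B"
    have "openin (tangent_bundle A) {z \<in> topspace (tangent_bundle A). (case z of (x, \<xi>) \<Rightarrow> F x \<xi>) \<in> B}"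
      by (rule openin_continuous_map_preimage[OF continuous_norm open_openin[THEN iffD1, OF B]])
    then have "open {(x, v). x \<in> fst c \<and> (x, chart_vec A c x v) \<in>
        {z \<in> topspace (tangent_bundle A). (case z of (x, \<xi>) \<Rightarrow> F x \<xi>) \<in> B}}"
      unfolding openin_tangent_bundle tangent_bundle_open_def using assms by (elim conjE) (rule bspec)
    also have "{(x, v). x \<in> fst c \<and> (x, chart_vec A c x v) \<in>
        {z \<in> topspace (tangent_bundle A). (case z of (x, \<xi>) \<Rightarrow> F x \<xi>) \<in> B}} =
        (\<lambda>(x, v). chart_norm c x v) -` B \<inter> (fst c \<times> UNIV)"
      using top tangent_space_eq[OF assms] by auto
    finally show "open ((\<lambda>(x, v). chart_norm c x v) -` B \<inter> (fst c \<times> UNIV))" .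
  qed
qed

end

section \<open>Piecewise $C^1$ paths and their length\<close>

text \<open>Piecewise C1 paths as iterated concatenations: statements about lengths can then be
  proved by induction instead of by tracking consecutive points of a subdivision.\<close>

inductive C1_chain :: "('m::t2_space, 'x::banach) chart set \<Rightarrow> (real \<Rightarrow> 'm) \<Rightarrow> real \<Rightarrow> real \<Rightarrow> bool"
  for A \<gamma> where
  single: "a < b \<Longrightarrow> C1_curve_on A {a..b} \<gamma> \<Longrightarrow> C1_chain A \<gamma> a b"
| append: "C1_chain A \<gamma> a b \<Longrightarrow> C1_chain A \<gamma> b c \<Longrightarrow> C1_chain A \<gamma> a c"

lemma C1_chain_less: "C1_chain A \<gamma> a b \<Longrightarrow> a < b"
  by (induction rule: C1_chain.induct) auto

lemma piecewise_C1_path_of_chain: "C1_chain A \<gamma> a b \<Longrightarrow> piecewise_C1_path A a b \<gamma>"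
proof (induction rule: C1_chain.induct)
  case (single a b)
  then show ?case unfolding piecewise_C1_path_def by (intro conjI exI[of _ "{a, b}"]) auto
next
  case (append a b c)
  obtain P where P: "finite P" "a \<in> P" "b \<in> P" "P \<subseteq> {a..b}"
    "\<forall>s\<in>P. \<forall>t\<in>P. s < t \<and> {s<..<t} \<inter> P = {} \<longrightarrow> C1_curve_on A {s..t} \<gamma>"
    using append.IH(1) unfolding piecewise_C1_path_def by blast
  obtain Q where Q: "finite Q" "b \<in> Q" "c \<in> Q" "Q \<subseteq> {b..c}"
    "\<forall>s\<in>Q. \<forall>t\<in>Q. s < t \<and> {s<..<t} \<inter> Q = {} \<longrightarrow> C1_curve_on A {s..t} \<gamma>"
    using append.IH(2) unfolding piecewise_C1_path_def by blast
  have ab: "a < b" "b < c" using append.IH unfolding piecewise_C1_path_def by auto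
  have "C1_curve_on A {s..t} \<gamma>"
    if st: "s \<in> P \<union> Q" "t \<in> P \<union> Q" "s < t" "{s<..<t} \<inter> (P \<union> Q) = {}" for s t
  \<comment> \<open>The junction \<open>b\<close> belongs to both subdivisions, so an interval
    without subdivision points inside cannot straddle it.\<close>
  proof (cases "t \<le> b")
    case True
    then have "s \<in> P" "t \<in> P" using st(1-3) P(3) Q(4) by fastforce+
    moreover have "{s<..<t} \<inter> P = {}" using st(4) by blast
    ultimately show ?thesis using P(5) st(3) by simp
  next
    case False
    then have "\<not> s < b" using st(4) P(3) by force
    then have "s \<in> Q" "t \<in> Q" using st(1,2) False P(4) Q(2) by fastforce+
    moreover have "{s<..<t} \<inter> Q = {}" using st(4) by blast
    ultimately show ?thesis using Q(5) st(3) by simp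
  qed
  moreover have "P \<union> Q \<subseteq> {a..c}" using P(4) Q(4) ab by fastforce
  ultimately show ?case unfolding piecewise_C1_path_def
    using P(1,2) Q(1,3) ab by (intro conjI exI[of _ "P \<union> Q"]) auto
qed

text \<open>Induction on the number of subdivision points: the piece between the last two points is
  split off, and the rest is a subdivision with one point fewer.\<close>

lemma chain_of_subdivision:
  assumes "finite P" "a \<in> P" "b \<in> P" "P \<subseteq> {a..b}" "a < b"
    "\<And>s t. s \<in> P \<Longrightarrow> t \<in> P \<Longrightarrow> s < t \<Longrightarrow> {s<..<t} \<inter> P = {} \<Longrightarrow> C1_curve_on A {s..t} \<gamma>"
  shows "C1_chain A \<gamma> a b"
  using assms
proof (induction "card P" arbitrary: P b rule: less_induct)
  case less
  define m where "m = Max (P - {b})"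
  have fin: "finite (P - {b})" "P - {b} \<noteq> {}" using less.prems by auto
  have m: "m \<in> P" "m \<noteq> b" using Max_in[OF fin] unfolding m_def by auto
  have mmax: "t \<le> m" if "t \<in> P" "t \<noteq> b" for t
    unfolding m_def using that fin by (intro Max_ge) auto
  have am: "a \<le> m" "m < b" using m less.prems(4) by force+
  have last: "C1_chain A \<gamma> m b"
  proof (rule C1_chain.single[OF am(2)], rule less.prems(6))
    show "{m<..<b} \<inter> P = {}" using mmax by force
  qed (use m am less.prems in auto)
  show ?case
  proof (cases "m = a")
    case False
    have "C1_chain A \<gamma> a m"
    proof (rule less.hyps)
      show "card (P - {b}) < card P" using less.prems by (intro card_Diff1_less) auto
      show "P - {b} \<subseteq> {a..m}" using mmax less.prems(4) by force
      fix s t assume st: "s \<in> P - {b}" "t \<in> P - {b}" "s < t" "{s<..<t} \<inter> (P - {b}) = {}"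
      have "t < b" using st(2) less.prems(4) by force
      then have "{s<..<t} \<inter> P = {}" using st(4) by auto
      then show "C1_curve_on A {s..t} \<gamma>" using less.prems(6) st by blast
    qed (use less.prems m am False in auto)
    then show ?thesis using last by (rule C1_chain.append)
  qed (use last in simp)
qed

lemma piecewise_C1_path_iff_chain: "piecewise_C1_path A a b \<gamma> \<longleftrightarrow> C1_chain A \<gamma> a b"
proof
  assume "piecewise_C1_path A a b \<gamma>"
  then obtain P where "a < b" "finite P" "a \<in> P" "b \<in> P" "P \<subseteq> {a..b}"
    "\<forall>s\<in>P. \<forall>t\<in>P. s < t \<and> {s<..<t} \<inter> P = {} \<longrightarrow> C1_curve_on A {s..t} \<gamma>"
    unfolding piecewise_C1_path_def by blast
  then show "C1_chain A \<gamma> a b" by (intro chain_of_subdivision[of P]) simp_all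
qed (rule piecewise_C1_path_of_chain)

lemma C1_curve_on_subset:
  assumes "C1_curve_on A S \<gamma>" "T \<subseteq> S" shows "C1_curve_on A T \<gamma>"
  unfolding C1_curve_on_def
proof (intro conjI ballI)
  show "continuous_on T \<gamma>" using assms continuous_on_subset unfolding C1_curve_on_def by blast
  fix c assume "c \<in> A"
  then obtain D where D: "\<forall>t\<in>S \<inter> \<gamma> -` fst c. ((snd c \<circ> \<gamma>) has_vector_derivative D t) (at t within S)"
    "continuous_on (S \<inter> \<gamma> -` fst c) D"
    using assms(1) unfolding C1_curve_on_def by blast
  have "\<forall>t\<in>T \<inter> \<gamma> -` fst c. ((snd c \<circ> \<gamma>) has_vector_derivative D t) (at t within T)"
    using D(1) assms(2) has_vector_derivative_within_subset by blast
  moreover have "continuous_on (T \<inter> \<gamma> -` fst c) D"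
    using D(2) by (rule continuous_on_subset) (use assms(2) in auto)
  ultimately show "\<exists>D. (\<forall>t\<in>T \<inter> \<gamma> -` fst c. ((snd c \<circ> \<gamma>) has_vector_derivative D t) (at t within T)) \<and>
      continuous_on (T \<inter> \<gamma> -` fst c) D" by blast
qed

lemma C1_curve_on_cong:
  assumes "C1_curve_on A S \<gamma>" "\<And>t. t \<in> S \<Longrightarrow> \<gamma>' t = \<gamma> t" shows "C1_curve_on A S \<gamma>'"
  unfolding C1_curve_on_def
proof (intro conjI ballI)
  show "continuous_on S \<gamma>'"
    using assms continuous_on_cong unfolding C1_curve_on_def by (metis (no_types, lifting))
  have eq: "S \<inter> \<gamma>' -` fst c = S \<inter> \<gamma> -` fst c" for c :: "('a, 'b) chart" using assms(2) by auto
  fix c assume "c \<in> A"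
  then obtain D where D: "\<forall>t\<in>S \<inter> \<gamma> -` fst c. ((snd c \<circ> \<gamma>) has_vector_derivative D t) (at t within S)"
    "continuous_on (S \<inter> \<gamma> -` fst c) D"
    using assms(1) unfolding C1_curve_on_def by blast
  have "((snd c \<circ> \<gamma>') has_vector_derivative D t) (at t within S)" if "t \<in> S \<inter> \<gamma> -` fst c" for t
    by (rule has_vector_derivative_transform[OF _ _ D(1)[rule_format, OF that]]) (use assms(2) that in auto)
  with D(2) show "\<exists>D. (\<forall>t\<in>S \<inter> \<gamma>' -` fst c. ((snd c \<circ> \<gamma>') has_vector_derivative D t) (at t within S)) \<and>
      continuous_on (S \<inter> \<gamma>' -` fst c) D" unfolding eq by blast
qed

lemma C1_curve_on_reflect:
  assumes "C1_curve_on A {a..b} \<gamma>"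
  shows "C1_curve_on A {q - b..q - a} (\<lambda>t. \<gamma> (q - t))"
  unfolding C1_curve_on_def
proof (intro conjI ballI)
  show "continuous_on {q - b..q - a} (\<lambda>t. \<gamma> (q - t))"
    using assms unfolding C1_curve_on_def
    by (auto intro!: continuous_on_compose2[of "{a..b}" \<gamma>] continuous_intros)
  fix c assume "c \<in> A"
  then obtain D where D: "\<forall>t\<in>{a..b} \<inter> \<gamma> -` fst c. ((snd c \<circ> \<gamma>) has_vector_derivative D t) (at t within {a..b})"
    "continuous_on ({a..b} \<inter> \<gamma> -` fst c) D"
    using assms(1) unfolding C1_curve_on_def by blast
  have "((snd c \<circ> (\<lambda>t. \<gamma> (q - t))) has_vector_derivative - D (q - t)) (at t within {q - b..q - a})"
    if "t \<in> {q - b..q - a} \<inter> (\<lambda>t. \<gamma> (q - t)) -` fst c" for t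
  proof -
    have 1: "((\<lambda>t. q - t) has_vector_derivative -1) (at t within {q - b..q - a})"
      by (auto intro!: derivative_eq_intros)
    have "((snd c \<circ> \<gamma>) has_vector_derivative D (q - t)) (at (q - t) within (\<lambda>t. q - t) ` {q - b..q - a})"
    proof (rule has_vector_derivative_within_subset)
      have "q - t \<in> {a..b} \<inter> \<gamma> -` fst c" using that by auto
      then show "((snd c \<circ> \<gamma>) has_vector_derivative D (q - t)) (at (q - t) within {a..b})" using D(1) by blast
    qed auto
    from vector_diff_chain_within[OF 1 this] show ?thesis by (simp add: o_def)
  qed
  moreover have "continuous_on ({q - b..q - a} \<inter> (\<lambda>t. \<gamma> (q - t)) -` fst c) (\<lambda>t. - D (q - t))"
    by (intro continuous_intros continuous_on_compose2[OF D(2)]) auto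
  ultimately show "\<exists>D. (\<forall>t\<in>{q - b..q - a} \<inter> (\<lambda>t. \<gamma> (q - t)) -` fst c.
      ((snd c \<circ> (\<lambda>t. \<gamma> (q - t))) has_vector_derivative D t) (at t within {q - b..q - a})) \<and>
      continuous_on ({q - b..q - a} \<inter> (\<lambda>t. \<gamma> (q - t)) -` fst c) D"
    by (intro exI[of _ "\<lambda>t. - D (q - t)"] conjI ballI) auto
qed

lemma C1_chain_cong:
  "C1_chain A \<gamma> a b \<Longrightarrow> (\<And>t. t \<in> {a..b} \<Longrightarrow> \<gamma>' t = \<gamma> t) \<Longrightarrow> C1_chain A \<gamma>' a b"
proof (induction rule: C1_chain.induct)
  case (single a b)
  then show ?case by (blast intro: C1_chain.single C1_curve_on_cong)
next
  case (append a b c)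
  have "a < b" "b < c" using append.hyps C1_chain_less by blast+
  then show ?case using append.IH append.prems by (intro C1_chain.append[of _ _ a b c]) auto
qed

lemma C1_chain_reflect: "C1_chain A \<gamma> a b \<Longrightarrow> C1_chain A (\<lambda>t. \<gamma> (q - t)) (q - b) (q - a)"
proof (induction rule: C1_chain.induct)
  case (single a b)
  then show ?case using C1_curve_on_reflect by (intro C1_chain.single) auto
next
  case (append a b c)
  show ?case by (rule C1_chain.append[OF append.IH(2,1)])
qed

lemma C1_chain_subinterval:
  "C1_chain A \<gamma> a b \<Longrightarrow> a \<le> s \<Longrightarrow> s < t \<Longrightarrow> t \<le> b \<Longrightarrow> C1_chain A \<gamma> s t"
proof (induction arbitrary: s t rule: C1_chain.induct)
  case (single a b)
  have "C1_curve_on A {s..t} \<gamma>" by (rule C1_curve_on_subset[OF single.hyps(2)]) (use single in auto)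
  then show ?case using single by (intro C1_chain.single) auto
next
  case (append a b c)
  consider "t \<le> b" | "b \<le> s" | "s < b" "b < t" by linarith
  then show ?case
  proof cases
    case 3
    then show ?thesis using append.IH(1)[of s b] append.IH(2)[of b t] append.prems
      by (intro C1_chain.append[of _ _ s b t]) auto
  qed (use append in auto)
qed

lemma C1_chain_continuous: "C1_chain A \<gamma> a b \<Longrightarrow> continuous_on {a..b} \<gamma>"
proof (induction rule: C1_chain.induct)
  case (append a b c)
  have "a < b" "b < c" using append.hyps C1_chain_less by blast+
  then have "{a..c} = {a..b} \<union> {b..c}" by auto
  then show ?case using append.IH by (simp add: continuous_on_closed_Un)
qed (auto simp: C1_curve_on_def)

section \<open>Speed, length, and concatenation of paths\<close>

context C1_Finsler_manifold begin

abbreviation (input) speed :: "(real \<Rightarrow> 'm) \<Rightarrow> real \<Rightarrow> real" where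
  "speed \<gamma> t \<equiv> F (\<gamma> t) (velocity A \<gamma> t)"

lemma curve_chart_change:
  assumes c: "c \<in> A" "c' \<in> A" "\<gamma> t \<in> fst c" "\<gamma> t \<in> fst c'"
    and \<gamma>: "continuous_on S \<gamma>" "t \<in> S"
    and D: "((snd c \<circ> \<gamma>) has_vector_derivative D) (at t within S)"
  shows "((snd c' \<circ> \<gamma>) has_vector_derivative transition_deriv c c' (\<gamma> t) D) (at t within S)"
proof -
  have "((snd c' \<circ> chart_inv c) has_derivative transition_deriv c c' (\<gamma> t)) (at (snd c (\<gamma> t)))"
    by (rule transition_has_derivative[OF c])
  then have "((snd c' \<circ> chart_inv c) has_derivative transition_deriv c c' (\<gamma> t))
      (at ((snd c \<circ> \<gamma>) t) within (snd c \<circ> \<gamma>) ` S)"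
    by (simp add: has_derivative_at_withinI)
  from vector_derivative_diff_chain_within[OF D this]
  have *: "((snd c' \<circ> chart_inv c) \<circ> (snd c \<circ> \<gamma>) has_vector_derivative transition_deriv c c' (\<gamma> t) D) (at t within S)" .
  have "(\<gamma> \<longlongrightarrow> \<gamma> t) (at t within S)" using \<gamma> unfolding continuous_on_def by blast
  then have "\<forall>\<^sub>F s in at t within S. \<gamma> s \<in> fst c" using c chart_open topological_tendstoD by blast
  then have ev: "\<forall>\<^sub>F s in at t within S. ((snd c' \<circ> chart_inv c) \<circ> (snd c \<circ> \<gamma>)) s = (snd c' \<circ> \<gamma>) s"
    by eventually_elim (use c in simp)
  show ?thesis
    using * unfolding has_vector_derivative_def
    by (rule has_derivative_transform_eventually[OF _ ev]) (use c \<gamma> in auto)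
qed

text \<open>\<open>velocity\<close> uses the two-sided derivative and is meaningless at the end
  points. The one-sided derivatives give a function \<sigma> that is continuous on the closed
  interval, independent of the chart by \<open>chart_vec_transition\<close>, and equal to the speed
  inside; lengths are computed with \<sigma>.\<close>

lemma curve_speed:
  assumes \<gamma>: "C1_curve_on A {a..b} \<gamma>" and ab: "a < b"
  obtains \<sigma> where "continuous_on {a..b} \<sigma>" "\<And>t. t \<in> {a..b} \<Longrightarrow> 0 \<le> \<sigma> t"
    "\<And>t. t \<in> {a<..<b} \<Longrightarrow> speed \<gamma> t = \<sigma> t"
    "\<And>c t D. c \<in> A \<Longrightarrow> t \<in> {a..b} \<Longrightarrow> \<gamma> t \<in> fst c \<Longrightarrow>
      ((snd c \<circ> \<gamma>) has_vector_derivative D) (at t within {a..b}) \<Longrightarrow> \<sigma> t = chart_norm c (\<gamma> t) D"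
proof -
  have \<gamma>c: "continuous_on {a..b} \<gamma>" using \<gamma> unfolding C1_curve_on_def by blast
  define ch where "ch = (\<lambda>t. SOME c. c \<in> A \<and> \<gamma> t \<in> fst c)"
  have ch: "ch t \<in> A" "\<gamma> t \<in> fst (ch t)" for t
    using someI_ex[of "\<lambda>c. c \<in> A \<and> \<gamma> t \<in> fst c"] obtain_chart unfolding ch_def by (metis (lifting))+
  define \<sigma> where "\<sigma> = (\<lambda>t. chart_norm (ch t) (\<gamma> t) (vector_derivative (snd (ch t) \<circ> \<gamma>) (at t within {a..b})))"
  have deriv: "\<exists>D. ((snd c \<circ> \<gamma>) has_vector_derivative D) (at t within {a..b})"
    if "c \<in> A" "t \<in> {a..b}" "\<gamma> t \<in> fst c" for c t
    using \<gamma> that unfolding C1_curve_on_def by blast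
  have \<sigma>: "\<sigma> t = chart_norm c (\<gamma> t) D"
    if c: "c \<in> A" and t: "t \<in> {a..b}" and "\<gamma> t \<in> fst c"
      and D: "((snd c \<circ> \<gamma>) has_vector_derivative D) (at t within {a..b})" for c t D
  proof -
    have "((snd (ch t) \<circ> \<gamma>) has_vector_derivative transition_deriv c (ch t) (\<gamma> t) D) (at t within {a..b})"
      by (rule curve_chart_change[OF c ch(1) that(3) ch(2) \<gamma>c t D])
    then have "vector_derivative (snd (ch t) \<circ> \<gamma>) (at t within {a..b}) = transition_deriv c (ch t) (\<gamma> t) D"
      using vector_derivative_within_cbox[of a b t, unfolded box_real, OF ab t] by blast
    then show ?thesis unfolding \<sigma>_def using chart_vec_transition[OF c ch(1) that(3) ch(2)] by simp
  qed
  have \<sigma>0: "0 \<le> \<sigma> t" for t unfolding \<sigma>_def by (rule chart_norm_nonneg[OF ch])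
  have \<sigma>c: "continuous_on {a..b} \<sigma>"
    unfolding continuous_on_eq_continuous_within
  proof
    fix t assume t: "t \<in> {a..b}"
    obtain c where c: "c \<in> A" "\<gamma> t \<in> fst c" by (rule obtain_chart)
    let ?S = "{a..b} \<inter> \<gamma> -` fst c"
    obtain D where D: "\<And>t. t \<in> ?S \<Longrightarrow> ((snd c \<circ> \<gamma>) has_vector_derivative D t) (at t within {a..b})"
      "continuous_on ?S D"
      using \<gamma> c unfolding C1_curve_on_def by blast
    have "continuous_on ?S (\<lambda>t. chart_norm c (\<gamma> t) (D t))"
      using continuous_on_compose2[OF chart_norm_jointly_continuous[OF c(1)]
          continuous_on_Pair[OF continuous_on_subset[OF \<gamma>c] D(2)]] by auto
    then have "continuous_on ?S \<sigma>"
    proof (rule continuous_on_eq)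
      show "chart_norm c (\<gamma> s) (D s) = \<sigma> s" if "s \<in> ?S" for s
        using \<sigma>[OF c(1) _ _ D(1)[OF that]] that by auto
    qed
    moreover obtain T where T: "open T" "T \<inter> {a..b} = \<gamma> -` fst c \<inter> {a..b}"
      using \<gamma>c chart_open[OF c(1)] unfolding continuous_on_open_invariant by blast
    \<comment> \<open>Continuity of \<gamma> makes \<open>?S\<close> relatively open in the
      interval, so continuity within it suffices.\<close>
    have "at t within {a..b} = at t within ?S"
      by (rule at_within_nhd[of t T]) (use T t c in blast)+
    ultimately show "continuous (at t within {a..b}) \<sigma>"
      using t c by (auto simp: continuous_on_eq_continuous_within)
  qed
  have "speed \<gamma> t = \<sigma> t" if t: "t \<in> {a<..<b}" for t
  proof -
    obtain c where c: "c \<in> A" "\<gamma> t \<in> fst c" by (rule obtain_chart)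
    have at: "at t within {a..b} = at t" using t by (intro at_within_interior) simp
    obtain D where D: "((snd c \<circ> \<gamma>) has_vector_derivative D) (at t within {a..b})"
      using deriv[OF c(1) _ c(2)] t by auto
    have "vector_derivative (snd c' \<circ> \<gamma>) (at t) = transition_deriv c c' (\<gamma> t) D"
      if "c' \<in> A" "\<gamma> t \<in> fst c'" for c'
      using curve_chart_change[OF c(1) that(1) c(2) that(2) \<gamma>c _ D] t
      unfolding at by (auto intro: vector_derivative_at)
    then have "velocity A \<gamma> t = chart_vec A c (\<gamma> t) D"
      unfolding velocity_def chart_vec_eq[OF c] by auto
    then show ?thesis using \<sigma>[OF c(1) _ c(2) D] t by auto
  qed
  with \<sigma>c \<sigma>0 \<sigma> show thesis using that by blast
qed

lemma curve_speed_integral: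
  assumes \<sigma>: "continuous_on {a..b} \<sigma>" "\<And>t. t \<in> {a<..<b} \<Longrightarrow> speed \<gamma> t = \<sigma> t"
  shows "speed \<gamma> integrable_on {a..b}" "path_len A F a b \<gamma> = integral {a..b} \<sigma>"
proof -
  show "speed \<gamma> integrable_on {a..b}"
    by (rule integrable_spike_finite[of "{a, b}" _ _ \<sigma>]) (use \<sigma> integrable_continuous_real in auto)
  show "path_len A F a b \<gamma> = integral {a..b} \<sigma>"
    unfolding path_len_def by (rule integral_spike[of "{a, b}"]) (use \<sigma>(2) in auto)
qed

lemma path_len_single_nonneg:
  assumes "C1_curve_on A {a..b} \<gamma>" "a < b"
  shows "speed \<gamma> integrable_on {a..b}" "0 \<le> path_len A F a b \<gamma>"
proof -
  obtain \<sigma> where \<sigma>: "continuous_on {a..b} \<sigma>" "\<And>t. t \<in> {a..b} \<Longrightarrow> 0 \<le> \<sigma> t"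
    "\<And>t. t \<in> {a<..<b} \<Longrightarrow> speed \<gamma> t = \<sigma> t" using curve_speed[OF assms] by metis
  show "speed \<gamma> integrable_on {a..b}" by (rule curve_speed_integral[OF \<sigma>(1,3)])
  show "0 \<le> path_len A F a b \<gamma>"
    using Henstock_Kurzweil_Integration.integral_nonneg[OF integrable_continuous_real[OF \<sigma>(1)] \<sigma>(2)]
      curve_speed_integral(2)[OF \<sigma>(1,3)] by simp
qed

lemma C1_chain_integrable: "C1_chain A \<gamma> a b \<Longrightarrow> speed \<gamma> integrable_on {a..b}"
proof (induction rule: C1_chain.induct)
  case (append a b c)
  then show ?case
    using Henstock_Kurzweil_Integration.integrable_combine[of a b c] C1_chain_less less_imp_le by metis
qed (rule path_len_single_nonneg)

lemma path_len_append:
  assumes "C1_chain A \<gamma> a c" "a \<le> b" "b \<le> c"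
  shows "path_len A F a c \<gamma> = path_len A F a b \<gamma> + path_len A F b c \<gamma>"
  unfolding path_len_def
  using Henstock_Kurzweil_Integration.integral_combine[OF assms(2,3) C1_chain_integrable[OF assms(1)]] by simp

lemma path_len_nonneg: "C1_chain A \<gamma> a b \<Longrightarrow> 0 \<le> path_len A F a b \<gamma>"
proof (induction rule: C1_chain.induct)
  case (append a b c)
  then show ?case
    using path_len_append[OF C1_chain.append[OF append.hyps]] C1_chain_less less_imp_le by (metis add_nonneg_nonneg)
qed (rule path_len_single_nonneg)

text \<open>The velocity at an interior time depends only on nearby values of the curve. At the end
  points it also sees values outside the interval, and these two points are discarded as a null
  set.\<close>

lemma path_len_cong:
  assumes "C1_chain A \<gamma> a b" "\<And>t. t \<in> {a..b} \<Longrightarrow> \<gamma>' t = \<gamma> t"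
  shows "path_len A F a b \<gamma>' = path_len A F a b \<gamma>"
  unfolding path_len_def
proof (rule integral_spike[of "{a, b}"])
  fix t assume t: "t \<in> {a..b} - {a, b}"
  have ev: "\<forall>\<^sub>F s in nhds t. \<gamma>' s = \<gamma> s"
    using eventually_nhds_in_open[of "{a<..<b}" t] t by (auto elim!: eventually_mono intro!: assms(2))
  have "vector_derivative (snd c \<circ> \<gamma>') (at t) = vector_derivative (snd c \<circ> \<gamma>) (at t)"
    for c :: "('m, 'x) chart"
    by (rule vector_derivative_cong_eq) (use ev in \<open>auto elim!: eventually_mono\<close>)
  then show "speed \<gamma> t = speed \<gamma>' t" unfolding velocity_def using assms(2)[of t] t by auto
qed simp

lemma path_len_reflect: "C1_chain A \<gamma> a b \<Longrightarrow> path_len A F (q - b) (q - a) (\<lambda>t. \<gamma> (q - t)) = path_len A F a b \<gamma>"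
proof (induction rule: C1_chain.induct)
  case (single a b)
  let ?\<gamma> = "\<lambda>t. \<gamma> (q - t)"
  obtain \<sigma> where \<sigma>: "continuous_on {a..b} \<sigma>" "\<And>t. t \<in> {a<..<b} \<Longrightarrow> speed \<gamma> t = \<sigma> t"
    "\<And>c t D. c \<in> A \<Longrightarrow> t \<in> {a..b} \<Longrightarrow> \<gamma> t \<in> fst c \<Longrightarrow>
      ((snd c \<circ> \<gamma>) has_vector_derivative D) (at t within {a..b}) \<Longrightarrow> \<sigma> t = chart_norm c (\<gamma> t) D"
    using curve_speed[OF single.hyps(2,1)] by metis
  have refl: "C1_curve_on A {q - b..q - a} ?\<gamma>" using single.hyps(2) by (rule C1_curve_on_reflect)
  obtain \<tau> where \<tau>: "continuous_on {q - b..q - a} \<tau>" "\<And>t. t \<in> {q - b<..<q - a} \<Longrightarrow> speed ?\<gamma> t = \<tau> t"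
    "\<And>c t D. c \<in> A \<Longrightarrow> t \<in> {q - b..q - a} \<Longrightarrow> ?\<gamma> t \<in> fst c \<Longrightarrow>
      ((snd c \<circ> ?\<gamma>) has_vector_derivative D) (at t within {q - b..q - a}) \<Longrightarrow> \<tau> t = chart_norm c (?\<gamma> t) D"
    using curve_speed[OF refl] single.hyps(1) by (metis diff_strict_left_mono)
  have eq: "\<tau> t = \<sigma> (q - t)" if t: "t \<in> {q - b..q - a}" for t
  proof -
    have t': "q - t \<in> {a..b}" using t by auto
    obtain c where c: "c \<in> A" "\<gamma> (q - t) \<in> fst c" by (rule obtain_chart)
    obtain D where D: "((snd c \<circ> \<gamma>) has_vector_derivative D) (at (q - t) within {a..b})"
      using single.hyps(2) c t' unfolding C1_curve_on_def by blast
    have 1: "((\<lambda>t. q - t) has_vector_derivative -1) (at t within {q - b..q - a})"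
      by (auto intro!: derivative_eq_intros)
    have "((snd c \<circ> \<gamma>) has_vector_derivative D) (at (q - t) within (\<lambda>t. q - t) ` {q - b..q - a})"
      by (rule has_vector_derivative_within_subset[OF D]) auto
    from vector_diff_chain_within[OF 1 this]
    have "((snd c \<circ> ?\<gamma>) has_vector_derivative - D) (at t within {q - b..q - a})" by (simp add: o_def)
    from \<tau>(3)[OF c(1) t c(2) this] \<sigma>(3)[OF c(1) t' c(2) D] show ?thesis
      by (simp add: chart_norm_minus[OF c])
  qed
  have "path_len A F (q - b) (q - a) ?\<gamma> = integral {q - b..q - a} \<tau>"
    by (rule curve_speed_integral[OF \<tau>(1,2)])
  also have "\<dots> = integral {q - b..q - a} (\<lambda>t. \<sigma> (q - t))"
    by (rule Henstock_Kurzweil_Integration.integral_cong) (rule eq)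
  \<comment> \<open>The substitution \<open>q - t\<close> is split into a shift and a reflection,
    the two forms for which integral rules are at hand.\<close>
  also have "\<dots> = integral {- b - (- q).. - a - (- q)} (\<lambda>t. (\<lambda>u. \<sigma> (- u)) (t + (- q)))" by simp
  also have "\<dots> = integral {- b.. - a} (\<lambda>u. \<sigma> (- u))" by (rule integral_shift_real_ivl)
  also have "\<dots> = integral {a..b} \<sigma>" by (rule Henstock_Kurzweil_Integration.integral_reflect_real)
  also have "\<dots> = path_len A F a b \<gamma>" by (rule curve_speed_integral(2)[OF \<sigma>(1,2), symmetric])
  finally show ?case .
next
  case (append a b c)
  have *: "a < b" "b < c" using append.hyps C1_chain_less by blast+
  have "path_len A F (q - c) (q - a) (\<lambda>t. \<gamma> (q - t)) =
      path_len A F (q - c) (q - b) (\<lambda>t. \<gamma> (q - t)) + path_len A F (q - b) (q - a) (\<lambda>t. \<gamma> (q - t))"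
    by (rule path_len_append[OF C1_chain_reflect[OF C1_chain.append[OF append.hyps]]]) (use * in auto)
  also have "\<dots> = path_len A F a b \<gamma> + path_len A F b c \<gamma>" using append.IH by simp
  also have "\<dots> = path_len A F a c \<gamma>"
    by (rule path_len_append[OF C1_chain.append[OF append.hyps], symmetric]) (use * in auto)
  finally show ?case .
qed

text \<open>The lengths whose infimum is the distance, as a relation. Its symmetry, transitivity and
  reflexivity become the metric axioms.\<close>

definition joined :: "'m \<Rightarrow> 'm \<Rightarrow> real \<Rightarrow> bool" where
  "joined p q l \<longleftrightarrow> (\<exists>a b \<gamma>. C1_chain A \<gamma> a b \<and> \<gamma> a = p \<and> \<gamma> b = q \<and> path_len A F a b \<gamma> = l)"

lemma joined_sym: "joined p q l \<Longrightarrow> joined q p l"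
  unfolding joined_def
proof (elim exE conjE)
  fix a b \<gamma> assume *: "C1_chain A \<gamma> a b" "\<gamma> a = p" "\<gamma> b = q" "path_len A F a b \<gamma> = l"
  show "\<exists>a b \<gamma>. C1_chain A \<gamma> a b \<and> \<gamma> a = q \<and> \<gamma> b = p \<and> path_len A F a b \<gamma> = l"
    using C1_chain_reflect[OF *(1), of 0] path_len_reflect[OF *(1), of 0] *(2-4)
    by (intro exI[of _ "0 - b"] exI[of _ "0 - a"] exI[of _ "\<lambda>t. \<gamma> (0 - t)"]) simp
qed

lemma joined_trans:
  assumes "joined p q l" "joined q r l'" shows "joined p r (l + l')"
proof -
  obtain a b \<gamma> where 1: "C1_chain A \<gamma> a b" "\<gamma> a = p" "\<gamma> b = q" "path_len A F a b \<gamma> = l"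
    using assms(1) unfolding joined_def by blast
  obtain a' b' \<delta> where 2: "C1_chain A \<delta> a' b'" "\<delta> a' = r" "\<delta> b' = q" "path_len A F a' b' \<delta> = l'"
    using joined_sym[OF assms(2)] unfolding joined_def by blast
  \<comment> \<open>\<delta> runs from r to q. Reflecting its parameter to \<open>b + b' - t\<close>
    reverses it and moves its start to \<open>b\<close>, where the first path ends.\<close>
  define e where "e = b + b' - a'"
  define \<eta> where "\<eta> = (\<lambda>t. \<delta> (b + b' - t))"
  define \<zeta> where "\<zeta> = (\<lambda>t. if t \<le> b then \<gamma> t else \<eta> t)"
  have 3: "C1_chain A \<eta> b e" "path_len A F b e \<eta> = l'" "\<eta> b = q" "\<eta> e = r"
    using C1_chain_reflect[OF 2(1), of "b + b'"] path_len_reflect[OF 2(1), of "b + b'"] 2(2-4)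
    unfolding e_def \<eta>_def by simp_all
  have \<zeta>1: "\<zeta> t = \<gamma> t" if "t \<in> {a..b}" for t using that unfolding \<zeta>_def by simp
  have \<zeta>2: "\<zeta> t = \<eta> t" if "t \<in> {b..e}" for t using that 1(3) 3(3) unfolding \<zeta>_def by auto
  have less: "a < b" "b < e" using C1_chain_less 1 3 by blast+
  have ch: "C1_chain A \<zeta> a e"
    by (rule C1_chain.append[OF C1_chain_cong[OF 1(1) \<zeta>1] C1_chain_cong[OF 3(1) \<zeta>2]])
  moreover have "path_len A F a e \<zeta> = l + l'"
    using path_len_append[OF ch, of b] less path_len_cong[OF 1(1) \<zeta>1] path_len_cong[OF 3(1) \<zeta>2] 1(4) 3(2) by simp
  moreover have "\<zeta> a = p" "\<zeta> e = r" using 1 3 less unfolding \<zeta>_def by auto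
  ultimately show ?thesis unfolding joined_def by blast
qed

lemma joined_nonneg: "joined p q l \<Longrightarrow> 0 \<le> l"
  unfolding joined_def using path_len_nonneg by blast

lemma finsler_dist_eq: "finsler_dist A F p q = Inf {l. joined p q l}"
  unfolding finsler_dist_def joined_def piecewise_C1_path_iff_chain
  by (intro arg_cong[of _ _ Inf] Collect_cong iff_exI) auto

lemma finsler_dist_le: "joined p q l \<Longrightarrow> finsler_dist A F p q \<le> l"
  unfolding finsler_dist_eq by (rule cInf_lower) (use joined_nonneg in \<open>auto intro: bdd_belowI[of _ 0]\<close>)

end

section \<open>The Finsler metric\<close>

text \<open>Continuous induction: the supremum of the times up to which P holds satisfies P by
  \<open>left\<close>, and by \<open>right\<close> it cannot be smaller than \<open>b\<close>. It
  serves to propagate differential inequalities along curves.\<close>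

lemma real_interval_induct:
  fixes a b :: real
  assumes base: "P a"
    and left: "\<And>t. a < t \<Longrightarrow> t \<le> b \<Longrightarrow> (\<And>s. a \<le> s \<Longrightarrow> s < t \<Longrightarrow> P s) \<Longrightarrow> P t"
    and right: "\<And>t. a \<le> t \<Longrightarrow> t < b \<Longrightarrow> P t \<Longrightarrow> \<exists>\<delta>>0. \<forall>s. t < s \<and> s < t + \<delta> \<and> s \<le> b \<longrightarrow> P s"
    and t: "a \<le> t" "t \<le> b"
  shows "P t"
proof -
  define S where "S = {t. a \<le> t \<and> t \<le> b \<and> (\<forall>s. a \<le> s \<and> s \<le> t \<longrightarrow> P s)}"
  have aS: "a \<in> S" using t base unfolding S_def by auto
  have bdd: "bdd_above S" unfolding S_def by (auto intro: bdd_aboveI[of _ b])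
  define T where "T = Sup S"
  have T: "a \<le> T" "T \<le> b"
    using aS bdd cSup_upper unfolding T_def apply blast
    using aS unfolding T_def by (intro cSup_least) (auto simp: S_def)
  have below: "P s" if "a \<le> s" "s < T" for s
  proof -
    obtain u where "u \<in> S" "s < u" using less_cSupD[of S s] aS \<open>s < T\<close> unfolding T_def by blast
    then show ?thesis using that unfolding S_def by auto
  qed
  have PT: "P T" using base left[of T] below T by (cases "a = T") auto
  have upto: "P s" if "a \<le> s" "s \<le> T" for s using below PT that by (cases "s = T") auto
  have "T = b"
  proof (rule ccontr)
    assume "T \<noteq> b"
    then obtain \<delta> where \<delta>: "\<delta> > 0" "\<And>s. T < s \<Longrightarrow> s < T + \<delta> \<Longrightarrow> s \<le> b \<Longrightarrow> P s"
      using right[of T] T PT by auto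
    define u where "u = min b (T + \<delta> / 2)"
    have u: "T < u" "u < T + \<delta>" "u \<le> b" unfolding u_def using \<delta> T \<open>T \<noteq> b\<close> by auto
    have "P s" if "a \<le> s" "s \<le> u" for s
      using upto[of s] \<delta>(2)[of s] that u by (cases "s \<le> T") auto
    then have "u \<in> S" unfolding S_def using u T by auto
    then have "u \<le> T" unfolding T_def using bdd by (rule cSup_upper)
    then show False using u by simp
  qed
  then show ?thesis using upto t by simp
qed

section \<open>Comparison of the Finsler distance with norms in a chart\<close>

context C1_Finsler_manifold begin

lemma chart_inv_mem: "p \<in> snd c ` S \<Longrightarrow> c \<in> A \<Longrightarrow> S \<subseteq> fst c \<Longrightarrow> chart_inv c p \<in> S \<and> snd c (chart_inv c p) = p"
  by auto

text \<open>The connecting path is the straight segment in the chart. Its chart velocity is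
  constant, and by P2 its speed is at most k times the norm of that velocity at \<open>x0\<close>.
  The radius keeps the segment inside the neighbourhood from P2.\<close>

lemma joined_near:
  assumes c: "c \<in> A" "x0 \<in> fst c" and k: "1 < k"
  obtains \<rho> where "0 < \<rho>" "\<And>y. y \<in> fst c \<Longrightarrow> norm (snd c y - snd c x0) < \<rho> \<Longrightarrow>
    \<exists>l. joined x0 y l \<and> l \<le> k * chart_norm c x0 (snd c y - snd c x0)"
proof -
  obtain W where W: "open W" "x0 \<in> W" "W \<subseteq> fst c"
    and WP: "\<And>y v. y \<in> W \<Longrightarrow> chart_norm c y v \<le> k * chart_norm c x0 v"
    using P2[OF c, of "k - 1"] k by auto
  have "open (snd c ` (fst c \<inter> W))" by (rule open_chart_image[OF c(1) W(1)])
  then obtain \<rho> where \<rho>: "\<rho> > 0" "ball (snd c x0) \<rho> \<subseteq> snd c ` (fst c \<inter> W)"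
    using open_contains_ball W(2) c(2) by (metis IntI imageI)
  show thesis
  proof (rule that[OF \<rho>(1)])
    fix y assume y: "y \<in> fst c" "norm (snd c y - snd c x0) < \<rho>"
    define v where "v = snd c y - snd c x0"
    define line where "line = (\<lambda>t::real. snd c x0 + t *\<^sub>R v)"
    define \<gamma> where "\<gamma> = (\<lambda>t. chart_inv c (line t))"
    have line: "line t \<in> snd c ` (fst c \<inter> W)" if "t \<in> {0..1}" for t
    proof -
      have "norm (t *\<^sub>R v) \<le> 1 * norm v" using that by (simp add: mult_left_le_one_le)
      then have "line t \<in> ball (snd c x0) \<rho>" using y(2) unfolding line_def v_def by (simp add: dist_norm)
      then show ?thesis using \<rho>(2) by blast
    qed
    have \<gamma>: "\<gamma> t \<in> fst c" "\<gamma> t \<in> W" "snd c (\<gamma> t) = line t" if "t \<in> {0..1}" for t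
      using chart_inv_mem[OF line[OF that] c(1)] unfolding \<gamma>_def by auto
    have linec: "continuous_on S line" for S unfolding line_def by (intro continuous_intros)
    have lined: "(line has_vector_derivative v) (at t within S)" for t S
      unfolding line_def by (auto intro!: derivative_eq_intros)
    have "line ` {0..1} \<subseteq> snd c ` fst c" using line by blast
    then have cont: "continuous_on {0..1} \<gamma>"
      unfolding \<gamma>_def by (rule continuous_on_compose2[OF chart_inv_continuous[OF c(1)] linec])
    have "C1_curve_on A {0..1} \<gamma>"
      unfolding C1_curve_on_def
    proof (intro conjI ballI cont)
      fix c' assume c': "c' \<in> A"
      let ?S = "{0..1} \<inter> \<gamma> -` fst c'"
      define J where "J = (\<lambda>p. Blinfun (frechet_derivative (snd c' \<circ> chart_inv c) (at p)))"
      have C1: "C1_on (snd c ` (fst c \<inter> fst c')) (snd c' \<circ> chart_inv c)" by (rule transition_C1[OF c(1) c'])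
      have mem: "line t \<in> snd c ` (fst c \<inter> fst c')" if "t \<in> ?S" for t
        using \<gamma>[of t] that by (metis IntD1 IntD2 IntI imageI vimageD)
      have "((snd c' \<circ> \<gamma>) has_vector_derivative J (line t) v) (at t within {0..1})" if "t \<in> ?S" for t
      proof -
        have "((snd c' \<circ> chart_inv c) has_derivative J (line t)) (at (line t) within line ` {0..1})"
          unfolding J_def blinfun_apply_Blinfun_frechet_derivative[OF C1_on_differentiable[OF C1 mem[OF that]]]
          by (rule has_derivative_at_withinI[OF C1_on_has_derivative[OF C1 mem[OF that]]])
        from vector_derivative_diff_chain_within[OF lined this]
        show ?thesis unfolding \<gamma>_def by (simp add: o_def)
      qed
      moreover have "continuous_on ?S (\<lambda>t. J (line t) v)"
      proof -
        have "continuous_on (snd c ` (fst c \<inter> fst c')) J" using C1 unfolding C1_on_iff J_def by blast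
        then have "continuous_on ?S (\<lambda>t. J (line t))"
          by (rule continuous_on_compose2[OF _ linec]) (use mem in blast)
        then show ?thesis by (intro continuous_intros)
      qed
      ultimately show "\<exists>D. (\<forall>t\<in>?S. ((snd c' \<circ> \<gamma>) has_vector_derivative D t) (at t within {0..1})) \<and>
          continuous_on ?S D"
        by (intro exI[of _ "\<lambda>t. J (line t) v"] conjI ballI)
    qed
    note C = this
    obtain \<sigma> where \<sigma>: "continuous_on {0..1} \<sigma>" "\<And>t. t \<in> {0..1} \<Longrightarrow> 0 \<le> \<sigma> t"
      "\<And>t. t \<in> {0<..<1} \<Longrightarrow> speed \<gamma> t = \<sigma> t"
      "\<And>c t D. c \<in> A \<Longrightarrow> t \<in> {0..1} \<Longrightarrow> \<gamma> t \<in> fst c \<Longrightarrow>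
        ((snd c \<circ> \<gamma>) has_vector_derivative D) (at t within {0..1}) \<Longrightarrow> \<sigma> t = chart_norm c (\<gamma> t) D"
      using curve_speed[OF C zero_less_one] by blast
    have \<sigma>le: "\<sigma> t \<le> k * chart_norm c x0 v" if t: "t \<in> {0..1}" for t
    proof -
      have "((snd c \<circ> \<gamma>) has_vector_derivative v) (at t within {0..1})"
        by (rule has_vector_derivative_transform[OF t _ lined]) (use \<gamma> in auto)
      then show ?thesis using \<sigma>(4)[OF c(1) t \<gamma>(1)[OF t]] WP[OF \<gamma>(2)[OF t]] by simp
    qed
    have "path_len A F 0 1 \<gamma> = integral {0..1} \<sigma>" by (rule curve_speed_integral(2)[OF \<sigma>(1,3)])
    also have "\<dots> \<le> integral {0..1} (\<lambda>t::real. k * chart_norm c x0 v)"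
      by (rule Henstock_Kurzweil_Integration.integral_le) (use \<sigma>(1) \<sigma>le integrable_continuous_real in auto)
    finally have "path_len A F 0 1 \<gamma> \<le> k * chart_norm c x0 v" by simp
    moreover have "\<gamma> 0 = x0" "\<gamma> 1 = y" unfolding \<gamma>_def line_def v_def using c y(1) by simp_all
    moreover have "C1_chain A \<gamma> 0 1" by (rule C1_chain.single[OF zero_less_one C])
    ultimately show "\<exists>l. joined x0 y l \<and> l \<le> k * chart_norm c x0 (snd c y - snd c x0)"
      unfolding joined_def v_def by blast
  qed
qed

text \<open>Paths need a nondegenerate parameter interval; the segment from p to itself in a chart
  has one and bounds its length by 0.\<close>

lemma joined_refl: "joined p p 0"
proof -
  obtain c where c: "c \<in> A" "p \<in> fst c" by (rule obtain_chart)
  obtain \<rho> where \<rho>: "0 < \<rho>" "\<And>y. y \<in> fst c \<Longrightarrow> norm (snd c y - snd c p) < \<rho> \<Longrightarrow>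
    \<exists>l. joined p y l \<and> l \<le> 2 * chart_norm c p (snd c y - snd c p)"
    using joined_near[OF c, of 2] by (metis one_less_numeral_iff semiring_norm(76))
  from \<rho>(2)[OF c(2)] obtain l where "joined p p l" "l \<le> 0"
    using \<rho>(1) chart_norm_zero_iff[OF c, of 0] by auto
  then show ?thesis using joined_nonneg[of p p l] by (metis order_antisym)
qed

text \<open>By connectedness: both the set of points reachable from p and its complement are open.
  Without this the infimum defining the distance might range over the empty set.\<close>

lemma joined_exists: "\<exists>l. joined p q l"
proof -
  define S where "S = {q. \<exists>l. joined p q l}"
  have nbhd: "\<exists>T. open T \<and> q \<in> T \<and> (\<forall>y\<in>T. \<exists>l. joined q y l)" for q
  proof -
    obtain c where c: "c \<in> A" "q \<in> fst c" by (rule obtain_chart)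
    obtain \<rho> where \<rho>: "0 < \<rho>" "\<And>y. y \<in> fst c \<Longrightarrow> norm (snd c y - snd c q) < \<rho> \<Longrightarrow>
      \<exists>l. joined q y l \<and> l \<le> 2 * chart_norm c q (snd c y - snd c q)"
      using joined_near[OF c, of 2] by (metis one_less_numeral_iff semiring_norm(76))
    have "open {y \<in> fst c. snd c y \<in> ball (snd c q) \<rho>}" by (rule open_chart_preimage[OF c(1) open_ball])
    then show ?thesis using \<rho> c(2)
      by (intro exI[of _ "{y \<in> fst c. snd c y \<in> ball (snd c q) \<rho>}"])
         (auto simp: dist_norm norm_minus_commute)
  qed
  have "open S"
  proof (subst open_subopen, rule ballI)
    fix q assume "q \<in> S"
    then show "\<exists>T. open T \<and> q \<in> T \<and> T \<subseteq> S"
    proof -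
      obtain T where T: "open T" "q \<in> T" "\<forall>y\<in>T. \<exists>l. joined q y l" using nbhd[of q] by blast
      then have "T \<subseteq> S" using \<open>q \<in> S\<close> joined_trans unfolding S_def by blast
      then show ?thesis using T by blast
    qed
  qed
  moreover have "open (- S)"
  proof (subst open_subopen, rule ballI)
    fix q assume q: "q \<in> - S"
    obtain T where T: "open T" "q \<in> T" "\<forall>y\<in>T. \<exists>l. joined q y l" using nbhd[of q] by blast
    have "T \<subseteq> - S"
    proof
      fix y assume "y \<in> T"
      then obtain l where "joined y q l" using T(3) joined_sym by blast
      then show "y \<in> - S" using q joined_trans unfolding S_def by blast
    qed
    then show "\<exists>T. open T \<and> q \<in> T \<and> T \<subseteq> - S" using T by blast
  qed
  ultimately have "S = {} \<or> - S = {}" using connectedD[OF conn, of S "- S"] by auto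
  moreover have "p \<in> S" unfolding S_def using joined_refl by blast
  ultimately show ?thesis unfolding S_def by blast
qed

abbreviation (input) fdist :: "'m \<Rightarrow> 'm \<Rightarrow> real" where "fdist \<equiv> finsler_dist A F"

lemma fdist_less: "fdist p q < r \<Longrightarrow> \<exists>l<r. joined p q l"
proof -
  assume "fdist p q < r"
  moreover have "{l. joined p q l} \<noteq> {}" using joined_exists by simp
  ultimately have "\<exists>l\<in>{l. joined p q l}. l < r"
    unfolding finsler_dist_eq by (intro cInf_lessD)
  then show ?thesis by auto
qed

lemma fdist_nonneg: "0 \<le> fdist p q"
  unfolding finsler_dist_eq by (rule cInf_greatest) (use joined_exists joined_nonneg in auto)

lemma fdist_refl: "fdist p p = 0"
  using finsler_dist_le[OF joined_refl] fdist_nonneg by (metis order_antisym)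

lemma fdist_commute: "fdist p q = fdist q p"
  unfolding finsler_dist_eq by (intro arg_cong[of _ _ Inf] Collect_cong iffI; erule joined_sym)

lemma fdist_triangle: "fdist p r \<le> fdist p q + fdist q r"
proof (rule field_le_epsilon)
  fix e :: real assume "0 < e"
  then obtain l l' where "l < fdist p q + e/2" "joined p q l" "l' < fdist q r + e/2" "joined q r l'"
    using fdist_less[of p q "fdist p q + e/2"] fdist_less[of q r "fdist q r + e/2"] by auto
  then show "fdist p r \<le> fdist p q + fdist q r + e"
    using finsler_dist_le[OF joined_trans] by fastforce
qed

text \<open>L is the arc length measured from the start. Later arguments see only that its
  increments dominate distances, so no derivatives of curves appear any more.\<close>

lemma fdist_path:
  assumes "fdist p q < r"
  obtains a b :: real and \<gamma> L where "a < b" "continuous_on {a..b} \<gamma>" "\<gamma> a = p" "\<gamma> b = q"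
    "\<And>s t. a \<le> s \<Longrightarrow> s \<le> t \<Longrightarrow> t \<le> b \<Longrightarrow> fdist (\<gamma> s) (\<gamma> t) \<le> L t - L s" "L b - L a < (r::real)"
proof -
  obtain l where "l < r" "joined p q l" using fdist_less[OF assms] by blast
  then obtain a b \<gamma> where \<gamma>: "C1_chain A \<gamma> a b" "\<gamma> a = p" "\<gamma> b = q" "path_len A F a b \<gamma> = l"
    unfolding joined_def by blast
  have ab: "a < b" using C1_chain_less \<gamma>(1) by blast
  define L where "L = (\<lambda>t. path_len A F a t \<gamma>)"
  have L: "L t - L s = path_len A F s t \<gamma>" if "a \<le> s" "s \<le> t" "t \<le> b" for s t
  proof (cases "a < t")
    case True
    have "C1_chain A \<gamma> a t" using C1_chain_subinterval[OF \<gamma>(1)] that True by simp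
    from path_len_append[OF this that(1,2)] show ?thesis unfolding L_def by simp
  next
    case False
    then have "s = a" "t = a" using that by auto
    then show ?thesis by (simp add: L_def path_len_def)
  qed
  show thesis
  proof (rule that[OF ab C1_chain_continuous[OF \<gamma>(1)] \<gamma>(2,3)])
    fix s t assume st: "a \<le> s" "s \<le> t" "t \<le> b"
    show "fdist (\<gamma> s) (\<gamma> t) \<le> L t - L s"
    proof (cases "s = t")
      case False
      then have "joined (\<gamma> s) (\<gamma> t) (L t - L s)"
        using C1_chain_subinterval[OF \<gamma>(1), of s t] st L[OF st] unfolding joined_def by auto
      then show ?thesis by (rule finsler_dist_le)
    qed (simp add: fdist_refl)
  next
    show "L b - L a < r" using L[of a b] ab \<gamma>(4) \<open>l < r\<close> by simp
  qed
qed

text \<open>The closedness assumption keeps a short curve from leaving the chart domain.\<close>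

lemma curve_lower_bound:
  assumes c: "c \<in> A" "x0 \<in> fst c" and k: "0 < k"
    and W: "\<And>y v. y \<in> W \<Longrightarrow> chart_norm c x0 v \<le> k * chart_norm c y v"
    and K: "\<And>\<rho>'. \<rho>' < \<rho> \<Longrightarrow> closed {y \<in> fst c. chart_norm c x0 (snd c y - snd c x0) \<le> \<rho>'}"
      "\<And>\<rho>'. \<rho>' < \<rho> \<Longrightarrow> {y \<in> fst c. chart_norm c x0 (snd c y - snd c x0) \<le> \<rho>'} \<subseteq> W"
    and \<gamma>: "C1_curve_on A {a..b} \<gamma>" "a < b" "\<gamma> a \<in> fst c"
    and small: "chart_norm c x0 (snd c (\<gamma> a) - snd c x0) + k * path_len A F a b \<gamma> < \<rho>"
  shows "\<gamma> b \<in> fst c \<and> chart_norm c x0 (snd c (\<gamma> b) - snd c (\<gamma> a)) \<le> k * path_len A F a b \<gamma>"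
proof -
  define N where "N = chart_norm c x0"
  have N: "N (v + w) \<le> N v + N w" "N (r *\<^sub>R v) = \<bar>r\<bar> * N v" "0 \<le> N v" "N 0 = 0" for v w r
    unfolding N_def using chart_norm_triangle[OF c] chart_norm_scale[OF c] chart_norm_nonneg[OF c]
      chart_norm_zero_iff[OF c] by auto
  obtain K0 where K0: "0 < K0" "\<And>v. N v \<le> K0 * norm v" using P1_equiv[OF c] unfolding N_def by blast
  have Nc: "continuous_on UNIV (\<lambda>v. N (v - p))" for p unfolding N_def by (rule chart_norm_continuous_on[OF c])
  have \<gamma>c: "continuous_on {a..b} \<gamma>" using \<gamma> unfolding C1_curve_on_def by blast
  obtain \<sigma> where \<sigma>: "continuous_on {a..b} \<sigma>" "\<And>t. t \<in> {a..b} \<Longrightarrow> 0 \<le> \<sigma> t"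
    "\<And>t. t \<in> {a<..<b} \<Longrightarrow> speed \<gamma> t = \<sigma> t"
    "\<And>c t D. c \<in> A \<Longrightarrow> t \<in> {a..b} \<Longrightarrow> \<gamma> t \<in> fst c \<Longrightarrow>
      ((snd c \<circ> \<gamma>) has_vector_derivative D) (at t within {a..b}) \<Longrightarrow> \<sigma> t = chart_norm c (\<gamma> t) D"
    using curve_speed[OF \<gamma>(1,2)] by blast
  define L where "L = (\<lambda>t. integral {a..t} \<sigma>)"
  have Lb: "path_len A F a b \<gamma> = L b" unfolding L_def by (rule curve_speed_integral(2)[OF \<sigma>(1,3)])
  have L': "(L has_vector_derivative \<sigma> t) (at t within {a..b})" if "t \<in> {a..b}" for t
    unfolding L_def by (rule integral_has_vector_derivative[OF \<sigma>(1) that])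
  have Lc: "continuous_on {a..b} L"
    unfolding L_def by (intro indefinite_integral_continuous_1 integrable_continuous_real \<sigma>)
  have La: "L a = 0" unfolding L_def by simp
  have Lmono: "L t \<le> L b" if "t \<in> {a..b}" for t
  proof -
    have int: "\<sigma> integrable_on {a..b}" by (intro integrable_continuous_real \<sigma>)
    have "L b = L t + integral {t..b} \<sigma>"
      unfolding L_def using Henstock_Kurzweil_Integration.integral_combine[of a t b \<sigma>] int that by simp
    moreover have "0 \<le> integral {t..b} \<sigma>"
      by (rule Henstock_Kurzweil_Integration.integral_nonneg)
         (use int integrable_on_subinterval[OF int, of t b] \<sigma>(2) that in auto)
    ultimately show ?thesis by simp
  qed
  define n0 where "n0 = N (snd c (\<gamma> a) - snd c x0)"
  \<comment> \<open>Continuous induction along the curve. The slack \<open>\<eta> * (t - a)\<close>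
    absorbs the first-order remainders in the forward step.\<close>
  have main: "\<gamma> b \<in> fst c \<and> N (snd c (\<gamma> b) - snd c (\<gamma> a)) \<le> k * L b + \<eta> * (b - a)"
    if \<eta>: "0 < \<eta>" "n0 + k * L b + \<eta> * (b - a) < \<rho>" for \<eta>
  proof -
    define P where "P = (\<lambda>t. \<gamma> t \<in> fst c \<and> N (snd c (\<gamma> t) - snd c (\<gamma> a)) \<le> k * L t + \<eta> * (t - a))"
    define \<rho>' where "\<rho>' = n0 + k * L b + \<eta> * (b - a)"
    define Z where "Z = {y \<in> fst c. N (snd c y - snd c x0) \<le> \<rho>'}"
    \<comment> \<open>As long as P holds the curve stays in Z. Closedness puts its left limit in the
      chart domain, and \<open>Z \<subseteq> W\<close> allows the speed estimate there.\<close>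
    have Z: "closed Z" "Z \<subseteq> W" unfolding Z_def N_def using K[of \<rho>'] \<eta> \<rho>'_def by auto
    have PZ: "\<gamma> t \<in> Z" if "P t" "t \<in> {a..b}" for t
    proof -
      have "N (snd c (\<gamma> t) - snd c x0) \<le> N (snd c (\<gamma> t) - snd c (\<gamma> a)) + n0"
        using N(1)[of "snd c (\<gamma> t) - snd c (\<gamma> a)" "snd c (\<gamma> a) - snd c x0"] unfolding n0_def by simp
      moreover have "k * L t \<le> k * L b" "\<eta> * (t - a) \<le> \<eta> * (b - a)"
        using Lmono[OF that(2)] k \<eta> that(2) by (auto intro!: mult_left_mono)
      ultimately show ?thesis using that unfolding Z_def P_def \<rho>'_def by auto
    qed
    have "P b"
    proof (rule real_interval_induct[of P a b])
      show "P a" unfolding P_def using \<gamma>(3) N(4) La by simp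
    next
      fix t assume t: "a < t" "t \<le> b" and IH: "\<And>s. a \<le> s \<Longrightarrow> s < t \<Longrightarrow> P s"
      have nb: "at t within {a..<t} \<noteq> bot" using t(1) by (simp add: trivial_limit_within)
      have lim: "(f \<longlongrightarrow> f t) (at t within {a..<t})" if "continuous_on {a..b} f"
        for f :: "real \<Rightarrow> 'z::topological_space"
      proof -
        have "(f \<longlongrightarrow> f t) (at t within {a..b})" using that t unfolding continuous_on_def by auto
        then show ?thesis by (rule tendsto_within_subset) (use t in auto)
      qed
      have ev: "\<forall>\<^sub>F s in at t within {a..<t}. a \<le> s \<and> s < t"
        unfolding eventually_at_topological by auto
      have "\<forall>\<^sub>F s in at t within {a..<t}. \<gamma> s \<in> Z"
        using ev by eventually_elim (use IH PZ t in auto)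
      then have "\<gamma> t \<in> Z" by (rule Lim_in_closed_set[OF Z(1) _ nb lim[OF \<gamma>c]])
      then have fc: "\<gamma> t \<in> fst c" unfolding Z_def by blast
      have "continuous_on (fst c) (\<lambda>y. N (snd c y - snd c (\<gamma> a)))"
        by (rule continuous_on_compose2[OF Nc chart_continuous[OF c(1)]]) auto
      then have "isCont (\<lambda>y. N (snd c y - snd c (\<gamma> a))) (\<gamma> t)"
        using continuous_on_eq_continuous_at[OF chart_open[OF c(1)]] fc by blast
      then have 1: "((\<lambda>s. N (snd c (\<gamma> s) - snd c (\<gamma> a))) \<longlongrightarrow> N (snd c (\<gamma> t) - snd c (\<gamma> a))) (at t within {a..<t})"
        by (rule isCont_tendsto_compose[OF _ lim[OF \<gamma>c]])
      have 2: "((\<lambda>s. k * L s + \<eta> * (s - a)) \<longlongrightarrow> k * L t + \<eta> * (t - a)) (at t within {a..<t})"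
        by (rule lim[of "\<lambda>s. k * L s + \<eta> * (s - a)"]) (intro continuous_intros Lc)
      have "\<forall>\<^sub>F s in at t within {a..<t}. N (snd c (\<gamma> s) - snd c (\<gamma> a)) \<le> k * L s + \<eta> * (s - a)"
        using ev by eventually_elim (use IH P_def in auto)
      then have "N (snd c (\<gamma> t) - snd c (\<gamma> a)) \<le> k * L t + \<eta> * (t - a)" by (rule tendsto_le[OF nb 2 1])
      then show "P t" unfolding P_def using fc by blast
    next
      fix t assume t: "a \<le> t" "t < b" and Pt: "P t"
      then have tab: "t \<in> {a..b}" by simp
      have \<gamma>W: "\<gamma> t \<in> W" "\<gamma> t \<in> fst c" using PZ[OF Pt tab] Z(2) unfolding Z_def by auto
      obtain D where D: "((snd c \<circ> \<gamma>) has_vector_derivative D) (at t within {a..b})"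
        using \<gamma>(1) c(1) \<gamma>W(2) tab unfolding C1_curve_on_def by blast
      have ND: "N D \<le> k * \<sigma> t" using W[OF \<gamma>W(1)] \<sigma>(4)[OF c(1) tab \<gamma>W(2) D] unfolding N_def by simp
      \<comment> \<open>The remainder of the chart curve enters with the factor K0, that of the
        length with the factor k; together they use up exactly \<eta>.\<close>
      define e where "e = \<eta> / (K0 + k)"
      have e: "0 < e" "K0 * e + k * e = \<eta>" 
      proof -
        show "0 < e" unfolding e_def using \<eta> K0 k by simp
        have "(K0 + k) * e = \<eta>" unfolding e_def using K0 k by simp
        then show "K0 * e + k * e = \<eta>" by (simp add: distrib_right)
      qed
      obtain d1 where d1: "d1 > 0" "\<And>s. s \<in> {a..b} \<Longrightarrow> \<bar>s - t\<bar> < d1 \<Longrightarrow>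
          norm (snd c (\<gamma> s) - snd c (\<gamma> t) - (s - t) *\<^sub>R D) \<le> e * \<bar>s - t\<bar>"
        using D e(1) unfolding has_vector_derivative_def has_derivative_within_alt o_def real_norm_def by blast
      obtain d2 where d2: "d2 > 0" "\<And>s. s \<in> {a..b} \<Longrightarrow> \<bar>s - t\<bar> < d2 \<Longrightarrow>
          norm (L s - L t - (s - t) *\<^sub>R \<sigma> t) \<le> e * \<bar>s - t\<bar>"
        using L'[OF tab] e(1) unfolding has_vector_derivative_def has_derivative_within_alt real_norm_def by blast
      have "(\<gamma> \<longlongrightarrow> \<gamma> t) (at t within {a..b})" using \<gamma>c tab unfolding continuous_on_def by blast
      then have "\<forall>\<^sub>F s in at t within {a..b}. \<gamma> s \<in> fst c"
        using \<gamma>W(2) chart_open[OF c(1)] topological_tendstoD by blast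
      then obtain d3 where d3: "d3 > 0" "\<And>s. s \<in> {a..b} \<Longrightarrow> s \<noteq> t \<Longrightarrow> dist s t < d3 \<Longrightarrow> \<gamma> s \<in> fst c"
        unfolding eventually_at by blast
      have "P s" if s: "t < s" "s < t + min d1 (min d2 d3)" "s \<le> b" for s
      proof -
        have sab: "s \<in> {a..b}" "\<bar>s - t\<bar> = s - t" "\<bar>s - t\<bar> < d1" "\<bar>s - t\<bar> < d2" "dist s t < d3"
          using s t by (auto simp: dist_real_def)
        have "N (snd c (\<gamma> s) - snd c (\<gamma> t)) \<le> N (snd c (\<gamma> s) - snd c (\<gamma> t) - (s - t) *\<^sub>R D) + N ((s - t) *\<^sub>R D)"
          using N(1)[of "snd c (\<gamma> s) - snd c (\<gamma> t) - (s - t) *\<^sub>R D" "(s - t) *\<^sub>R D"] by simp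
        also have "N (snd c (\<gamma> s) - snd c (\<gamma> t) - (s - t) *\<^sub>R D) \<le> K0 * (e * (s - t))"
        proof -
          have "K0 * norm (snd c (\<gamma> s) - snd c (\<gamma> t) - (s - t) *\<^sub>R D) \<le> K0 * (e * (s - t))"
            using d1(2)[OF sab(1,3)] K0(1) unfolding sab(2) by (intro mult_left_mono) auto
          then show ?thesis using K0(2) order_trans by blast
        qed
        also have "N ((s - t) *\<^sub>R D) \<le> (s - t) * (k * \<sigma> t)"
          using N(2)[of "s - t" D] ND s(1) sab(2) by (simp add: mult_left_mono)
        also have "(s - t) * (k * \<sigma> t) \<le> k * (L s - L t + e * (s - t))"
        proof -
          have "(s - t) * \<sigma> t \<le> L s - L t + e * (s - t)"
            using d2(2)[OF sab(1,4)] sab(2) by simp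
          then have "k * ((s - t) * \<sigma> t) \<le> k * (L s - L t + e * (s - t))" using k by (intro mult_left_mono) auto
          then show ?thesis by (simp add: mult.left_commute)
        qed
        finally have "N (snd c (\<gamma> s) - snd c (\<gamma> t)) \<le> K0 * (e * (s - t)) + k * (L s - L t + e * (s - t))" by simp
        also have "\<dots> = k * (L s - L t) + (K0 * e + k * e) * (s - t)" by (simp add: algebra_simps)
        finally have 1: "N (snd c (\<gamma> s) - snd c (\<gamma> t)) \<le> k * (L s - L t) + \<eta> * (s - t)" unfolding e(2) .
        have "N (snd c (\<gamma> s) - snd c (\<gamma> a)) \<le> N (snd c (\<gamma> s) - snd c (\<gamma> t)) + N (snd c (\<gamma> t) - snd c (\<gamma> a))"
          using N(1)[of "snd c (\<gamma> s) - snd c (\<gamma> t)" "snd c (\<gamma> t) - snd c (\<gamma> a)"] by simp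
        also have "\<dots> \<le> k * L s + \<eta> * (s - a)"
          using 1 Pt unfolding P_def by (simp add: algebra_simps)
        finally show "P s" unfolding P_def using d3(2)[OF sab(1) _ sab(5)] s(1) by simp
      qed
      then show "\<exists>\<delta>>0. \<forall>s. t < s \<and> s < t + \<delta> \<and> s \<le> b \<longrightarrow> P s"
        using d1(1) d2(1) d3(1) by (intro exI[of _ "min d1 (min d2 d3)"]) auto
    qed (use \<gamma>(2) in auto)
    then show ?thesis unfolding P_def by simp
  qed
  \<comment> \<open>The strict inequality \<open>small\<close> leaves room for a positive total
    slack e, which then tends to 0.\<close>
  define gap where "gap = \<rho> - (n0 + k * L b)"
  have gap: "0 < gap" using small unfolding gap_def n0_def N_def Lb by simp
  have ba: "0 < b - a" using \<gamma>(2) by simp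
  have main': "\<gamma> b \<in> fst c \<and> N (snd c (\<gamma> b) - snd c (\<gamma> a)) \<le> k * L b + e"
    if "0 < e" "e < gap" for e
  proof -
    have "e / (b - a) * (b - a) = e" "0 < e / (b - a)" using ba that by simp_all
    then show ?thesis using main[of "e / (b - a)"] that unfolding gap_def by simp
  qed
  have "\<gamma> b \<in> fst c" using main'[of "gap / 2"] gap by simp
  moreover have "N (snd c (\<gamma> b) - snd c (\<gamma> a)) \<le> k * L b"
  proof (rule field_le_epsilon)
    fix e :: real assume "0 < e"
    then have "N (snd c (\<gamma> b) - snd c (\<gamma> a)) \<le> k * L b + min e (gap / 2)"
      using main'[of "min e (gap / 2)"] gap by linarith
    then show "N (snd c (\<gamma> b) - snd c (\<gamma> a)) \<le> k * L b + e" by linarith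
  qed
  ultimately show ?thesis unfolding N_def Lb by blast
qed

text \<open>The smallness condition passes from piece to piece: by the triangle inequality the
  displacement gained on the first piece is paid for by k times its length.\<close>

lemma chain_lower_bound:
  assumes c: "c \<in> A" "x0 \<in> fst c" and k: "0 < k"
    and W: "\<And>y v. y \<in> W \<Longrightarrow> chart_norm c x0 v \<le> k * chart_norm c y v"
    and K: "\<And>\<rho>'. \<rho>' < \<rho> \<Longrightarrow> closed {y \<in> fst c. chart_norm c x0 (snd c y - snd c x0) \<le> \<rho>'}"
      "\<And>\<rho>'. \<rho>' < \<rho> \<Longrightarrow> {y \<in> fst c. chart_norm c x0 (snd c y - snd c x0) \<le> \<rho>'} \<subseteq> W"
  shows "C1_chain A \<gamma> a b \<Longrightarrow> \<gamma> a \<in> fst c \<Longrightarrow>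
    chart_norm c x0 (snd c (\<gamma> a) - snd c x0) + k * path_len A F a b \<gamma> < \<rho> \<Longrightarrow>
    \<gamma> b \<in> fst c \<and> chart_norm c x0 (snd c (\<gamma> b) - snd c (\<gamma> a)) \<le> k * path_len A F a b \<gamma>"
proof (induction rule: C1_chain.induct)
  case (single a b)
  show ?case by (rule curve_lower_bound[OF c k W K single.hyps(2,1) single.prems])
next
  case (append a b e)
  define N where "N = chart_norm c x0"
  have N: "N (v + w) \<le> N v + N w" for v w unfolding N_def by (rule chart_norm_triangle[OF c])
  have less: "a < b" "b < e" using append.hyps C1_chain_less by blast+
  have len: "path_len A F a e \<gamma> = path_len A F a b \<gamma> + path_len A F b e \<gamma>"
    by (rule path_len_append[OF C1_chain.append[OF append.hyps]]) (use less in auto)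
  have kl: "k * path_len A F a e \<gamma> = k * path_len A F a b \<gamma> + k * path_len A F b e \<gamma>"
    "0 \<le> k * path_len A F b e \<gamma>"
    unfolding len using path_len_nonneg[OF append.hyps(2)] k by (auto simp: distrib_left)
  have 1: "\<gamma> b \<in> fst c" "N (snd c (\<gamma> b) - snd c (\<gamma> a)) \<le> k * path_len A F a b \<gamma>"
    using append.IH(1) append.prems kl unfolding N_def by auto
  have "N (snd c (\<gamma> b) - snd c x0) \<le> N (snd c (\<gamma> b) - snd c (\<gamma> a)) + N (snd c (\<gamma> a) - snd c x0)"
    using N[of "snd c (\<gamma> b) - snd c (\<gamma> a)" "snd c (\<gamma> a) - snd c x0"] by simp
  then have "N (snd c (\<gamma> b) - snd c x0) + k * path_len A F b e \<gamma> < \<rho>"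
    using 1(2) append.prems(2) kl(1) unfolding N_def by linarith
  then have 2: "\<gamma> e \<in> fst c" "N (snd c (\<gamma> e) - snd c (\<gamma> b)) \<le> k * path_len A F b e \<gamma>"
    using append.IH(2) 1(1) unfolding N_def by auto
  have "N (snd c (\<gamma> e) - snd c (\<gamma> a)) \<le> N (snd c (\<gamma> e) - snd c (\<gamma> b)) + N (snd c (\<gamma> b) - snd c (\<gamma> a))"
    using N[of "snd c (\<gamma> e) - snd c (\<gamma> b)" "snd c (\<gamma> b) - snd c (\<gamma> a)"] by simp
  then show ?case using 1 2 kl(1) unfolding N_def by linarith
qed

text \<open>The upper bound for the distance is the straight segment; the lower bound is that every
  short path, wherever it might go, is at least as long as its displacement in the chart divided by
  k. In particular a small metric ball lies in the chart and in any given neighbourhood U.\<close>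

lemma fdist_chart:
  assumes c: "c \<in> A" "x0 \<in> fst c" and k: "1 < k" and U: "open U" "x0 \<in> U"
  obtains \<delta> where "0 < \<delta>" "\<And>y. fdist x0 y < \<delta> \<Longrightarrow> y \<in> fst c \<and> y \<in> U \<and>
    chart_norm c x0 (snd c y - snd c x0) \<le> k * fdist x0 y \<and>
    fdist x0 y \<le> k * chart_norm c x0 (snd c y - snd c x0)"
proof -
  define N where "N = chart_norm c x0"
  obtain W where W: "open W" "x0 \<in> W" "W \<subseteq> fst c"
    and WP: "\<And>y v. y \<in> W \<Longrightarrow> 1 / k * N v \<le> chart_norm c y v"
    using P2[OF c, of "k - 1"] k unfolding N_def by auto
  have WN: "N v \<le> k * chart_norm c y v" if "y \<in> W" for y v
    using WP[OF that, of v] k by (simp add: field_simps)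
  obtain r where r: "0 < r" "cball (snd c x0) r \<subseteq> snd c ` (fst c \<inter> (U \<inter> W))"
    "\<And>S. closed S \<Longrightarrow> S \<subseteq> cball (snd c x0) r \<Longrightarrow> closed {y \<in> fst c. snd c y \<in> S}"
    using chart_closed_sets[OF c, of "U \<inter> W"] U W by blast
  obtain k0 where k0: "k0 > 0" "\<And>v. k0 * norm v \<le> N v" using P1_equiv[OF c] unfolding N_def by blast
  obtain \<rho>1 where \<rho>1: "0 < \<rho>1" "\<And>y. y \<in> fst c \<Longrightarrow> norm (snd c y - snd c x0) < \<rho>1 \<Longrightarrow>
    \<exists>l. joined x0 y l \<and> l \<le> k * N (snd c y - snd c x0)"
    using joined_near[OF c k] unfolding N_def by blast
  \<comment> \<open>The constant k0 of P1 turns \<open>N v < \<rho>\<close> into smallness of the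
    model norm, as both radii require.\<close>
  define \<rho> where "\<rho> = k0 * min r \<rho>1"
  have \<rho>: "0 < \<rho>" unfolding \<rho>_def using k0 r \<rho>1 by simp
  have small: "norm v < min r \<rho>1" if "N v < \<rho>" for v
  proof -
    have "k0 * norm v < k0 * min r \<rho>1" using k0(2)[of v] that unfolding \<rho>_def by linarith
    then show ?thesis using k0(1) by simp
  qed
  have inUW: "y \<in> U \<inter> W" if "y \<in> fst c" "N (snd c y - snd c x0) < \<rho>" for y
  proof -
    have "snd c y \<in> cball (snd c x0) r"
      using small[OF that(2)] by (simp add: dist_norm norm_minus_commute)
    then obtain z where "z \<in> fst c" "z \<in> U \<inter> W" "snd c y = snd c z" using r(2) by blast
    then show ?thesis using that(1) c(1) chart_inv_chart by metis
  qed
  have K1: "closed {y \<in> fst c. N (snd c y - snd c x0) \<le> \<rho>'}" if "\<rho>' < \<rho>" for \<rho>'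
  proof -
    have "closed {p. N (p - snd c x0) \<le> \<rho>'}"
      unfolding N_def by (intro closed_Collect_le chart_norm_continuous_on[OF c] continuous_on_const)
    moreover have "{p. N (p - snd c x0) \<le> \<rho>'} \<subseteq> cball (snd c x0) r"
    proof
      fix p assume "p \<in> {p. N (p - snd c x0) \<le> \<rho>'}"
      then have "N (p - snd c x0) < \<rho>" using that by simp
      from small[OF this] show "p \<in> cball (snd c x0) r" by (simp add: dist_norm norm_minus_commute)
    qed
    ultimately have "closed {y \<in> fst c. snd c y \<in> {p. N (p - snd c x0) \<le> \<rho>'}}" by (rule r(3))
    then show ?thesis by simp
  qed
  have K2: "{y \<in> fst c. N (snd c y - snd c x0) \<le> \<rho>'} \<subseteq> W" if "\<rho>' < \<rho>" for \<rho>'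
    using inUW that order.strict_trans1 by blast
  have k': "0 < k" using k by simp
  \<comment> \<open>A path from \<open>x0\<close> starts with displacement 0, so
    \<open>k * l < \<rho>\<close> is precisely the smallness condition of
    \<open>chain_lower_bound\<close>.\<close>
  have lower: "y \<in> fst c \<and> N (snd c y - snd c x0) \<le> k * l" if l: "joined x0 y l" "l < \<rho> / k" for y l
  proof -
    obtain a b \<gamma> where \<gamma>: "C1_chain A \<gamma> a b" "\<gamma> a = x0" "\<gamma> b = y" "path_len A F a b \<gamma> = l"
      using l(1) unfolding joined_def by blast
    have "N (snd c (\<gamma> a) - snd c x0) + k * path_len A F a b \<gamma> < \<rho>"
      using \<gamma> l(2) k' chart_norm_zero_iff[OF c, of 0] unfolding N_def by (simp add: field_simps)
    from chain_lower_bound[OF c k' WN[unfolded N_def] K1[unfolded N_def] K2[unfolded N_def]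
        \<gamma>(1) _ this[unfolded N_def]]
    show ?thesis unfolding N_def using \<gamma> c(2) by simp
  qed
  show thesis
  proof (rule that[of "\<rho> / k"])
    show "0 < \<rho> / k" using \<rho> k' by simp
    fix y assume y: "fdist x0 y < \<rho> / k"
    obtain l where "joined x0 y l" "l < \<rho> / k" using fdist_less[OF y] by blast
    then have yc: "y \<in> fst c" using lower by blast
    have Nle: "N (snd c y - snd c x0) \<le> k * fdist x0 y"
    proof (rule field_le_epsilon)
      fix e :: real assume "0 < e"
      then obtain l where l: "joined x0 y l" "l < min (\<rho> / k) (fdist x0 y + e / k)"
        using fdist_less[of x0 y "min (\<rho> / k) (fdist x0 y + e / k)"] y k' by auto
      then have "N (snd c y - snd c x0) \<le> k * l" using lower by simp
      also have "\<dots> \<le> k * (fdist x0 y + e / k)" using l k' by (intro mult_left_mono) auto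
      finally show "N (snd c y - snd c x0) \<le> k * fdist x0 y + e" using k' by (simp add: distrib_left)
    qed
    then have lt: "N (snd c y - snd c x0) < \<rho>" using y k' by (simp add: field_simps)
    obtain l where "joined x0 y l" "l \<le> k * N (snd c y - snd c x0)" using \<rho>1(2)[OF yc] small[OF lt] by auto
    then have "fdist x0 y \<le> k * N (snd c y - snd c x0)" using finsler_dist_le order_trans by blast
    then show "y \<in> fst c \<and> y \<in> U \<and> chart_norm c x0 (snd c y - snd c x0) \<le> k * fdist x0 y \<and>
        fdist x0 y \<le> k * chart_norm c x0 (snd c y - snd c x0)"
      using yc inUW[OF yc lt] Nle unfolding N_def by blast
  qed
qed

lemma fdist_le_chart_norm:
  assumes c: "c \<in> A" "x0 \<in> fst c" and k: "1 < k"
  obtains \<rho> where "0 < \<rho>" "\<And>y. y \<in> fst c \<Longrightarrow> norm (snd c y - snd c x0) < \<rho> \<Longrightarrow>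
    fdist x0 y \<le> k * chart_norm c x0 (snd c y - snd c x0)"
proof -
  obtain \<rho> where \<rho>: "0 < \<rho>" "\<And>y. y \<in> fst c \<Longrightarrow> norm (snd c y - snd c x0) < \<rho> \<Longrightarrow>
    \<exists>l. joined x0 y l \<and> l \<le> k * chart_norm c x0 (snd c y - snd c x0)"
    by (rule joined_near[OF c k]) (rule that)
  have "fdist x0 y \<le> k * chart_norm c x0 (snd c y - snd c x0)"
    if "y \<in> fst c" "norm (snd c y - snd c x0) < \<rho>" for y
    using \<rho>(2)[OF that] finsler_dist_le order_trans by blast
  with \<rho>(1) show thesis by (rule that)
qed

text \<open>Together with \<open>fdist_nbhd\<close> this says that the Finsler distance induces the
  topology of M.\<close>

lemma fdist_open_ball:
  assumes "open U" "x \<in> U" obtains \<delta> where "0 < \<delta>" "\<And>y. fdist x y < \<delta> \<Longrightarrow> y \<in> U"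
proof -
  obtain c where c: "c \<in> A" "x \<in> fst c" by (rule obtain_chart)
  show thesis using fdist_chart[OF c _ assms, of 2] that by (metis one_less_numeral_iff semiring_norm(76))
qed

lemma fdist_nbhd:
  assumes "0 < r" obtains T where "open T" "x \<in> T" "\<And>y. y \<in> T \<Longrightarrow> fdist x y < r"
proof -
  obtain c where c: "c \<in> A" "x \<in> fst c" by (rule obtain_chart)
  have "(1::real) < 2" by simp
  then obtain \<rho> where \<rho>: "0 < \<rho>" "\<And>y. y \<in> fst c \<Longrightarrow> norm (snd c y - snd c x) < \<rho> \<Longrightarrow>
    fdist x y \<le> 2 * chart_norm c x (snd c y - snd c x)" by (rule fdist_le_chart_norm[OF c]) (rule that)
  obtain K where K: "0 < K" "\<And>v. chart_norm c x v \<le> K * norm v" using P1_equiv[OF c] by blast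
  define s where "s = min \<rho> (r / (2 * K))"
  have s: "0 < s" unfolding s_def using \<rho> K assms by simp
  show thesis
  proof (rule that)
    show "open {y \<in> fst c. snd c y \<in> ball (snd c x) s}" by (rule open_chart_preimage[OF c(1) open_ball])
    show "x \<in> {y \<in> fst c. snd c y \<in> ball (snd c x) s}" using c s by simp
    fix y assume "y \<in> {y \<in> fst c. snd c y \<in> ball (snd c x) s}"
    then have y: "y \<in> fst c" "norm (snd c y - snd c x) < s" by (auto simp: dist_norm norm_minus_commute)
    have "fdist x y \<le> 2 * (K * norm (snd c y - snd c x))"
      using \<rho>(2)[OF y(1)] y(2) K(2)[of "snd c y - snd c x"] unfolding s_def by linarith
    also have "\<dots> < 2 * (K * (r / (2 * K)))"
      using y(2) K(1) unfolding s_def by (intro mult_strict_left_mono) auto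
    also have "\<dots> = r" using K(1) by simp
    finally show "fdist x y < r" .
  qed
qed

text \<open>Only definiteness needs the charts: a point at distance 0 lies in the same chart with
  the same coordinates, by the lower bound in \<open>fdist_chart\<close>.\<close>

lemma Metric_space_fdist: "Metric_space UNIV fdist"
proof
  fix x y
  show "(fdist x y = 0) = (x = y)"
  proof
    assume 0: "fdist x y = 0"
    obtain c where c: "c \<in> A" "x \<in> fst c" by (rule obtain_chart)
    have "(1::real) < 2" by simp
    then obtain \<delta> where \<delta>: "0 < \<delta>" "\<And>y. fdist x y < \<delta> \<Longrightarrow> y \<in> fst c \<and> y \<in> UNIV \<and>
      chart_norm c x (snd c y - snd c x) \<le> 2 * fdist x y \<and>
      fdist x y \<le> 2 * chart_norm c x (snd c y - snd c x)"
      by (rule fdist_chart[OF c _ open_UNIV UNIV_I]) (rule that)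
    then have "y \<in> fst c" "chart_norm c x (snd c y - snd c x) \<le> 0" using \<delta>(2)[of y] \<delta>(1) 0 by auto
    then have "snd c y = snd c x"
      using chart_norm_nonneg[OF c] chart_norm_zero_iff[OF c] by (metis order_antisym eq_iff_diff_eq_0)
    then show "x = y" using chart_inv_chart c \<open>y \<in> fst c\<close> by metis
  qed (simp add: fdist_refl)
qed (auto simp: fdist_nonneg fdist_commute intro: fdist_triangle)

lemma fdist_tendsto:
  assumes "\<And>e. 0 < e \<Longrightarrow> \<forall>\<^sub>F n in G. fdist (\<sigma> n) x < e" shows "(\<sigma> \<longlongrightarrow> x) G"
proof (rule topological_tendstoI)
  fix S :: "'m set" assume "open S" "x \<in> S"
  then obtain \<delta> where \<delta>: "0 < \<delta>" "\<And>y. fdist x y < \<delta> \<Longrightarrow> y \<in> S" by (rule fdist_open_ball) (rule that)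
  show "\<forall>\<^sub>F n in G. \<sigma> n \<in> S" using assms[OF \<delta>(1)] by eventually_elim (use \<delta>(2) fdist_commute in metis)
qed

lemma continuous_fdist:
  assumes "continuous_on S \<gamma>" shows "continuous_on S (\<lambda>t. fdist (\<gamma> t) q)"
  unfolding continuous_on_def
proof
  fix t assume t: "t \<in> S"
  show "((\<lambda>t. fdist (\<gamma> t) q) \<longlongrightarrow> fdist (\<gamma> t) q) (at t within S)"
  proof (rule tendstoI)
    fix e :: real assume "0 < e"
    then obtain T where T: "open T" "\<gamma> t \<in> T" "\<And>y. y \<in> T \<Longrightarrow> fdist (\<gamma> t) y < e" using fdist_nbhd by blast
    have "(\<gamma> \<longlongrightarrow> \<gamma> t) (at t within S)" using assms t unfolding continuous_on_def by blast
    then have "\<forall>\<^sub>F s in at t within S. \<gamma> s \<in> T" using T topological_tendstoD by blast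
    then show "\<forall>\<^sub>F s in at t within S. dist (fdist (\<gamma> s) q) (fdist (\<gamma> t) q) < e"
    proof eventually_elim
      case (elim s)
      then show ?case
        using T(3)[of "\<gamma> s"] fdist_triangle[of "\<gamma> s" q "\<gamma> t"] fdist_triangle[of "\<gamma> t" q "\<gamma> s"]
          fdist_commute[of "\<gamma> s" "\<gamma> t"] by (simp add: dist_real_def abs_less_iff)
    qed
  qed
qed

text \<open>Completeness refers to the distance, closedness of E and continuity of w to the
  topology; \<open>fdist_tendsto\<close> carries the limit of the Cauchy sequence from one to the
  other.\<close>

lemma ekeland:
  assumes compl: "Metric_space.mcomplete UNIV fdist" and E: "closed E" "x \<in> E"
    and w: "continuous_on E w" "\<And>z. z \<in> E \<Longrightarrow> m \<le> (w z :: real)" and lam: "0 < k"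
  obtains y where "y \<in> E" "w y + k * fdist x y \<le> w x" "\<And>z. z \<in> E \<Longrightarrow> w y \<le> w z + k * fdist y z"
proof -
  interpret M: Metric_space UNIV fdist by (rule Metric_space_fdist)
  \<comment> \<open>The points below y in Ekeland's order, which is transitive by the triangle
    inequality. Y descends in it, each time to an almost minimizer of w over the current
    set.\<close>
  define S where "S = (\<lambda>y. {z \<in> E. w z + k * fdist y z \<le> w y})"
  define Y where "Y = rec_nat x (\<lambda>n y. SOME z. z \<in> S y \<and> w z < Inf (w ` S y) + (1/2)^n)"
  have self: "y \<in> S y" if "y \<in> E" for y unfolding S_def using that fdist_refl by simp
  have S_trans: "S z \<subseteq> S y" if "z \<in> S y" for y z
  proof
    fix u assume u: "u \<in> S z"
    have "k * fdist y u \<le> k * (fdist y z + fdist z u)"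
      using lam fdist_triangle by (intro mult_left_mono) auto
    then show "u \<in> S y" using u that unfolding S_def by (simp add: distrib_left)
  qed
  have bdd: "bdd_below (w ` S y)" for y
    by (rule bdd_belowI2[of _ m]) (use w(2) in \<open>auto simp: S_def\<close>)
  have pick: "\<exists>z. z \<in> S y \<and> w z < Inf (w ` S y) + (1/2)^n" if "y \<in> E" for y and n :: nat
    using cInf_lessD[of "w ` S y" "Inf (w ` S y) + (1/2)^n"] self[OF that] by auto
  have Y0: "Y 0 = x" unfolding Y_def by simp
  have YS: "Y (Suc n) = (SOME z. z \<in> S (Y n) \<and> w z < Inf (w ` S (Y n)) + (1/2)^n)" for n
    unfolding Y_def by simp
  have YE: "Y n \<in> E" for n
  proof (induction n)
    case (Suc n)
    have "Y (Suc n) \<in> S (Y n)" using someI_ex[OF pick[OF Suc, of n]] unfolding YS[symmetric] by blast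
    then show ?case unfolding S_def by blast
  qed (use E Y0 in simp)
  have Y: "Y (Suc n) \<in> S (Y n)" "w (Y (Suc n)) < Inf (w ` S (Y n)) + (1/2)^n" for n
    using someI_ex[OF pick[OF YE, of n n]] unfolding YS[symmetric] by blast+
  have Ymono: "S (Y j) \<subseteq> S (Y i)" if "i \<le> j" for i j
    using lift_Suc_antimono_le[of "\<lambda>n. S (Y n)", OF _ that] S_trans Y(1) by blast
  have Yin: "Y j \<in> S (Y i)" if "i \<le> j" for i j using Ymono[OF that] self[OF YE] by blast
  have almost: "w (Y (Suc n)) < w z + (1/2)^n" if "z \<in> S (Y n)" for n z
    using Y(2)[of n] cInf_lower[OF imageI[OF that] bdd] by linarith
  \<comment> \<open>The order bounds k times the distance by the drop of w; as \<open>Y j\<close>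
    still lies in \<open>S (Y n)\<close>, over which \<open>Y (Suc n)\<close> is almost minimal,
    this drop is small.\<close>
  have tail: "k * fdist (Y (Suc n)) (Y j) < (1/2)^n" if "Suc n \<le> j" for n j
  proof -
    have "k * fdist (Y (Suc n)) (Y j) \<le> w (Y (Suc n)) - w (Y j)"
      using Yin[OF that] unfolding S_def by simp
    also have "\<dots> < (1/2)^n" using almost[OF Yin[of n j]] that by simp
    finally show ?thesis .
  qed
  have "M.MCauchy Y"
    unfolding M.MCauchy_def
  proof (intro conjI allI impI)
    fix e :: real assume "0 < e"
    then obtain n where n: "(1/2::real)^n < k * e / 2" using real_arch_pow_inv[of "k * e / 2" "1/2"] lam by auto
    have "fdist (Y i) (Y j) < e" if "Suc n \<le> i" "Suc n \<le> j" for i j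
    proof -
      have "fdist (Y i) (Y j) \<le> fdist (Y (Suc n)) (Y i) + fdist (Y (Suc n)) (Y j)"
        using fdist_triangle[of "Y i" "Y j" "Y (Suc n)"] fdist_commute by metis
      then have "k * fdist (Y i) (Y j) \<le> k * fdist (Y (Suc n)) (Y i) + k * fdist (Y (Suc n)) (Y j)"
        using lam mult_left_mono[of _ _ k] by (simp add: distrib_left[symmetric])
      also have "\<dots> < k * e" using tail[OF that(1)] tail[OF that(2)] n by linarith
      finally show ?thesis using lam by simp
    qed
    then show "\<exists>N. \<forall>n n'. N \<le> n \<longrightarrow> N \<le> n' \<longrightarrow> fdist (Y n) (Y n') < e" by blast
  qed simp
  then obtain y where "limitin M.mtopology Y y sequentially" using compl unfolding M.mcomplete_def by blast
  then have lim: "\<forall>\<^sub>F n in sequentially. fdist (Y n) y < e" if "0 < e" for e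
    using that unfolding M.limit_metric_sequentially eventually_sequentially by blast
  have Yy: "Y \<longlonglongrightarrow> y" by (rule fdist_tendsto[OF lim])
  have yE: "y \<in> E" using closed_sequentially[OF E(1) YE Yy] .
  have wY: "(\<lambda>n. w (Y n)) \<longlonglongrightarrow> w y"
    by (rule continuous_on_tendsto_compose[OF w(1) Yy yE]) (use YE in simp)
  have dY: "(\<lambda>n. fdist (Y n) q) \<longlonglongrightarrow> fdist y q" for q
    using isCont_tendsto_compose[OF _ Yy, of "\<lambda>p. fdist p q"]
      continuous_fdist[OF continuous_on_id[of UNIV], of q] by (simp add: continuous_on_eq_continuous_at)
  have yS: "y \<in> S (Y i)" for i
  proof -
    have "w y + k * fdist y (Y i) \<le> w (Y i)"
    proof (rule tendsto_upperbound)
      show "(\<lambda>j. w (Y j) + k * fdist (Y j) (Y i)) \<longlonglongrightarrow> w y + k * fdist y (Y i)"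
        by (intro tendsto_intros wY dY)
      show "\<forall>\<^sub>F j in sequentially. w (Y j) + k * fdist (Y j) (Y i) \<le> w (Y i)"
        using eventually_ge_at_top[of i]
      proof eventually_elim
        case (elim j)
        then show ?case using Yin[OF elim] fdist_commute[of "Y i" "Y j"] unfolding S_def by simp
      qed
    qed simp
    then show ?thesis unfolding S_def using yE by (simp add: fdist_commute)
  qed
  show thesis
  proof (rule that[OF yE])
    show "w y + k * fdist x y \<le> w x" using yS[of 0] Y0 unfolding S_def by simp
    fix z assume z: "z \<in> E"
    show "w y \<le> w z + k * fdist y z"
    proof (rule ccontr)
      assume neg: "\<not> ?thesis"
      \<comment> \<open>A violating z is below y, hence in every \<open>S (Y n)\<close>. Almost
        minimality then yields \<open>w y \<le> w z\<close> in the limit, which contradicts the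
        violation.\<close>
      then have "z \<in> S y" unfolding S_def using z by simp
      then have "z \<in> S (Y n)" for n using S_trans[OF yS] by blast
      then have le: "w (Y (Suc n)) \<le> w z + (1/2)^n" for n using almost less_imp_le by blast
      have half: "(\<lambda>n. (1/2::real)^n) \<longlonglongrightarrow> 0" by (rule LIMSEQ_realpow_zero) auto
      have "w y \<le> w z"
      proof (rule LIMSEQ_le)
        show "(\<lambda>n. w (Y (Suc n))) \<longlonglongrightarrow> w y" using wY by (rule LIMSEQ_Suc)
        show "(\<lambda>n. w z + (1/2)^n) \<longlonglongrightarrow> w z" using tendsto_add[OF tendsto_const half, of "w z"] by simp
      qed (use le in blast)
      moreover have "0 \<le> k * fdist y z" using lam fdist_nonneg by simp
      ultimately show False using neg by simp
    qed
  qed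
qed

end

section \<open>Local consequences of the viscosity inequalities\<close>

context C1_Finsler_manifold begin

text \<open>Over the zero space every chart domain is a single point, so M is discrete and no set
  has a boundary. This supplies the unit vectors over which \<open>dual_norm\<close> takes its
  supremum.\<close>

lemma model_space_nontrivial:
  assumes "frontier (\<Omega> :: 'm set) \<noteq> {}" shows "\<exists>v::'x. v \<noteq> 0"
proof (rule ccontr)
  assume "\<not> ?thesis"
  then have zero: "v = 0" for v :: 'x by blast
  have pt: "open {x}" for x :: 'm
  proof -
    obtain c where c: "c \<in> A" "x \<in> fst c" by (rule obtain_chart)
    have "y = x" if "y \<in> fst c" for y
      using chart_inv_chart[OF c(1) that] chart_inv_chart[OF c] zero[of "snd c y"] zero[of "snd c x"] by simp
    then have "fst c = {x}" using c(2) by blast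
    then show ?thesis using chart_open[OF c(1)] by simp
  qed
  have op: "open S" for S :: "'m set" using open_UN[of S "\<lambda>x. {x}"] pt by simp
  then have "closed \<Omega>" "interior \<Omega> = \<Omega>" using interior_open[OF op] unfolding closed_def by auto
  then show False using assms unfolding frontier_def by (simp add: closure_closed)
qed

text \<open>Local extrema depend only on the germ of the test function, so a C1 function on the
  model space may be used through its extension Q or G to M, with the same derivative in the
  chart.\<close>

lemma test_function:
  fixes \<beta> :: "'x \<Rightarrow> real"
  assumes cut: "smooth_cutoff \<beta> \<beta>' B \<delta>" and c: "c \<in> A" "x \<in> fst c"
    and g: "C1_on UNIV g" "(g has_derivative D) (at (snd c x))" and T: "open T" "x \<in> T"
  obtains G where "C1_fun A G" "(G \<circ> chart_inv c has_derivative D) (at (snd c x))"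
    "(\<forall>y \<in> fst c \<inter> T \<inter> closure \<Omega>. w x - g (snd c x) \<le> w y - g (snd c y)) \<longrightarrow>
      differential A G x \<in> subdifferential A \<Omega> w x"
    "(\<forall>y \<in> fst c \<inter> T \<inter> closure \<Omega>. w y - g (snd c y) \<le> w x - g (snd c x)) \<longrightarrow>
      differential A G x \<in> superdifferential A \<Omega> w x"
proof -
  obtain G N where G: "C1_fun A G" "open N" "x \<in> N" "N \<subseteq> fst c" "\<And>y. y \<in> N \<Longrightarrow> G y = g (snd c y)"
    using C1_extension[OF cut c g(1)] by blast
  have "open (snd c ` (fst c \<inter> N))" by (rule open_chart_image[OF c(1) G(2)])
  then have 1: "(G \<circ> chart_inv c has_derivative D) (at (snd c x))"
    by (rule has_derivative_transform_within_open[OF g(2)]) (use G c in auto)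
  show thesis
  proof (rule that[OF G(1) 1]; rule impI)
    assume *: "\<forall>y \<in> fst c \<inter> T \<inter> closure \<Omega>. w x - g (snd c x) \<le> w y - g (snd c y)"
    have "local_min_on (closure \<Omega>) (\<lambda>y. w y - G y) x"
      unfolding local_min_on_def
    proof (intro exI[of _ "N \<inter> T"] conjI ballI)
      fix y assume "y \<in> N \<inter> T \<inter> closure \<Omega>"
      then show "w x - G x \<le> w y - G y" using *[rule_format, of y] G(3-5) by auto
    qed (use G T in auto)
    then show "differential A G x \<in> subdifferential A \<Omega> w x" using G(1) unfolding subdifferential_def by blast
  next
    assume *: "\<forall>y \<in> fst c \<inter> T \<inter> closure \<Omega>. w y - g (snd c y) \<le> w x - g (snd c x)"
    have "local_max_on (closure \<Omega>) (\<lambda>y. w y - G y) x"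
      unfolding local_max_on_def
    proof (intro exI[of _ "N \<inter> T"] conjI ballI)
      fix y assume "y \<in> N \<inter> T \<inter> closure \<Omega>"
      then show "w y - G y \<le> w x - G x" using *[rule_format, of y] G(3-5) by auto
    qed (use G T in auto)
    then show "differential A G x \<in> superdifferential A \<Omega> w x" using G(1) unfolding superdifferential_def by blast
  qed
qed

lemma chart_ball_in:
  assumes "c \<in> A" "x \<in> fst c" "open T" "x \<in> T"
  obtains r where "0 < r" "cball (snd c x) r \<subseteq> snd c ` (fst c \<inter> T)"
proof -
  have "open (snd c ` (fst c \<inter> T))" "snd c x \<in> snd c ` (fst c \<inter> T)"
    using assms open_chart_image by auto
  then show thesis using that open_contains_cball by metis
qed

lemma continuous_in_chart:
  fixes w :: "'m \<Rightarrow> real"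
  assumes "continuous_on S w" "c \<in> A" "T \<subseteq> snd c ` (fst c \<inter> S)"
  shows "continuous_on T (\<lambda>p. w (chart_inv c p))"
proof (rule continuous_on_compose2[OF assms(1)])
  show "continuous_on T (chart_inv c)"
    by (rule continuous_on_subset[OF chart_inv_continuous[OF assms(2)]]) (use assms(3) in blast)
  show "chart_inv c ` T \<subseteq> S" using assms(2,3) by auto
qed

text \<open>The convex penalty \<open>G\<close> has slope at least \<open>\<kappa>\<^sup>2\<close> away from \<open>x0\<close> and confines the minimizer
  to a small ball; the fuzzy sum rule then turns a jump of \<open>w\<close> into a steep superdifferential.\<close>

lemma superdifferential_imp_slope:
  fixes \<beta> :: "'x \<Rightarrow> real"
  assumes cut: "smooth_cutoff \<beta> \<beta>' B \<delta>" and \<Omega>: "open \<Omega>" "x0 \<in> \<Omega>"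
    and w: "continuous_on (closure \<Omega>) w"
    and super: "\<And>x \<Delta>. x \<in> \<Omega> \<Longrightarrow> \<Delta> \<in> superdifferential A \<Omega> w x \<Longrightarrow> dual_norm A F x \<Delta> \<le> 1"
    and k: "1 < k"
  shows "\<exists>\<delta>>0. \<forall>y. fdist x0 y < \<delta> \<longrightarrow> w y \<le> w x0 + k * fdist x0 y"
proof -
  \<comment> \<open>The factor k is spent in three equal shares: on comparing norms at nearby points
    (P2), on the margin between the slopes \<kappa> and \<open>\<kappa> * \<kappa>\<close>, and on
    passing from the chart norm to the distance.\<close>
  define \<kappa> where "\<kappa> = root 3 k"
  have \<kappa>: "1 < \<kappa>" "\<kappa> * \<kappa> * \<kappa> = k"
    using k real_root_pow_pos2[of 3 k] unfolding \<kappa>_def by (auto simp: power3_eq_cube)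
  obtain c where c: "c \<in> A" "x0 \<in> fst c" by (rule obtain_chart)
  define N where "N = chart_norm c x0"
  define y0 where "y0 = snd c x0"
  have N: "N (r *\<^sub>R v) = \<bar>r\<bar> * N v" "0 \<le> N v" for v r
    unfolding N_def using chart_norm_scale[OF c] chart_norm_nonneg[OF c] by auto
  obtain k0 where k0: "0 < k0" "\<And>v. k0 * norm v \<le> N v" using P1_equiv[OF c] unfolding N_def by blast
  obtain W where W: "open W" "x0 \<in> W" "W \<subseteq> fst c"
    and WP: "\<And>y v. y \<in> W \<Longrightarrow> chart_norm c y v \<le> \<kappa> * N v"
    using P2[OF c, of "\<kappa> - 1"] \<kappa> unfolding N_def by auto
  obtain r1 where r1: "0 < r1" "cball y0 r1 \<subseteq> snd c ` (fst c \<inter> (\<Omega> \<inter> W))"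
    using chart_ball_in[OF c, of "\<Omega> \<inter> W"] \<Omega> W unfolding y0_def by blast
  \<comment> \<open>The sign turns touching from above into touching from below, the situation of
    the fuzzy sum rule.\<close>
  define f where "f = (\<lambda>p. - w (chart_inv c p))"
  have fc: "continuous_on (cball y0 r1) f"
    unfolding f_def
    by (intro continuous_intros continuous_in_chart[OF w c(1)]) (use r1(2) closure_subset[of \<Omega>] in blast)
  have fy: "f (snd c y) = - w y" if "y \<in> fst c" for y unfolding f_def using c(1) that by simp
  have "\<forall>e>0. \<exists>d>0. \<forall>p\<in>cball y0 r1. dist p y0 < d \<longrightarrow> dist (f p) (f y0) < e"
    using fc r1(1) unfolding continuous_on_iff by simp
  then have near: "\<exists>d>0. \<forall>p\<in>cball y0 r1. dist p y0 < d \<longrightarrow> f y0 - e < f p" if "0 < e" for e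
    using that by (fastforce simp: dist_real_def abs_less_iff)
  obtain d1 where d1: "0 < d1" "\<And>p. p \<in> cball y0 r1 \<Longrightarrow> dist p y0 < d1 \<Longrightarrow> f y0 - 1 < f p"
    using near[of 1] by auto
  define R where "R = min r1 (d1 / 2)"
  have R: "0 < R" "R \<le> r1" "R < d1" unfolding R_def using r1 d1 by auto
  have fR: "f y0 - 1 \<le> f p" if "p \<in> cball y0 R" for p
    using d1(2)[of p] that R by (force simp: dist_commute)
  have key: "f y0 \<le> f x1 + \<kappa> * \<kappa> * N (x1 - y0)" if x1: "dist y0 x1 < R / 2" for x1
  proof (rule ccontr)
    assume neg: "\<not> ?thesis"
    \<comment> \<open>The second term vanishes at x1 and is at least
      \<open>8 / R * (R / 4) = 2\<close> on the shell, more than the drop of at most 1 allowed to f.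
      Both terms are convex and vanish at y0.\<close>
    define G where "G = (\<lambda>s. \<kappa> * \<kappa> * N (s - y0) + 8 / R * max 0 (norm (s - y0) - R / 2))"
    have Gx1: "G x1 = \<kappa> * \<kappa> * N (x1 - y0)" unfolding G_def using x1 by (simp add: dist_norm norm_minus_commute)
    define gap where "gap = f y0 - (f x1 + G x1)"
    have gap: "0 < gap" using neg Gx1 unfolding gap_def by simp
    have G0: "0 \<le> G s" for s unfolding G_def using N(2) \<kappa> R by auto
    have GN: "\<kappa> * \<kappa> * N (s - y0) \<le> G s" for s unfolding G_def using R by simp
    obtain K where K: "K-lipschitz_on UNIV (\<lambda>s. N (s - y0))"
      using chart_norm_lipschitz[OF c] unfolding N_def by blast
    have "1-lipschitz_on UNIV (\<lambda>s::'x. max 0 (norm (s - y0) - R / 2))"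
    proof (rule lipschitz_onI)
      fix s t :: 'x
      have "\<bar>norm (s - y0) - norm (t - y0)\<bar> \<le> norm (s - t)"
        using norm_triangle_ineq3[of "s - y0" "t - y0"] by simp
      then show "dist (max 0 (norm (s - y0) - R / 2)) (max 0 (norm (t - y0) - R / 2)) \<le> 1 * dist s t"
        by (auto simp: dist_real_def dist_norm max_def abs_le_iff)
    qed simp
    from lipschitz_on_add[OF lipschitz_on_cmult_real[OF K, of "\<kappa> * \<kappa>"] lipschitz_on_cmult_real[OF this, of "8 / R"]]
    obtain C where C: "C-lipschitz_on UNIV G" unfolding G_def by blast
    obtain d2 where d2: "0 < d2" "\<And>p. p \<in> cball y0 r1 \<Longrightarrow> dist p y0 < d2 \<Longrightarrow> f y0 - gap / 2 < f p"
      using near[of "gap / 2"] gap by auto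
    \<comment> \<open>The first bound keeps s away from y0; the second makes the error in the
      derivatives at most half of the slope margin.\<close>
    define \<eta> where "\<eta> = min (gap / 2) (k0 * (\<kappa> * \<kappa> - \<kappa>) / 2)"
    have \<kappa>2: "0 < \<kappa> * \<kappa> - \<kappa>" using \<kappa>(1) by simp
    have \<eta>: "0 < \<eta>" "\<eta> \<le> gap / 2" "\<eta> \<le> k0 * (\<kappa> * \<kappa> - \<kappa>) / 2"
      unfolding \<eta>_def using gap k0(1) \<kappa>2 by auto
    have shell: "f x1 + G x1 + gap \<le> f z + G z" if z: "z \<in> cball y0 R" "3 * R / 4 \<le> dist y0 z" for z
    proof -
      have "R / 4 \<le> max 0 (norm (z - y0) - R / 2)" using z(2) unfolding dist_norm norm_minus_commute[of y0] by linarith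
      then have "8 / R * (R / 4) \<le> 8 / R * max 0 (norm (z - y0) - R / 2)"
        by (rule mult_left_mono) (use R in simp)
      moreover have "8 / R * (R / 4) = 2" using R by simp
      moreover have "0 \<le> \<kappa> * \<kappa> * N (z - y0)" using N(2) \<kappa>(1) by simp
      ultimately have "2 \<le> G z" unfolding G_def by linarith
      then show ?thesis using fR[OF z(1)] unfolding gap_def by simp
    qed
    have fcR: "continuous_on (cball y0 R) f" using fc by (rule continuous_on_subset) (use R in auto)
    have x1R: "x1 \<in> cball y0 R" using x1 R by simp
    obtain z s g1 g2 g1' g2' where fz: "z \<in> cball y0 R" "dist y0 z < 3 * R / 4" "dist z s < d2"
      "f z + G s \<le> f x1 + G x1 + \<eta>"
      "C1_on UNIV g1" "(g1 has_derivative blinfun_apply g1') (at z)"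
      "(g2 has_derivative blinfun_apply g2') (at s)" "norm (g1' + g2') \<le> \<eta>"
      "\<And>z'. z' \<in> cball y0 R \<Longrightarrow> f z - g1 z \<le> f z' - g1 z'"
      "\<And>s'. G s - g2 s \<le> G s' - g2 s'"
      by (rule smooth_cutoff.fuzzy_sum_rule[OF cut fcR _ C G0 x1R gap d2(1) \<eta>(1)],
          erule fR, erule (1) shell, rule that)
    define v where "v = s - y0"
    \<comment> \<open>If s were y0, then z would be so close to y0 that continuity forbids f to fall
      by \<open>gap / 2\<close>, as the value of the minimizer would require.\<close>
    have "v \<noteq> 0"
    proof
      assume "v = 0"
      then have "s = y0" unfolding v_def by simp
      then have "f y0 - gap / 2 < f z" using d2(2)[of z] fz(1,3) R by auto
      moreover have "f z \<le> f y0 - gap / 2" using fz(4) G0[of s] \<eta>(2) gap_def by linarith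
      ultimately show False by simp
    qed
    then have "0 < k0 * norm v" using k0(1) by simp
    then have Nv: "0 < N v" using k0(2)[of v] by linarith
    \<comment> \<open>Along the segment from s towards y0, convexity and \<open>G y0 = 0\<close>
      give a value of at most \<open>(1 - t) * G s\<close>. The function g2 touching G from below
      inherits this descent.\<close>
    have "g2' (- v) \<le> - G s"
    proof (rule directional_derivative_le[OF fz(7)])
      have "\<forall>\<^sub>F t in at_right (0::real). 0 < t \<and> t < 1" 
        by (subst eventually_at_right[of 0 1]) (auto intro: exI[of _ 1])
      then show "\<forall>\<^sub>F t in at_right 0. g2 (s + t *\<^sub>R - v) - g2 s \<le> t * - G s"
      proof eventually_elim
        case (elim t)
        have eq: "s + t *\<^sub>R - v - y0 = (1 - t) *\<^sub>R v" unfolding v_def by (simp add: algebra_simps)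
        have m: "max 0 ((1 - t) * a - R / 2) \<le> (1 - t) * max 0 (a - R / 2)" for a
        proof -
          have "(1 - t) * a - R / 2 \<le> (1 - t) * (a - R / 2)" using elim R by (simp add: algebra_simps)
          also have "\<dots> \<le> (1 - t) * max 0 (a - R / 2)" using elim by (intro mult_left_mono) auto
          finally show ?thesis using elim by simp
        qed
        have "G (s + t *\<^sub>R - v) = \<kappa> * \<kappa> * ((1 - t) * N v) + 8 / R * max 0 ((1 - t) * norm v - R / 2)"
          unfolding G_def eq using elim N(1) by simp
        also have "\<dots> \<le> \<kappa> * \<kappa> * ((1 - t) * N v) + 8 / R * ((1 - t) * max 0 (norm v - R / 2))"
          using m[of "norm v"] R by (intro add_left_mono mult_left_mono) auto
        also have "\<dots> = (1 - t) * G s"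
        proof -
          have "a * ((1 - t) * b) + e * ((1 - t) * m) = (1 - t) * (a * b + e * m)" for a b e m :: real
            by (simp add: algebra_simps)
          then show ?thesis unfolding G_def v_def .
        qed
        finally show ?case using fz(10)[of "s + t *\<^sub>R - v"] by (simp add: algebra_simps)
      qed
    qed
    then have g2v: "\<kappa> * \<kappa> * N v \<le> g2' v" using GN[of s] unfolding v_def by (simp add: blinfun.bilinear_simps)
    have "\<bar>g1' v + g2' v\<bar> \<le> \<eta> * norm v"
    proof -
      have "norm ((g1' + g2') v) \<le> norm (g1' + g2') * norm v" by (rule norm_blinfun)
      also have "\<dots> \<le> \<eta> * norm v" using fz(8) by (intro mult_right_mono) auto
      finally show ?thesis by (simp add: blinfun.bilinear_simps)
    qed
    moreover have "\<eta> * norm v \<le> (\<kappa> * \<kappa> - \<kappa>) / 2 * N v"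
    proof -
      have "\<eta> * norm v \<le> k0 * (\<kappa> * \<kappa> - \<kappa>) / 2 * norm v" using \<eta>(3) by (intro mult_right_mono) auto
      also have "\<dots> = (\<kappa> * \<kappa> - \<kappa>) / 2 * (k0 * norm v)" by simp
      also have "\<dots> \<le> (\<kappa> * \<kappa> - \<kappa>) / 2 * N v" using k0(2) \<kappa>2 by (intro mult_left_mono) auto
      finally show ?thesis .
    qed
    moreover have "(\<kappa> * \<kappa> - \<kappa>) / 2 * N v = (\<kappa> * \<kappa> * N v - \<kappa> * N v) / 2" by (simp add: algebra_simps)
    moreover have "\<kappa> * N v < \<kappa> * \<kappa> * N v"
      by (rule mult_strict_right_mono[OF _ Nv]) (use \<kappa>2 in simp)
    moreover have "b < - p" if "\<bar>p + q\<bar> \<le> e" "e \<le> m" "m = (t - b) / 2" "b < t" "t \<le> q" for b p q e m t :: real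
    proof -
      have "p + q \<le> e" using that(1) by simp
      moreover have "2 * m = t - b" using that(3) by simp
      ultimately show ?thesis using that(2,4,5) by linarith
    qed
    \<comment> \<open>Since g1' nearly cancels g2', the test function - g1 for w is steeper than
      \<kappa> times N, while the dual norm bound at x allows at most that.\<close>
    ultimately have big: "\<kappa> * N v < - g1' v" using g2v by metis
    have "z \<in> cball y0 r1" using fz(1) R(2) by simp
    then obtain x where x: "x \<in> fst c" "x \<in> \<Omega>" "x \<in> W" "snd c x = z" using r1(2) by blast
    have Tx: "open {y \<in> fst c. snd c y \<in> ball y0 R}" "x \<in> {y \<in> fst c. snd c y \<in> ball y0 R}"
      using open_chart_preimage[OF c(1) open_ball] x fz(2) R by auto
    have g1m: "((\<lambda>p. - g1 p) has_derivative (\<lambda>v. - g1' v)) (at (snd c x))"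
      using has_derivative_minus[OF fz(6)] x(4) by simp
    obtain Q where "C1_fun A Q" and Q: "(Q \<circ> chart_inv c has_derivative (\<lambda>v. - g1' v)) (at (snd c x))"
      "(\<forall>y \<in> fst c \<inter> {y \<in> fst c. snd c y \<in> ball y0 R} \<inter> closure \<Omega>.
        w y - - g1 (snd c y) \<le> w x - - g1 (snd c x)) \<longrightarrow>
        differential A Q x \<in> superdifferential A \<Omega> w x"
      by (rule test_function[OF cut c(1) x(1) C1_on_minus[OF fz(5)] g1m Tx, of \<Omega> w]) (rule that)
    have "differential A Q x \<in> superdifferential A \<Omega> w x"
    proof (rule Q(2)[rule_format])
      fix y assume "y \<in> fst c \<inter> {y \<in> fst c. snd c y \<in> ball y0 R} \<inter> closure \<Omega>"
      then show "w y - - g1 (snd c y) \<le> w x - - g1 (snd c x)"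
        using fz(9)[of "snd c y"] fy[of y] fy[OF x(1)] x(4) by simp
    qed
    then have dn: "dual_norm A F x (differential A Q x) \<le> 1" using super x(2) by blast
    have "\<bar>- g1' v\<bar> \<le> dual_norm A F x (differential A Q x) * chart_norm c x v"
      by (rule dual_norm_bound(1)[OF c(1) x(1) Q(1)])
    also have "\<dots> \<le> 1 * chart_norm c x v"
      using dn chart_norm_nonneg[OF c(1) x(1)] by (intro mult_right_mono) auto
    also have "\<dots> \<le> \<kappa> * N v" using WP[OF x(3)] by simp
    finally show False using big by simp
  qed
  have T: "open {y \<in> fst c. snd c y \<in> ball y0 (R / 2)}" "x0 \<in> {y \<in> fst c. snd c y \<in> ball y0 (R / 2)}"
    by (rule open_chart_preimage[OF c(1) open_ball]) (use c(2) R in \<open>simp add: y0_def\<close>)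
  obtain \<delta>' where \<delta>': "0 < \<delta>'" "\<And>y. fdist x0 y < \<delta>' \<Longrightarrow> y \<in> fst c \<and> y \<in> {y \<in> fst c. snd c y \<in> ball y0 (R / 2)} \<and>
    chart_norm c x0 (snd c y - snd c x0) \<le> \<kappa> * fdist x0 y \<and>
    fdist x0 y \<le> \<kappa> * chart_norm c x0 (snd c y - snd c x0)"
    by (rule fdist_chart[OF c \<kappa>(1) T]) (rule that)
  have "w y \<le> w x0 + k * fdist x0 y" if "fdist x0 y < \<delta>'" for y
  proof -
    have y: "y \<in> fst c" "dist y0 (snd c y) < R / 2" "N (snd c y - y0) \<le> \<kappa> * fdist x0 y"
      using \<delta>'(2)[OF that] unfolding N_def y0_def by auto
    have "w y - w x0 \<le> \<kappa> * \<kappa> * N (snd c y - y0)"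
      using key[OF y(2)] fy[OF y(1)] fy[OF c(2)] unfolding y0_def by simp
    also have "\<dots> \<le> \<kappa> * \<kappa> * (\<kappa> * fdist x0 y)" using y(3) \<kappa>(1) by (intro mult_left_mono) auto
    also have "\<dots> = k * fdist x0 y" using \<kappa>(2) by (simp add: mult.assoc)
    finally show ?thesis by simp
  qed
  then show ?thesis using \<delta>'(1) by blast
qed

text \<open>The hypothesis \<open>slope\<close> says that w cannot decrease from \<open>x0\<close>
  faster than at rate k. Adding a cone of intermediate slope l makes \<open>x0\<close> a strict
  minimizer with a margin, and the fuzzy sum rule gives a nearby subdifferential of size about l,
  below 1.\<close>

lemma subdifferential_imp_slope:
  fixes \<beta> :: "'x \<Rightarrow> real"
  assumes cut: "smooth_cutoff \<beta> \<beta>' B \<delta>" and \<Omega>: "open \<Omega>" "x0 \<in> \<Omega>"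
    and nontriv: "\<exists>v::'x. v \<noteq> 0"
    and w: "continuous_on (closure \<Omega>) w"
    and sub: "\<And>x \<Delta>. x \<in> \<Omega> \<Longrightarrow> \<Delta> \<in> subdifferential A \<Omega> w x \<Longrightarrow> 1 \<le> dual_norm A F x \<Delta>"
    and k: "0 \<le> k" "k < 1" and slope: "\<And>z. z \<in> closure \<Omega> \<Longrightarrow> w x0 \<le> w z + k * fdist x0 z"
  shows False
proof -
  \<comment> \<open>The gap between k and l produces the margin on the shell, the gap between l and
    1 the final contradiction.\<close>
  define l where "l = (1 + k) / 2"
  have l: "k < l" "l < 1" "0 < l" unfolding l_def using k by auto
  \<comment> \<open>Three factors may be lost: from the distance to the chart norm, from the norm at
    x to the norm at \<open>x0\<close>, and for the error in the fuzzy sum rule.\<close>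
  define \<kappa> where "\<kappa> = root 3 (1 / l)"
  have \<kappa>: "1 < \<kappa>" "\<kappa> * \<kappa> * \<kappa> * l = 1"
    using l real_root_pow_pos2[of 3 "1 / l"] unfolding \<kappa>_def by (auto simp: power3_eq_cube field_simps)
  obtain c where c: "c \<in> A" "x0 \<in> fst c" by (rule obtain_chart)
  define N where "N = chart_norm c x0"
  define y0 where "y0 = snd c x0"
  have N: "N (v + u) \<le> N v + N u" "N (r *\<^sub>R v) = \<bar>r\<bar> * N v" "0 \<le> N v" "N 0 = 0" for v u r
    unfolding N_def using chart_norm_triangle[OF c] chart_norm_scale[OF c] chart_norm_nonneg[OF c]
      chart_norm_zero_iff[OF c] by auto
  obtain k0 K0 where k0: "0 < k0" "\<And>v. k0 * norm v \<le> N v" "0 < K0" "\<And>v. N v \<le> K0 * norm v"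
    using P1_equiv[OF c] unfolding N_def by blast
  obtain W where W: "open W" "x0 \<in> W" "W \<subseteq> fst c"
    and WP: "\<And>y v. y \<in> W \<Longrightarrow> 1 / \<kappa> * N v \<le> chart_norm c y v"
    using P2[OF c, of "\<kappa> - 1"] \<kappa> unfolding N_def by auto
  have WN: "N v \<le> \<kappa> * chart_norm c y v" if "y \<in> W" for y v
    using WP[OF that, of v] \<kappa>(1) by (simp add: field_simps)
  obtain r1 where r1: "0 < r1" "cball y0 r1 \<subseteq> snd c ` (fst c \<inter> (\<Omega> \<inter> W))"
    using chart_ball_in[OF c, of "\<Omega> \<inter> W"] \<Omega> W unfolding y0_def by blast
  obtain \<rho> where \<rho>: "0 < \<rho>" "\<And>y. y \<in> fst c \<Longrightarrow> norm (snd c y - snd c x0) < \<rho> \<Longrightarrow>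
    fdist x0 y \<le> \<kappa> * N (snd c y - snd c x0)"
    using fdist_le_chart_norm[OF c \<kappa>(1)] unfolding N_def by blast
  define R where "R = min r1 (\<rho> / 2)"
  have R: "0 < R" "R \<le> r1" "R < \<rho>" unfolding R_def using r1 \<rho> by auto
  define f where "f = (\<lambda>p. w (chart_inv c p))"
  have fc: "continuous_on (cball y0 R) f"
    unfolding f_def
    by (intro continuous_in_chart[OF w c(1)]) (use R r1(2) closure_subset[of \<Omega>] in force)
  have fy: "f (snd c y) = w y" if "y \<in> fst c" for y unfolding f_def using c(1) that by simp
  have fR: "f y0 - \<kappa> * k * N (p - y0) \<le> f p" if p: "p \<in> cball y0 R" for p
  proof -
    have "p \<in> cball y0 r1" using p R(2) by simp
    then obtain y where y: "y \<in> fst c" "y \<in> \<Omega>" "snd c y = p" using r1(2) by blast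
    have "norm (snd c y - snd c x0) < \<rho>" using p R(3) y(3) unfolding y0_def by (simp add: dist_norm norm_minus_commute)
    then have "k * fdist x0 y \<le> k * (\<kappa> * N (p - y0))"
      using \<rho>(2)[OF y(1)] y(3) k(1) unfolding y0_def by (intro mult_left_mono) auto
    then show ?thesis using slope[of y] y closure_subset[of \<Omega>] fy[OF y(1)] fy[OF c(2)]
      unfolding y0_def by (auto simp: algebra_simps)
  qed
  have \<kappa>k: "0 \<le> \<kappa> * k" using \<kappa>(1) k(1) by simp
  have fm: "f y0 - \<kappa> * k * (K0 * R) \<le> f p" if p: "p \<in> cball y0 R" for p
  proof -
    have "N (p - y0) \<le> K0 * norm (p - y0)" by (rule k0)
    also have "\<dots> \<le> K0 * R" using p k0(3) by (intro mult_left_mono) (auto simp: dist_norm norm_minus_commute)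
    finally have "\<kappa> * k * N (p - y0) \<le> \<kappa> * k * (K0 * R)" using \<kappa>k by (intro mult_left_mono) auto
    then show ?thesis using fR[OF p] by linarith
  qed
  define G where "G = (\<lambda>s. \<kappa> * l * N (s - y0))"
  have \<kappa>l: "0 < \<kappa> * l" using \<kappa>(1) l(3) by simp
  have G0: "0 \<le> G s" for s unfolding G_def using N(3) \<kappa>l by simp
  have Gy0: "G y0 = 0" unfolding G_def using N(4) by simp
  obtain K where K: "K-lipschitz_on UNIV (\<lambda>s. N (s - y0))"
    using chart_norm_lipschitz[OF c] unfolding N_def by blast
  from lipschitz_on_cmult_real[OF K, of "\<kappa> * l"] obtain C where C: "C-lipschitz_on UNIV G"
    unfolding G_def by blast
  \<comment> \<open>On the shell the cone rises at rate \<open>\<kappa> * l\<close> in N while f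
    falls at rate at most \<open>\<kappa> * k\<close>, and N is at least \<open>k0 * (R / 2)\<close>
    there.\<close>
  define \<gamma> where "\<gamma> = \<kappa> * (l - k) * (k0 * (R / 2))"
  have \<gamma>: "0 < \<gamma>" unfolding \<gamma>_def using \<kappa>(1) l(1) k0(1) R(1) by simp
  have shell: "f y0 + G y0 + \<gamma> \<le> f z + G z" if z: "z \<in> cball y0 R" "R / 2 \<le> dist y0 z" for z
  proof -
    have "k0 * (R / 2) \<le> k0 * norm (z - y0)" using z(2) k0(1) by (simp add: dist_norm norm_minus_commute)
    also have "\<dots> \<le> N (z - y0)" by (rule k0)
    finally have "\<gamma> \<le> \<kappa> * (l - k) * N (z - y0)" unfolding \<gamma>_def using \<kappa>(1) l(1) by (intro mult_left_mono) auto
    moreover have "G z = \<kappa> * l * N (z - y0)" unfolding G_def ..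
    ultimately show ?thesis using fR[OF z(1)] Gy0 by (simp add: algebra_simps)
  qed
  define \<eta> where "\<eta> = k0 * (\<kappa> * l * (\<kappa> - 1) / 2)"
  have \<eta>: "0 < \<eta>" unfolding \<eta>_def using k0(1) \<kappa>l \<kappa>(1) by simp
  have y0R: "y0 \<in> cball y0 R" using R by simp
  obtain z s g1 g2 g1' g2' where fz: "z \<in> cball y0 R" "dist y0 z < R / 2" "dist z s < 1"
    "f z + G s \<le> f y0 + G y0 + \<eta>"
    "C1_on UNIV g1" "(g1 has_derivative blinfun_apply g1') (at z)"
    "(g2 has_derivative blinfun_apply g2') (at s)" "norm (g1' + g2') \<le> \<eta>"
    "\<And>z'. z' \<in> cball y0 R \<Longrightarrow> f z - g1 z \<le> f z' - g1 z'"
    "\<And>s'. G s - g2 s \<le> G s' - g2 s'"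
    by (rule smooth_cutoff.fuzzy_sum_rule[OF cut fc _ C G0 y0R \<gamma> zero_less_one \<eta>],
        erule fm, erule (1) shell, rule that)
  have g2v: "g2' v \<le> \<kappa> * l * N v" for v
  proof (rule directional_derivative_le[OF fz(7)])
    show "\<forall>\<^sub>F t in at_right 0. g2 (s + t *\<^sub>R v) - g2 s \<le> t * (\<kappa> * l * N v)"
      using eventually_at_right_less[of 0]
    proof eventually_elim
      case (elim t)
      have "N (s + t *\<^sub>R v - y0) \<le> N (s - y0) + t * N v"
        using N(1)[of "s - y0" "t *\<^sub>R v"] N(2)[of t v] elim by (simp add: algebra_simps)
      then have "\<kappa> * l * N (s + t *\<^sub>R v - y0) \<le> \<kappa> * l * (N (s - y0) + t * N v)"
        using \<kappa>l by (intro mult_left_mono) auto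
      then show ?case using fz(10)[of "s + t *\<^sub>R v"] unfolding G_def by (simp add: algebra_simps)
    qed
  qed
  \<comment> \<open>The slope of the cone plus the error \<eta> measured in N. As
    \<open>(1 + \<kappa>) / 2 < \<kappa>\<close>, one more factor \<kappa> still leaves the product
    below 1.\<close>
  define q where "q = \<kappa> * l + \<kappa> * l * (\<kappa> - 1) / 2"
  have q: "0 < q" "q * \<kappa> < 1"
  proof -
    show "0 < q" unfolding q_def using \<kappa>l \<kappa>(1) by (simp add: add_pos_nonneg)
    have "q * \<kappa> = \<kappa> * \<kappa> * l * ((1 + \<kappa>) / 2)" unfolding q_def by (simp add: field_simps)
    also have "\<dots> < \<kappa> * \<kappa> * l * \<kappa>" using \<kappa>(1) l(3) by (intro mult_strict_left_mono) auto
    also have "\<dots> = 1" using \<kappa>(2) by (simp add: mult.commute mult.left_commute)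
    finally show "q * \<kappa> < 1" .
  qed
  have g1v: "\<bar>g1' v\<bar> \<le> q * N v" for v
  proof -
    have "norm ((g1' + g2') v) \<le> norm (g1' + g2') * norm v" by (rule norm_blinfun)
    also have "\<dots> \<le> \<eta> * norm v" using fz(8) by (intro mult_right_mono) auto
    also have "\<dots> = \<kappa> * l * (\<kappa> - 1) / 2 * (k0 * norm v)" unfolding \<eta>_def by simp
    also have "\<dots> \<le> \<kappa> * l * (\<kappa> - 1) / 2 * N v"
      using k0(2) \<kappa>l \<kappa>(1) by (intro mult_left_mono) auto
    finally have "\<bar>g1' v + g2' v\<bar> \<le> \<kappa> * l * (\<kappa> - 1) / 2 * N v" by (simp add: blinfun.bilinear_simps)
    moreover have "\<bar>g2' v\<bar> \<le> \<kappa> * l * N v"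
      using g2v[of v] g2v[of "- v"] N(2)[of "-1" v] by (simp add: blinfun.bilinear_simps abs_le_iff)
    ultimately show ?thesis unfolding q_def distrib_right by linarith
  qed
  have "z \<in> cball y0 r1" using fz(1) R(2) by simp
  then obtain x where x: "x \<in> fst c" "x \<in> \<Omega>" "x \<in> W" "snd c x = z" using r1(2) by blast
  have Tx: "open {y \<in> fst c. snd c y \<in> ball y0 R}" "x \<in> {y \<in> fst c. snd c y \<in> ball y0 R}"
    using open_chart_preimage[OF c(1) open_ball] x fz(2) R by auto
  obtain Q where "C1_fun A Q" and Q: "(Q \<circ> chart_inv c has_derivative blinfun_apply g1') (at (snd c x))"
    "(\<forall>y \<in> fst c \<inter> {y \<in> fst c. snd c y \<in> ball y0 R} \<inter> closure \<Omega>.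
      w x - g1 (snd c x) \<le> w y - g1 (snd c y)) \<longrightarrow>
      differential A Q x \<in> subdifferential A \<Omega> w x"
    by (rule test_function[OF cut c(1) x(1) fz(5) fz(6)[folded x(4)] Tx, of \<Omega> w]) (rule that)
  have "differential A Q x \<in> subdifferential A \<Omega> w x"
  proof (rule Q(2)[rule_format])
    fix y assume "y \<in> fst c \<inter> {y \<in> fst c. snd c y \<in> ball y0 R} \<inter> closure \<Omega>"
    then show "w x - g1 (snd c x) \<le> w y - g1 (snd c y)"
      using fz(9)[of "snd c y"] fy[of y] fy[OF x(1)] x(4) by simp
  qed
  then have "1 \<le> dual_norm A F x (differential A Q x)" using sub x(2) by blast
  also have "\<dots> \<le> q * \<kappa>"
  proof (rule dual_norm_bound(2)[OF c(1) x(1) Q(1) _ nontriv])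
    fix v
    have "\<bar>g1' v\<bar> \<le> q * (\<kappa> * chart_norm c x v)"
      using g1v[of v] WN[OF x(3), of v] q(1) mult_left_mono[of "N v" "\<kappa> * chart_norm c x v" q] by linarith
    then show "\<bar>g1' v\<bar> \<le> q * \<kappa> * chart_norm c x v" by (simp add: mult.assoc)
  qed
  finally show False using q(2) by simp
qed

end

section \<open>Comparison along paths\<close>

context C1_Finsler_manifold begin

text \<open>The slope bound is available only at points of \<Omega>, whereas the path may start on
  the boundary. Continuous induction therefore starts at an interior time, which afterwards tends to
  the initial one.\<close>

lemma slope_along_path:
  assumes w: "continuous_on (closure \<Omega>) w" and k: "0 \<le> k"
    and slope: "\<And>x. x \<in> \<Omega> \<Longrightarrow> \<exists>\<delta>>0. \<forall>y. fdist x y < \<delta> \<longrightarrow> (w y :: real) \<le> w x + k * fdist x y"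
    and \<gamma>: "(a::real) < b" "continuous_on {a..b} \<gamma>" "\<And>t. a < t \<Longrightarrow> t < b \<Longrightarrow> \<gamma> t \<in> \<Omega>"
      "\<gamma> a \<in> closure \<Omega>" "\<gamma> b \<in> closure \<Omega>"
    and L: "\<And>s t. a \<le> s \<Longrightarrow> s \<le> t \<Longrightarrow> t \<le> b \<Longrightarrow> fdist (\<gamma> s) (\<gamma> t) \<le> L t - L s"
  shows "w (\<gamma> b) \<le> w (\<gamma> a) + k * (L b - L a)"
proof -
  have cl: "\<gamma> t \<in> closure \<Omega>" if "a \<le> t" "t \<le> b" for t
    using \<gamma>(3)[of t] \<gamma>(4,5) closure_subset[of \<Omega>] that by (cases "t = a"; cases "t = b") auto
  have wc: "continuous_on {a..b} (\<lambda>t. w (\<gamma> t))"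
    by (rule continuous_on_compose2[OF w \<gamma>(2)]) (use cl in auto)
  have Lmono: "L s \<le> L t" if "a \<le> s" "s \<le> t" "t \<le> b" for s t
    using L[OF that] fdist_nonneg[of "\<gamma> s" "\<gamma> t"] by simp
  have step: "w (\<gamma> b) \<le> w (\<gamma> t0) + k * (L b - L t0)" if t0: "a < t0" "t0 < b" for t0
  proof (rule real_interval_induct[of "\<lambda>t. w (\<gamma> t) \<le> w (\<gamma> t0) + k * (L t - L t0)" t0 b])
    fix t assume t: "t0 < t" "t \<le> b" and IH: "\<And>s. t0 \<le> s \<Longrightarrow> s < t \<Longrightarrow> w (\<gamma> s) \<le> w (\<gamma> t0) + k * (L s - L t0)"
    have "((\<lambda>s. w (\<gamma> s)) \<longlongrightarrow> w (\<gamma> t)) (at t within {a..b})"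
      using wc t t0 unfolding continuous_on_def by auto
    then have lim: "((\<lambda>s. w (\<gamma> s)) \<longlongrightarrow> w (\<gamma> t)) (at t within {t0..<t})"
      by (rule tendsto_within_subset) (use t t0 in auto)
    show "w (\<gamma> t) \<le> w (\<gamma> t0) + k * (L t - L t0)"
    proof (rule tendsto_upperbound[OF lim])
      have "\<forall>\<^sub>F s in at t within {t0..<t}. t0 \<le> s \<and> s < t" unfolding eventually_at_topological by auto
      then show "\<forall>\<^sub>F s in at t within {t0..<t}. w (\<gamma> s) \<le> w (\<gamma> t0) + k * (L t - L t0)"
      proof eventually_elim
        case (elim s)
        have "k * (L s - L t0) \<le> k * (L t - L t0)"
          using Lmono[of s t] elim t t0 k by (intro mult_left_mono) auto
        then show ?case using IH[of s] elim by simp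
      qed
      show "at t within {t0..<t} \<noteq> bot" using t(1) by (simp add: trivial_limit_within)
    qed
  next
    fix t assume t: "t0 \<le> t" "t < b" and P: "w (\<gamma> t) \<le> w (\<gamma> t0) + k * (L t - L t0)"
    have tO: "\<gamma> t \<in> \<Omega>" using \<gamma>(3) t t0 by simp
    then obtain \<delta> where \<delta>: "0 < \<delta>" "\<And>y. fdist (\<gamma> t) y < \<delta> \<Longrightarrow> w y \<le> w (\<gamma> t) + k * fdist (\<gamma> t) y"
      using slope by blast
    obtain T where T: "open T" "\<gamma> t \<in> T" "\<And>y. y \<in> T \<Longrightarrow> fdist (\<gamma> t) y < \<delta>" using fdist_nbhd[OF \<delta>(1)] by blast
    have "(\<gamma> \<longlongrightarrow> \<gamma> t) (at t within {a..b})" using \<gamma>(2) t t0 unfolding continuous_on_def by auto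
    then have "\<forall>\<^sub>F s in at t within {a..b}. \<gamma> s \<in> T" using T topological_tendstoD by blast
    then obtain d where d: "0 < d" "\<And>s. s \<in> {a..b} \<Longrightarrow> s \<noteq> t \<Longrightarrow> dist s t < d \<Longrightarrow> \<gamma> s \<in> T"
      unfolding eventually_at by blast
    have "w (\<gamma> s) \<le> w (\<gamma> t0) + k * (L s - L t0)" if s: "t < s" "s < t + d" "s \<le> b" for s
    proof -
      have "\<gamma> s \<in> T" by (rule d(2)) (use s t t0 in \<open>auto simp: dist_real_def\<close>)
      then have "w (\<gamma> s) \<le> w (\<gamma> t) + k * fdist (\<gamma> t) (\<gamma> s)" using \<delta>(2) T(3) by blast
      also have "k * fdist (\<gamma> t) (\<gamma> s) \<le> k * (L s - L t)" using L[of t s] s t t0 k by (intro mult_left_mono) auto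
      finally show ?thesis using P by (simp add: right_diff_distrib)
    qed
    then show "\<exists>\<delta>>0. \<forall>s. t < s \<and> s < t + \<delta> \<and> s \<le> b \<longrightarrow> w (\<gamma> s) \<le> w (\<gamma> t0) + k * (L s - L t0)"
      using d(1) by blast
  qed (use t0 in auto)
  have "((\<lambda>s. w (\<gamma> s)) \<longlongrightarrow> w (\<gamma> a)) (at a within {a..b})"
    using wc \<gamma>(1) unfolding continuous_on_def by auto
  then have lim: "((\<lambda>s. w (\<gamma> s)) \<longlongrightarrow> w (\<gamma> a)) (at a within {a<..<b})"
    by (rule tendsto_within_subset) auto
  have "w (\<gamma> b) - k * (L b - L a) \<le> w (\<gamma> a)"
  proof (rule tendsto_lowerbound[OF lim])
    have "\<forall>\<^sub>F s in at a within {a<..<b}. a < s \<and> s < b" unfolding eventually_at_topological by auto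
    then show "\<forall>\<^sub>F s in at a within {a<..<b}. w (\<gamma> b) - k * (L b - L a) \<le> w (\<gamma> s)"
    proof eventually_elim
      case (elim s)
      have "k * (L b - L s) \<le> k * (L b - L a)"
        using Lmono[of a s] elim k by (intro mult_left_mono) auto
      then show ?case using step[of s] elim by simp
    qed
    show "at a within {a<..<b} \<noteq> bot" using \<gamma>(1) by (simp add: trivial_limit_within islimpt_greaterThanLessThan1)
  qed
  then show ?thesis by simp
qed

text \<open>Cut an almost shortest path at the last time at which it is outside \<Omega>. The
  discarded part has length at least the distance from y to the cut point, which accounts for the
  last estimate.\<close>

lemma path_from_frontier:
  assumes \<Omega>: "open \<Omega>" "x \<in> \<Omega>" "y \<notin> \<Omega>" and r: "fdist y x < r"
  obtains a b :: real and \<gamma> L where "a < b" "continuous_on {a..b} \<gamma>" "\<gamma> a \<in> frontier \<Omega>" "\<gamma> b = x"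
    "\<And>t. a < t \<Longrightarrow> t \<le> b \<Longrightarrow> \<gamma> t \<in> \<Omega>"
    "\<And>s t. a \<le> s \<Longrightarrow> s \<le> t \<Longrightarrow> t \<le> b \<Longrightarrow> fdist (\<gamma> s) (\<gamma> t) \<le> L t - L s"
    "fdist y (\<gamma> a) + (L b - L a) < (r::real)"
proof -
  obtain a b :: real and \<gamma> L where \<gamma>: "a < b" "continuous_on {a..b} \<gamma>" "\<gamma> a = y" "\<gamma> b = x"
    and L: "\<And>s t. a \<le> s \<Longrightarrow> s \<le> t \<Longrightarrow> t \<le> b \<Longrightarrow> fdist (\<gamma> s) (\<gamma> t) \<le> L t - L s" "L b - L a < r"
    by (rule fdist_path[OF r]) (rule that)
  define Z where "Z = {t \<in> {a..b}. \<gamma> t \<in> - \<Omega>}"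
  have "closed Z"
    using continuous_closed_preimage[OF \<gamma>(2), of "- \<Omega>"] \<Omega>(1)
    unfolding Z_def by (simp add: closed_Compl vimage_def Int_def)
  moreover have "Z \<subseteq> {a..b}" unfolding Z_def by blast
  ultimately have "compact Z" by (meson bounded_closed_interval bounded_subset compact_eq_bounded_closed)
  moreover have "a \<in> Z" using \<gamma> \<Omega>(3) unfolding Z_def by simp
  ultimately obtain \<tau> where \<tau>: "\<tau> \<in> Z" "\<And>t. t \<in> Z \<Longrightarrow> t \<le> \<tau>" using compact_attains_sup[of Z] by blast
  have \<tau>ab: "a \<le> \<tau>" "\<tau> \<le> b" "\<gamma> \<tau> \<notin> \<Omega>" using \<tau>(1) unfolding Z_def by auto
  then have \<tau>b: "\<tau> < b" using \<gamma>(4) \<Omega>(2) by (cases "\<tau> = b") auto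
  have after: "\<gamma> t \<in> \<Omega>" if "\<tau> < t" "t \<le> b" for t
    using \<tau>(2)[of t] that \<tau>ab unfolding Z_def by force
  have "(\<gamma> \<longlongrightarrow> \<gamma> \<tau>) (at \<tau> within {a..b})" using \<gamma>(2) \<tau>ab unfolding continuous_on_def by auto
  then have lim: "(\<gamma> \<longlongrightarrow> \<gamma> \<tau>) (at \<tau> within {\<tau><..<b})"
    by (rule tendsto_within_subset) (use \<tau>ab in auto)
  have "\<gamma> \<tau> \<in> closure \<Omega>"
  proof (rule Lim_in_closed_set[OF closed_closure _ _ lim])
    have "\<forall>\<^sub>F t in at \<tau> within {\<tau><..<b}. \<tau> < t \<and> t < b" unfolding eventually_at_topological by auto
    then show "\<forall>\<^sub>F t in at \<tau> within {\<tau><..<b}. \<gamma> t \<in> closure \<Omega>"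
      by eventually_elim (use after closure_subset in force)
    show "at \<tau> within {\<tau><..<b} \<noteq> bot" using \<tau>b by (simp add: trivial_limit_within islimpt_greaterThanLessThan1)
  qed
  then have front: "\<gamma> \<tau> \<in> frontier \<Omega>" using \<tau>ab(3) \<Omega>(1) unfolding frontier_def by (simp add: interior_open)
  show thesis
  proof (rule that[OF \<tau>b continuous_on_subset[OF \<gamma>(2)] front \<gamma>(4) after])
    show "{\<tau>..b} \<subseteq> {a..b}" using \<tau>ab by simp
    show "fdist y (\<gamma> \<tau>) + (L b - L \<tau>) < r" using L(1)[of a \<tau>] L(2) \<tau>ab \<gamma>(3) by simp
    show "fdist (\<gamma> s) (\<gamma> t) \<le> L t - L s" if "\<tau> \<le> s" "s \<le> t" "t \<le> b" for s t
      using L(1)[of s t] that \<tau>ab by simp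
  qed
qed

text \<open>A bound on the ascent in every direction bounds the descent as well: traverse the path
  backwards.\<close>

lemma slope_compare_frontier:
  assumes \<Omega>: "open \<Omega>" "x \<in> \<Omega>" "y \<notin> \<Omega>" and r: "fdist y x < r"
    and w: "continuous_on (closure \<Omega>) w" and k: "0 \<le> k"
    and slope: "\<And>x. x \<in> \<Omega> \<Longrightarrow> \<exists>\<delta>>0. \<forall>y. fdist x y < \<delta> \<longrightarrow> (w y :: real) \<le> w x + k * fdist x y"
  obtains y' l where "y' \<in> frontier \<Omega>" "0 \<le> l" "fdist y y' + l < r" "\<bar>w x - w y'\<bar> \<le> k * l"
proof -
  obtain a b :: real and \<gamma> L where \<gamma>: "a < b" "continuous_on {a..b} \<gamma>" "\<gamma> a \<in> frontier \<Omega>" "\<gamma> b = x"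
    "\<And>t. a < t \<Longrightarrow> t \<le> b \<Longrightarrow> \<gamma> t \<in> \<Omega>"
    and L: "\<And>s t. a \<le> s \<Longrightarrow> s \<le> t \<Longrightarrow> t \<le> b \<Longrightarrow> fdist (\<gamma> s) (\<gamma> t) \<le> L t - L s"
    "fdist y (\<gamma> a) + (L b - L a) < r"
    by (rule path_from_frontier[OF \<Omega> r]) (rule that)
  have cl: "\<gamma> a \<in> closure \<Omega>" "\<gamma> b \<in> closure \<Omega>"
    using \<gamma>(3,4) \<Omega>(2) closure_subset[of \<Omega>] unfolding frontier_def by auto
  have 1: "w (\<gamma> b) \<le> w (\<gamma> a) + k * (L b - L a)"
    by (rule slope_along_path[OF w k slope \<gamma>(1,2) _ cl L(1)]) (use \<gamma>(5) in auto)
  \<comment> \<open>The double signs come from the reversed parameter; the length function of the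
    reversed path is \<open>- L (- t)\<close>.\<close>
  have 2: "w (\<gamma> (- (- a))) \<le> w (\<gamma> (- (- b))) + k * (- L (- (- a)) - - L (- (- b)))"
  proof (rule slope_along_path[OF w k slope, of "- b" "- a" "\<lambda>t. \<gamma> (- t)" "\<lambda>t. - L (- t)"])
    show "continuous_on {- b..- a} (\<lambda>t. \<gamma> (- t))"
      by (rule continuous_on_compose2[OF \<gamma>(2)]) (auto intro!: continuous_intros)
    show "fdist (\<gamma> (- s)) (\<gamma> (- t)) \<le> - L (- t) - - L (- s)" if "- b \<le> s" "s \<le> t" "t \<le> - a" for s t
      using L(1)[of "- t" "- s"] that fdist_commute[of "\<gamma> (- s)" "\<gamma> (- t)"] by simp
  qed (use \<gamma> cl in auto)
  have "0 \<le> L b - L a" using L(1)[of a b] \<gamma>(1) fdist_nonneg[of "\<gamma> a" "\<gamma> b"] by simp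
  then show thesis
    by (rule that[OF \<gamma>(3) _ L(2)]) (use 1 2 \<gamma>(4) in \<open>simp add: abs_le_iff\<close>)
qed

end

section \<open>Existence and uniqueness for the boundary value problem\<close>

locale eikonal_problem = C1_Finsler_manifold A F
  for A :: "('m::t2_space, 'x::banach) chart set" and F +
  fixes \<beta> :: "'x \<Rightarrow> real" and \<beta>' B \<delta> and \<Omega> :: "'m set" and h u :: "'m \<Rightarrow> real"
  assumes complete: "Metric_space.mcomplete UNIV fdist"
    and cutoff: "smooth_cutoff \<beta> \<beta>' B \<delta>"
    and \<Omega>: "open \<Omega>"
    and bounded: "Metric_space.mbounded UNIV fdist \<Omega>"
    and frontier_nonempty: "frontier \<Omega> \<noteq> {}"
    and h: "\<And>x y. x \<in> frontier \<Omega> \<Longrightarrow> y \<in> frontier \<Omega> \<Longrightarrow> \<bar>h x - h y\<bar> \<le> fdist x y"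
    and u: "\<And>x. x \<in> closure \<Omega> \<Longrightarrow> u x = (INF y\<in>frontier \<Omega>. h y + fdist y x)"
begin

lemma frontier_not_in: "y \<in> frontier \<Omega> \<Longrightarrow> y \<notin> \<Omega>"
  using \<Omega> unfolding frontier_def by (simp add: interior_open)

lemma frontier_in_closure: "y \<in> frontier \<Omega> \<Longrightarrow> y \<in> closure \<Omega>"
  unfolding frontier_def by blast

lemma closure_cases: "x \<in> closure \<Omega> \<Longrightarrow> x \<in> \<Omega> \<or> x \<in> frontier \<Omega>"
  using \<Omega> unfolding frontier_def by (simp add: interior_open)

lemma bdd: "bdd_below ((\<lambda>y. h y + fdist y x) ` frontier \<Omega>)"
proof -
  obtain y0 where y0: "y0 \<in> frontier \<Omega>" using frontier_nonempty by blast
  show ?thesis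
  proof (rule bdd_belowI2)
    fix y assume y: "y \<in> frontier \<Omega>"
    show "h y0 - fdist y0 x \<le> h y + fdist y x"
      using h[OF y0 y] fdist_triangle[of y0 y x] fdist_commute[of y x] by (simp add: abs_le_iff)
  qed
qed

lemma u_le: "x \<in> closure \<Omega> \<Longrightarrow> y \<in> frontier \<Omega> \<Longrightarrow> u x \<le> h y + fdist y x"
  unfolding u by (rule cINF_lower[OF bdd])

lemma u_ge: "x \<in> closure \<Omega> \<Longrightarrow> (\<And>y. y \<in> frontier \<Omega> \<Longrightarrow> m \<le> h y + fdist y x) \<Longrightarrow> m \<le> u x"
  unfolding u by (rule cINF_greatest[OF frontier_nonempty])

lemma u_approx:
  assumes "x \<in> closure \<Omega>" "0 < e" obtains y where "y \<in> frontier \<Omega>" "h y + fdist y x < u x + e"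
proof -
  have "\<exists>y\<in>frontier \<Omega>. h y + fdist y x < u x + e"
  proof (rule ccontr)
    assume "\<not> ?thesis"
    then have "u x + e \<le> u x" by (intro u_ge[OF assms(1)]) (auto simp: not_less)
    then show False using assms(2) by simp
  qed
  then show thesis using that by blast
qed

lemma u_lipschitz:
  assumes "x \<in> closure \<Omega>" "z \<in> closure \<Omega>" shows "u x \<le> u z + fdist x z"
proof -
  have "u x - fdist x z \<le> u z"
  proof (rule u_ge[OF assms(2)])
    fix y assume y: "y \<in> frontier \<Omega>"
    show "u x - fdist x z \<le> h y + fdist y z"
      using u_le[OF assms(1) y] fdist_triangle[of y x z] fdist_commute[of x z] by simp
  qed
  then show ?thesis by simp
qed

lemma u_frontier: assumes x: "x \<in> frontier \<Omega>" shows "u x = h x"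
proof (rule order_antisym)
  show "u x \<le> h x" using u_le[OF frontier_in_closure[OF x] x] fdist_refl by simp
  show "h x \<le> u x"
  proof (rule u_ge[OF frontier_in_closure[OF x]])
    fix y assume y: "y \<in> frontier \<Omega>"
    show "h x \<le> h y + fdist y x" using h[OF y x] by (simp add: abs_le_iff)
  qed
qed

lemma u_continuous: "continuous_on (closure \<Omega>) u"
  unfolding continuous_on_def
proof
  fix x assume x: "x \<in> closure \<Omega>"
  show "(u \<longlongrightarrow> u x) (at x within closure \<Omega>)"
  proof (rule tendstoI)
    fix e :: real assume "0 < e"
    then obtain T where T: "open T" "x \<in> T" "\<And>y. y \<in> T \<Longrightarrow> fdist x y < e" using fdist_nbhd by blast
    show "\<forall>\<^sub>F z in at x within closure \<Omega>. dist (u z) (u x) < e"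
      unfolding eventually_at_topological
    proof (intro exI[of _ T] conjI ballI impI T(1,2))
      fix z assume z: "z \<in> T" "z \<in> closure \<Omega>"
      show "dist (u z) (u x) < e"
        using u_lipschitz[OF x z(2)] u_lipschitz[OF z(2) x] T(3)[OF z(1)] fdist_commute[of x z]
        by (simp add: dist_real_def abs_less_iff)
    qed
  qed
qed

text \<open>Where g touches u from above, g cannot descend faster than u, hence not faster than the
  distance. This bounds the derivative in each direction from below only; applying it to the
  opposite direction as well bounds its absolute value.\<close>

lemma u_superdifferential:
  assumes x: "x \<in> \<Omega>" and \<Lambda>: "\<Lambda> \<in> superdifferential A \<Omega> u x" shows "dual_norm A F x \<Lambda> \<le> 1"
proof -
  obtain g V where g: "\<Lambda> = differential A g x" "C1_fun A g" and V: "open V" "x \<in> V"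
    "\<And>y. y \<in> V \<inter> closure \<Omega> \<Longrightarrow> u y - g y \<le> u x - g x"
    using \<Lambda> unfolding superdifferential_def local_max_on_def by blast
  obtain c where c: "c \<in> A" "x \<in> fst c" by (rule obtain_chart)
  define D where "D = frechet_derivative (g \<circ> chart_inv c) (at (snd c x))"
  have D: "(g \<circ> chart_inv c has_derivative D) (at (snd c x))"
    unfolding D_def by (rule C1_fun_has_derivative[OF g(2) c])
  have lin: "D (- v) = - D v" for v
    by (rule linear_neg[OF has_derivative_linear[OF D]])
  have one: "- D v \<le> k * chart_norm c x v" if k: "1 < k" for k v
  proof (rule directional_derivative_le[OF has_derivative_minus[OF D]])
    obtain \<rho> where \<rho>: "0 < \<rho>" "\<And>y. y \<in> fst c \<Longrightarrow> norm (snd c y - snd c x) < \<rho> \<Longrightarrow>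
      fdist x y \<le> k * chart_norm c x (snd c y - snd c x)"
      by (rule fdist_le_chart_norm[OF c k]) (rule that)
    let ?S = "snd c ` (fst c \<inter> (V \<inter> \<Omega>)) \<inter> ball (snd c x) \<rho>"
    have "open ?S" "snd c x \<in> ?S"
      using open_chart_image[OF c(1), of "V \<inter> \<Omega>"] V(1,2) \<Omega> x c(2) \<rho>(1) by auto
    moreover have "((\<lambda>t. snd c x + t *\<^sub>R v) \<longlongrightarrow> snd c x + 0 *\<^sub>R v) (at_right 0)"
      by (intro tendsto_intros)
    ultimately have "\<forall>\<^sub>F t in at_right 0. snd c x + t *\<^sub>R v \<in> ?S" by (auto dest: topological_tendstoD)
    then show "\<forall>\<^sub>F t in at_right 0. - (g \<circ> chart_inv c) (snd c x + t *\<^sub>R v) - - (g \<circ> chart_inv c) (snd c x)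
        \<le> t * (k * chart_norm c x v)"
      using eventually_at_right_less[of 0]
    proof eventually_elim
      case (elim t)
      then obtain y where y: "y \<in> fst c" "y \<in> V" "y \<in> \<Omega>" "snd c y = snd c x + t *\<^sub>R v" by auto
      have cl: "y \<in> closure \<Omega>" "x \<in> closure \<Omega>" using y(3) x closure_subset by auto
      have gy: "(g \<circ> chart_inv c) (snd c x + t *\<^sub>R v) = g y" "(g \<circ> chart_inv c) (snd c x) = g x"
        using y(1) c unfolding y(4)[symmetric] by simp_all
      have "norm (snd c y - snd c x) < \<rho>" using elim y(4) by (simp add: dist_norm)
      then have "fdist x y \<le> k * chart_norm c x (t *\<^sub>R v)" using \<rho>(2)[OF y(1)] y(4) by simp
      also have "\<dots> = t * (k * chart_norm c x v)" using chart_norm_scale[OF c] elim by simp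
      finally show ?case unfolding gy using V(3)[of y] y(2) cl u_lipschitz[OF cl(2,1)] by simp
    qed
  qed
  have "\<bar>D v\<bar> \<le> 1 * chart_norm c x v" for v
  proof -
    have "- D v \<le> 1 * chart_norm c x v" for v
    proof (rule field_le_epsilon)
      fix e :: real assume "0 < e"
      \<comment> \<open>Chosen so that passing from 1 to k costs at most e; the summand 1 covers
        vectors of norm 0.\<close>
      define k where "k = 1 + e / (chart_norm c x v + 1)"
      have n: "0 \<le> chart_norm c x v" by (rule chart_norm_nonneg[OF c])
      then have k: "1 < k" unfolding k_def using \<open>0 < e\<close> by simp
      have "k * chart_norm c x v = chart_norm c x v + e * (chart_norm c x v / (chart_norm c x v + 1))"
        unfolding k_def by (simp add: distrib_right)
      also have "\<dots> \<le> chart_norm c x v + e * 1"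
        using n \<open>0 < e\<close> by (intro add_left_mono mult_left_mono) auto
      finally show "- D v \<le> 1 * chart_norm c x v + e" using one[OF k, of v] by simp
    qed
    from this[of v] this[of "- v"] show ?thesis
      using chart_norm_minus[OF c, of v] by (simp add: lin abs_le_iff)
  qed
  then show ?thesis unfolding g(1)
    by (rule dual_norm_bound(2)[OF c D _ model_space_nontrivial[OF frontier_nonempty]])
qed

text \<open>Moving from \<open>x\<close> along an almost optimal path towards the boundary decreases \<open>u\<close> at unit rate.\<close>

lemma u_subdifferential:
  assumes x: "x \<in> \<Omega>" and \<Delta>: "\<Delta> \<in> subdifferential A \<Omega> u x" shows "1 \<le> dual_norm A F x \<Delta>"
proof (rule ccontr)
  assume neg: "\<not> ?thesis"
  obtain g V where g: "\<Delta> = differential A g x" "C1_fun A g" and V: "open V" "x \<in> V"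
    "\<And>y. y \<in> V \<inter> closure \<Omega> \<Longrightarrow> u x - g x \<le> u y - g y"
    using \<Delta> unfolding subdifferential_def local_min_on_def by blast
  obtain c where c: "c \<in> A" "x \<in> fst c" by (rule obtain_chart)
  define D where "D = frechet_derivative (g \<circ> chart_inv c) (at (snd c x))"
  have D: "(g \<circ> chart_inv c has_derivative D) (at (snd c x))"
    unfolding D_def by (rule C1_fun_has_derivative[OF g(2) c])
  define q where "q = max 0 (dual_norm A F x \<Delta>)"
  have q: "0 \<le> q" "q < 1" using neg unfolding q_def by auto
  have Dq: "\<bar>D v\<bar> \<le> q * chart_norm c x v" for v
  proof -
    have "\<bar>D v\<bar> \<le> dual_norm A F x \<Delta> * chart_norm c x v" unfolding g(1) by (rule dual_norm_bound(1)[OF c D])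
    also have "\<dots> \<le> q * chart_norm c x v"
      unfolding q_def by (intro mult_right_mono chart_norm_nonneg[OF c]) auto
    finally show ?thesis .
  qed
  obtain k0 where k0: "0 < k0" "\<And>v. k0 * norm v \<le> chart_norm c x v" using P1_equiv[OF c] by blast
  \<comment> \<open>The rates satisfy q < p < \<theta> < 1. The first gap absorbs the remainder of
    the derivative of g, the second the factor k = \<theta> / p between chart norm and
    distance.\<close>
  define \<theta> where "\<theta> = (1 + q) / 2"
  define p where "p = q + (1 - q) / 4"
  have p: "0 < p" "p < \<theta>" "0 < \<theta>" "\<theta> < 1" unfolding p_def \<theta>_def using q by (auto simp: field_simps)
  define k where "k = \<theta> / p"
  have k: "1 < k" "p * k = \<theta>" unfolding k_def using p by auto
  have "\<forall>e>0. \<exists>d>0. \<forall>y\<in>UNIV. norm (y - snd c x) < d \<longrightarrow>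
      norm ((g \<circ> chart_inv c) y - (g \<circ> chart_inv c) (snd c x) - D (y - snd c x)) \<le> e * norm (y - snd c x)"
    using D unfolding has_derivative_within_alt by blast
  then obtain d where d: "0 < d" "\<And>y. norm (y - snd c x) < d \<Longrightarrow>
      norm ((g \<circ> chart_inv c) y - (g \<circ> chart_inv c) (snd c x) - D (y - snd c x)) \<le> k0 * ((1 - q) / 4) * norm (y - snd c x)"
    using q(2) k0(1) by (metis UNIV_I diff_gt_0_iff_gt divide_pos_pos mult_pos_pos zero_less_numeral)
  have "open {y \<in> fst c. snd c y \<in> ball (snd c x) d}" by (rule open_chart_preimage[OF c(1) open_ball])
  then have U: "open (V \<inter> \<Omega> \<inter> {y \<in> fst c. snd c y \<in> ball (snd c x) d})" "x \<in> V \<inter> \<Omega> \<inter> {y \<in> fst c. snd c y \<in> ball (snd c x) d}"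
    using V \<Omega> x c(2) d(1) by auto
  obtain r where r: "0 < r" "\<And>y. fdist x y < r \<Longrightarrow> y \<in> fst c \<and> y \<in> V \<inter> \<Omega> \<inter> {y \<in> fst c. snd c y \<in> ball (snd c x) d} \<and>
    chart_norm c x (snd c y - snd c x) \<le> k * fdist x y \<and>
    fdist x y \<le> k * chart_norm c x (snd c y - snd c x)"
    by (rule fdist_chart[OF c k(1) U]) (rule that)
  have xcl: "x \<in> closure \<Omega>" using x closure_subset by auto
  have slow: "u x - \<theta> * fdist x y \<le> u y" if y: "fdist x y < r" for y
  proof -
    have y': "y \<in> fst c" "y \<in> V" "y \<in> \<Omega>" "norm (snd c y - snd c x) < d"
      "chart_norm c x (snd c y - snd c x) \<le> k * fdist x y"
      using r(2)[OF y] by (auto simp: dist_norm norm_minus_commute)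
    let ?v = "snd c y - snd c x"
    have "\<bar>g y - g x - D ?v\<bar> \<le> k0 * ((1 - q) / 4) * norm ?v"
      using d(2)[OF y'(4)] y'(1) c by simp
    also have "\<dots> = (1 - q) / 4 * (k0 * norm ?v)" by simp
    also have "\<dots> \<le> (1 - q) / 4 * chart_norm c x ?v" using k0(2) q(2) by (intro mult_left_mono) auto
    finally have "g x - g y \<le> \<bar>D ?v\<bar> + (1 - q) / 4 * chart_norm c x ?v" by linarith
    also have "\<dots> \<le> p * chart_norm c x ?v" using Dq[of ?v] unfolding p_def distrib_right by linarith
    also have "\<dots> \<le> p * (k * fdist x y)" using y'(5) p(1) by (intro mult_left_mono) auto
    also have "\<dots> = \<theta> * fdist x y" using k(2) by (simp add: mult.assoc[symmetric])
    finally have "g x - g y \<le> \<theta> * fdist x y" .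
    moreover have "u x - g x \<le> u y - g y" using V(3)[of y] y'(2,3) closure_subset[of \<Omega>] by blast
    ultimately show ?thesis by simp
  qed
  define s where "s = r / 2"
  have s: "0 < s" "s < r" unfolding s_def using r(1) by auto
  \<comment> \<open>It is spent twice, on the choice of y and on that of the path, and
    \<open>2 * e\<close> must stay below \<open>s * (1 - \<theta>)\<close>.\<close>
  define e where "e = s * (1 - \<theta>) / 4"
  have e: "0 < e" unfolding e_def using s p by simp
  obtain y where y: "y \<in> frontier \<Omega>" "h y + fdist y x < u x + e" by (rule u_approx[OF xcl e])
  have "fdist y x < fdist y x + e" using e by simp
  then obtain a b :: real and \<gamma> L where \<gamma>: "a < b" "continuous_on {a..b} \<gamma>" "\<gamma> a = y" "\<gamma> b = x"
    and L: "\<And>s t. a \<le> s \<Longrightarrow> s \<le> t \<Longrightarrow> t \<le> b \<Longrightarrow> fdist (\<gamma> s) (\<gamma> t) \<le> L t - L s" "L b - L a < fdist y x + e"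
    by (rule fdist_path) (rule that)
  have "\<not> fdist x y < r" using r(2)[of y] frontier_not_in[OF y(1)] by blast
  then have "s \<le> fdist (\<gamma> a) x" using s \<gamma>(3) fdist_commute[of x y] by simp
  moreover have "fdist (\<gamma> b) x \<le> s" using \<gamma>(4) fdist_refl s by simp
  \<comment> \<open>At the point of the path at distance s from x, the remaining length is at least
    s. So u has dropped by at least \<open>s - 2 * e\<close>, whereas the slow rate \<theta> permits
    only \<open>\<theta> * s\<close>.\<close>
  ultimately obtain t where t: "a \<le> t" "t \<le> b" "fdist (\<gamma> t) x = s"
    using IVT2'[of "\<lambda>t. fdist (\<gamma> t) x" b s a] continuous_fdist[OF \<gamma>(2)] \<gamma>(1) by auto
  have near: "fdist x (\<gamma> t) < r" using t(3) s fdist_commute[of x "\<gamma> t"] by simp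
  have "\<gamma> t \<in> closure \<Omega>" using r(2)[OF near] closure_subset[of \<Omega>] by blast
  then have "u (\<gamma> t) \<le> h y + fdist y (\<gamma> t)" using u_le y(1) by blast
  moreover have "fdist y (\<gamma> t) \<le> L t - L a" "s \<le> L b - L t" using L(1)[of a t] L(1)[of t b] t \<gamma> by auto
  ultimately have "u (\<gamma> t) \<le> u x + 2 * e - s" using y(2) L(2) by linarith
  moreover have "u x - \<theta> * s \<le> u (\<gamma> t)" using slow[OF near] t(3) fdist_commute[of x "\<gamma> t"] by simp
  ultimately have "s * (1 - \<theta>) \<le> 2 * e" by (simp add: algebra_simps)
  moreover have "0 < s * (1 - \<theta>)" using s p by simp
  ultimately show False unfolding e_def by linarith
qed

lemma u_viscosity_solution: "eikonal_viscosity_solution A F \<Omega> h u"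
  unfolding eikonal_viscosity_solution_def
  by (intro conjI ballI u_continuous u_subdifferential u_superdifferential u_frontier)

lemma viscosity_solution_unique:
  assumes sol: "eikonal_viscosity_solution A F \<Omega> h w" and x: "x \<in> closure \<Omega>"
  shows "w x = u x"
proof (cases "x \<in> \<Omega>")
  case False
  then have "x \<in> frontier \<Omega>" using closure_cases[OF x] by blast
  then show ?thesis using sol u_frontier unfolding eikonal_viscosity_solution_def by simp
next
  case xO: True
  have w: "continuous_on (closure \<Omega>) w"
    "\<And>x \<Delta>. x \<in> \<Omega> \<Longrightarrow> \<Delta> \<in> subdifferential A \<Omega> w x \<Longrightarrow> 1 \<le> dual_norm A F x \<Delta>"
    "\<And>x \<Delta>. x \<in> \<Omega> \<Longrightarrow> \<Delta> \<in> superdifferential A \<Omega> w x \<Longrightarrow> dual_norm A F x \<Delta> \<le> 1"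
    "\<And>x. x \<in> frontier \<Omega> \<Longrightarrow> w x = h x"
    using sol unfolding eikonal_viscosity_solution_def by blast+
  have slope: "\<exists>\<delta>>0. \<forall>y. fdist x y < \<delta> \<longrightarrow> w y \<le> w x + k * fdist x y" if "1 < k" "x \<in> \<Omega>" for k x
    by (rule superdifferential_imp_slope[OF cutoff \<Omega> that(2) w(1,3) that(1)])
  \<comment> \<open>A path from y may leave the closure of \<Omega>. Up to its last boundary point
    y' the Lipschitz condition on h is used, from there on the slope bound of w.\<close>
  have lip: "\<bar>w x - h y\<bar> \<le> fdist y x" if x: "x \<in> \<Omega>" and y: "y \<in> frontier \<Omega>" for x y
  proof (rule field_le_epsilon)
    fix e :: real assume e: "0 < e"
    define r where "r = fdist y x + e / 2"
    have r: "fdist y x < r" "0 < r" unfolding r_def using e fdist_nonneg[of y x] by auto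
    \<comment> \<open>The length bound r and the slope k each waste e/2.\<close>
    define k where "k = 1 + e / (2 * r)"
    have k: "1 < k" "k * r = r + e / 2" unfolding k_def using e r by (auto simp: field_simps)
    have k': "0 \<le> k" using k by simp
    obtain y' l where y': "y' \<in> frontier \<Omega>" "0 \<le> l" "fdist y y' + l < r" "\<bar>w x - w y'\<bar> \<le> k * l"
      by (rule slope_compare_frontier[OF \<Omega> x frontier_not_in[OF y] r(1) w(1) k'], erule slope[OF k(1)], rule that)
    have "1 * fdist y y' \<le> k * fdist y y'" using k fdist_nonneg[of y y'] by (intro mult_right_mono) auto
    then have "\<bar>h y - h y'\<bar> \<le> k * fdist y y'" using h[OF y y'(1)] by simp
    then have "\<bar>w x - h y\<bar> \<le> k * l + k * fdist y y'" using y'(4) w(4)[OF y'(1)] by simp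
    also have "\<dots> = k * (fdist y y' + l)" by (simp add: distrib_left)
    also have "\<dots> \<le> k * r" using y'(3) k' by (intro mult_left_mono) auto
    also have "\<dots> = fdist y x + e" unfolding k(2) unfolding r_def by simp
    finally show "\<bar>w x - h y\<bar> \<le> fdist y x + e" .
  qed
  interpret M: Metric_space UNIV fdist by (rule Metric_space_fdist)
  obtain x0 C0 where "\<Omega> \<subseteq> M.mcball x0 C0" using bounded unfolding M.mbounded_def by blast
  then have C0: "fdist x0 z \<le> C0" if "z \<in> \<Omega>" for z using that unfolding M.mcball_def by blast
  have C: "fdist x0 z \<le> C0 + 1" if z: "z \<in> closure \<Omega>" for z
  proof -
    obtain T where T: "open T" "z \<in> T" "\<And>y. y \<in> T \<Longrightarrow> fdist z y < 1" 
      by (rule fdist_nbhd[OF zero_less_one]) (rule that)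
    then obtain z' where "z' \<in> \<Omega>" "z' \<in> T" using z open_Int_closure_eq_empty[OF T(1), of \<Omega>] by blast
    then show ?thesis using C0[of z'] T(3)[of z'] fdist_triangle[of x0 z z'] fdist_commute[of z z'] by simp
  qed
  have diam: "fdist y z \<le> 2 * C0 + 2" if "y \<in> closure \<Omega>" "z \<in> closure \<Omega>" for y z
    using C[OF that(1)] C[OF that(2)] fdist_triangle[of y z x0] fdist_commute[of x0 y] by simp
  obtain y0 where y0: "y0 \<in> frontier \<Omega>" using frontier_nonempty by blast
  \<comment> \<open>The lower bound required by Ekeland's principle; it comes from the bounded
    diameter of the closure.\<close>
  have low: "h y0 - (2 * C0 + 2) \<le> w z" if z: "z \<in> closure \<Omega>" for z
  proof (cases "z \<in> \<Omega>")
    case True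
    then show ?thesis using lip[OF True y0] diam[OF frontier_in_closure[OF y0] z] by (simp add: abs_le_iff)
  next
    case False
    then have "z \<in> frontier \<Omega>" using closure_cases[OF z] by blast
    then show ?thesis using h[OF y0] w(4) diam[OF frontier_in_closure[OF y0] z] by (fastforce simp: abs_le_iff)
  qed
  \<comment> \<open>Ekeland's principle is applied with slope \<open>1 - e\<close>. Restoring the
    slope 1 needed to compare with u costs e times the diameter.\<close>
  have ge: "u x - e * (2 * C0 + 2) \<le> w x" if e: "0 < e" "e < 1" for e
  proof -
    define k where "k = 1 - e"
    have k: "0 < k" "0 \<le> k" "k < 1" unfolding k_def using e by auto
    obtain y where y: "y \<in> closure \<Omega>" "w y + k * fdist x y \<le> w x"
      "\<And>z. z \<in> closure \<Omega> \<Longrightarrow> w y \<le> w z + k * fdist y z"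
      by (rule ekeland[OF complete closed_closure x w(1) _ k(1)], erule low, rule that)
    have "y \<notin> \<Omega>"
    proof
      assume "y \<in> \<Omega>"
      then show False
        by (rule subdifferential_imp_slope[OF cutoff \<Omega> _ model_space_nontrivial[OF frontier_nonempty] w(1,2) k(2,3) y(3)])
    qed
    then have yf: "y \<in> frontier \<Omega>" using closure_cases[OF y(1)] by blast
    have "u x \<le> h y + fdist x y" using u_le[OF x yf] fdist_commute[of x y] by simp
    also have "\<dots> = (w y + k * fdist x y) + e * fdist x y"
      using w(4)[OF yf] unfolding k_def by (simp add: algebra_simps)
    also have "\<dots> \<le> w x + e * (2 * C0 + 2)" using y(2) diam[OF x y(1)] e by (intro add_mono mult_left_mono) auto
    finally show ?thesis by simp
  qed
  have C0': "0 \<le> C0" using C0[OF xO] fdist_nonneg order_trans by blast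
  show ?thesis
  proof (rule order_antisym)
    show "w x \<le> u x"
    proof (rule u_ge[OF x])
      fix y assume "y \<in> frontier \<Omega>"
      then show "w x \<le> h y + fdist y x" using lip[OF xO, of y] by simp
    qed
    show "u x \<le> w x"
    proof (rule field_le_epsilon)
      fix e :: real assume "0 < e"
      \<comment> \<open>The cap 1/2 keeps the slope \<open>1 - e'\<close> positive.\<close>
      define e' where "e' = min (1/2) (e / (2 * C0 + 2))"
      have e': "0 < e'" "e' < 1" unfolding e'_def using \<open>0 < e\<close> C0' by auto
      have "e' * (2 * C0 + 2) \<le> e / (2 * C0 + 2) * (2 * C0 + 2)"
        unfolding e'_def using C0' by (intro mult_right_mono) auto
      also have "\<dots> = e" using C0' by simp
      finally show "u x \<le> w x + e" using ge[OF e'] by simp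
    qed
  qed
qed

end

theorem theorem3p3:
  fixes A :: "('m::t2_space, 'x::banach) chart set"
    and F :: "'m \<Rightarrow> ('m, 'x) tangent \<Rightarrow> real"
    and \<Omega> :: "'m set"
    and h u :: "'m \<Rightarrow> real"
  assumes "C1_Finsler_manifold A F"
    and "Metric_space.mcomplete UNIV (finsler_dist A F)"
    and "\<exists>b :: 'x \<Rightarrow> real. C1_Lipschitz_bump b"
    and "open \<Omega>" and "\<Omega> \<noteq> {}"
    and "Metric_space.mbounded UNIV (finsler_dist A F) \<Omega>"
    and "frontier \<Omega> \<noteq> {}"
    and "\<forall>x\<in>frontier \<Omega>. \<forall>y\<in>frontier \<Omega>. \<bar>h x - h y\<bar> \<le> finsler_dist A F x y"
    and "\<forall>x\<in>closure \<Omega>. u x = (INF y\<in>frontier \<Omega>. h y + finsler_dist A F y x)"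
  shows "eikonal_viscosity_solution A F \<Omega> h u \<and>
    (\<forall>w. eikonal_viscosity_solution A F \<Omega> h w \<longrightarrow> (\<forall>x\<in>closure \<Omega>. w x = u x))"
proof -
  obtain \<beta> :: "'x \<Rightarrow> real" and \<beta>' B \<delta> where cut: "smooth_cutoff \<beta> \<beta>' B \<delta>"
    using assms(3) ex_smooth_cutoff by blast
  interpret C1_Finsler_manifold A F by (rule assms(1))
  interpret eikonal_problem A F \<beta> \<beta>' B \<delta> \<Omega> h u
    by (intro eikonal_problem.intro eikonal_problem_axioms.intro assms(1,2,4,6,7) cut)
       (use assms(8,9) in simp_all)
  show ?thesis using u_viscosity_solution viscosity_solution_unique by blast
qed

end
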